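(* Let $\Gamma$ be an infinite group with property (T) and let $(Q,\epsilon)$ be a Kazhdan pair for $\Gamma$, where $Q$ contains an element of infinite order. Then if $\mathrm{card}(Q)=n$, $$C(\Gamma)\le n-\frac{\epsilon^2}{2}.$$ In particular, if $\Gamma$ is torsion-free and $2$-generated, then $C(\Gamma)\le 2-\frac{(\epsilon_2)^2}{2}$, where $\epsilon_2$ is the supremum of the $\epsilon$ such that $(Q,\epsilon)$ is a Kazhdan pair for $\Gamma$ for some $Q$ with $\mathrm{card}(Q)=2$.
   Context: A Kazhdan pair for a countable group $\Gamma$ is a pair $(Q,\epsilon)$ with $Q\subseteq\Gamma$ a finite generating set and $\epsilon>0$ such that for any unitary representation $\pi$ of $\Gamma$ on a Hilbert space $\mathcal H$, if some $\xi\in\mathcal H$ satisfies $\|\pi(\gamma)(\xi)-\xi\|<\epsilon\|\xi\|$ for all $\gamma\in Q$, then $\pi$ has a non-zero invariant vector; $\Gamma$ has property (T) iff it has a Kazhdan pair. $C(\Gamma)$ is the cost of $\Gamma$ (in the sense of Gaboriau): the infimum of $C_\mu(E^X_\Gamma)$ over all free measure preserving actions of $\Gamma$ on standard probability spaces $(X,\mu)$, where the cost $C_\mu(E)$ of a countable measure preserving equivalence relation $E$ is the infimum over all graphings $\mathcal G$ of $E$ (Borel graphs on $X$ whose connected components are the $E$-classes a.e.) of $\frac12\int_X \deg_{\mathcal G}(x)\,d\mu(x)$. *)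

theory Defs
  imports
    "HOL-Probability.Probability"
    "HOL-Algebra.Module"
    "HOL-Algebra.Generated_Groups"
    "HOL-Algebra.Multiplicative_Group"
    "HOL-Algebra.Group_Action"
begin

section \<open>Unitary representations and Kazhdan pairs\<close>

definition complex_ring :: "complex ring" where
  "complex_ring = \<lparr>carrier = UNIV, mult = (*), one = 1, zero = 0, add = (+)\<rparr>"

text \<open>
  Hilbert spaces are modelled with explicit carriers (a type-class formulation would not allow
  quantifying over all of them inside a definition). The fields \<open>mult\<close> and \<open>one\<close> inherited from the
  record of modules play no role.
\<close>

record 'h inner_space = "(complex, 'h) module" +
  cinner :: "'h \<Rightarrow> 'h \<Rightarrow> complex"

definition hnorm :: "('h, 'm) inner_space_scheme \<Rightarrow> 'h \<Rightarrow> real" where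
  "hnorm H x = sqrt (Re (cinner H x x))"

locale hilbert_space = Module.module complex_ring H
    for H :: "('h, 'm) inner_space_scheme" (structure) +
  assumes cinner_add_left:
      "\<lbrakk>x \<in> carrier H; y \<in> carrier H; z \<in> carrier H\<rbrakk>
        \<Longrightarrow> cinner H (x \<oplus> y) z = cinner H x z + cinner H y z"
    and cinner_smult_left:
      "\<lbrakk>x \<in> carrier H; y \<in> carrier H\<rbrakk> \<Longrightarrow> cinner H (c \<odot> x) y = c * cinner H x y"
    and cinner_commute:
      "\<lbrakk>x \<in> carrier H; y \<in> carrier H\<rbrakk> \<Longrightarrow> cinner H x y = cnj (cinner H y x)"
    and cinner_nonneg: "x \<in> carrier H \<Longrightarrow> 0 \<le> Re (cinner H x x)"
    and cinner_definite: "\<lbrakk>x \<in> carrier H; cinner H x x = 0\<rbrakk> \<Longrightarrow> x = \<zero>"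
    and complete:
      "\<lbrakk>\<And>n. s n \<in> carrier H; \<And>e. e > 0 \<Longrightarrow> \<exists>N. \<forall>m\<ge>N. \<forall>n\<ge>N. hnorm H (s m \<ominus> s n) < e\<rbrakk>
        \<Longrightarrow> \<exists>l\<in>carrier H. (\<lambda>n::nat. hnorm H (s n \<ominus> l)) \<longlonglongrightarrow> 0"

definition unitary_operator :: "('h, 'm) inner_space_scheme \<Rightarrow> ('h \<Rightarrow> 'h) \<Rightarrow> bool" where
  "unitary_operator H U \<longleftrightarrow>
     bij_betw U (carrier H) (carrier H) \<and>
     (\<forall>x\<in>carrier H. \<forall>y\<in>carrier H. U (x \<oplus>\<^bsub>H\<^esub> y) = U x \<oplus>\<^bsub>H\<^esub> U y) \<and>
     (\<forall>c. \<forall>x\<in>carrier H. U (c \<odot>\<^bsub>H\<^esub> x) = c \<odot>\<^bsub>H\<^esub> U x) \<and>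
     (\<forall>x\<in>carrier H. \<forall>y\<in>carrier H. cinner H (U x) (U y) = cinner H x y)"

definition unitary_representation ::
  "('g, 'b) monoid_scheme \<Rightarrow> ('h, 'm) inner_space_scheme \<Rightarrow> ('g \<Rightarrow> 'h \<Rightarrow> 'h) \<Rightarrow> bool" where
  "unitary_representation G H \<pi> \<longleftrightarrow>
     (\<forall>g\<in>carrier G. unitary_operator H (\<pi> g)) \<and>
     (\<forall>g\<in>carrier G. \<forall>h\<in>carrier G. \<forall>x\<in>carrier H. \<pi> (g \<otimes>\<^bsub>G\<^esub> h) x = \<pi> g (\<pi> h x))"

definition has_almost_invariant_vector where
  "has_almost_invariant_vector H \<pi> Q \<epsilon> \<longleftrightarrow>
     (\<exists>\<xi>\<in>carrier H. \<forall>\<gamma>\<in>Q. hnorm H (\<pi> \<gamma> \<xi> \<ominus>\<^bsub>H\<^esub> \<xi>) < \<epsilon> * hnorm H \<xi>)"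

definition has_invariant_vector where
  "has_invariant_vector G H \<pi> \<longleftrightarrow>
     (\<exists>\<xi>\<in>carrier H. \<xi> \<noteq> \<zero>\<^bsub>H\<^esub> \<and> (\<forall>\<gamma>\<in>carrier G. \<pi> \<gamma> \<xi> = \<xi>))"

text \<open>
  HOL cannot quantify over all types, so the definition ranges over the Hilbert spaces whose
  carrier is a set of reals.  This is no restriction: see \<open>kazhdan_pair_any_type\<close> below.
\<close>

definition kazhdan_pair :: "('g, 'b) monoid_scheme \<Rightarrow> 'g set \<Rightarrow> real \<Rightarrow> bool" where
  "kazhdan_pair G Q \<epsilon> \<longleftrightarrow>
     finite Q \<and> Q \<subseteq> carrier G \<and> generate G Q = carrier G \<and> \<epsilon> > 0 \<and>
     (\<forall>(H :: real inner_space) \<pi>.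
        hilbert_space H \<and> unitary_representation G H \<pi> \<and> has_almost_invariant_vector H \<pi> Q \<epsilon>
        \<longrightarrow> has_invariant_vector G H \<pi>)"

definition property_T :: "('g, 'b) monoid_scheme \<Rightarrow> bool" where
  "property_T G \<longleftrightarrow> (\<exists>Q \<epsilon>. kazhdan_pair G Q \<epsilon>)"

text \<open>
  The supremum is one of real numbers: for infinite \<open>G\<close> the set is bounded above by \<open>2\<close>, because
  the regular representation has no non-zero invariant vector.
\<close>

definition kazhdan_constant :: "('g, 'b) monoid_scheme \<Rightarrow> nat \<Rightarrow> real" where
  "kazhdan_constant G n = Sup {\<epsilon>. \<exists>Q. card Q = n \<and> kazhdan_pair G Q \<epsilon>}"


section \<open>Cost\<close>

definition standard_borel :: "'x measure \<Rightarrow> bool" where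
  "standard_borel M \<longleftrightarrow>
     (\<exists>T. completely_metrizable_space T \<and> second_countable T \<and> topspace T = space M \<and>
          sets M = sigma_sets (space M) {U. openin T U})"

definition standard_prob_space :: "'x measure \<Rightarrow> bool" where
  "standard_prob_space M \<longleftrightarrow> prob_space M \<and> standard_borel M"

definition free_pmp_action ::
  "('g, 'b) monoid_scheme \<Rightarrow> 'x measure \<Rightarrow> ('g \<Rightarrow> 'x \<Rightarrow> 'x) \<Rightarrow> bool" where
  "free_pmp_action G M \<alpha> \<longleftrightarrow>
     group_action G (space M) \<alpha> \<and>
     (\<forall>g\<in>carrier G. \<alpha> g \<in> measurable M M \<and> distr M M (\<alpha> g) = M) \<and>
     (AE x in M. \<forall>g\<in>carrier G. g \<noteq> \<one>\<^bsub>G\<^esub> \<longrightarrow> \<alpha> g x \<noteq> x)"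

definition orbit_relation ::
  "('g, 'b) monoid_scheme \<Rightarrow> 'x measure \<Rightarrow> ('g \<Rightarrow> 'x \<Rightarrow> 'x) \<Rightarrow> ('x \<times> 'x) set" where
  "orbit_relation G M \<alpha> = {(x, y). x \<in> space M \<and> y \<in> orbit G \<alpha> x}"

definition borel_graph :: "'x measure \<Rightarrow> ('x \<times> 'x) set \<Rightarrow> bool" where
  "borel_graph M \<G> \<longleftrightarrow> \<G> \<in> sets (M \<Otimes>\<^sub>M M) \<and> sym \<G> \<and> irrefl \<G>"

text \<open>The connected component of \<open>x\<close> in the graph \<open>\<G>\<close> is \<open>\<G>\<^sup>* `` {x}\<close>.\<close>

definition graphing :: "'x measure \<Rightarrow> ('x \<times> 'x) set \<Rightarrow> ('x \<times> 'x) set \<Rightarrow> bool" where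
  "graphing M E \<G> \<longleftrightarrow> borel_graph M \<G> \<and> (AE x in M. \<G>\<^sup>* `` {x} = E `` {x})"

text \<open>Counting measure, so that vertices of infinite degree have degree \<open>\<infinity>\<close>.\<close>

definition graph_degree :: "('x \<times> 'x) set \<Rightarrow> 'x \<Rightarrow> ennreal" where
  "graph_degree \<G> x = emeasure (count_space UNIV) (\<G> `` {x})"

definition cost_rel :: "'x measure \<Rightarrow> ('x \<times> 'x) set \<Rightarrow> ennreal" where
  "cost_rel M E = (INF \<G>\<in>{\<G>. graphing M E \<G>}. (\<integral>\<^sup>+ x. graph_degree \<G> x \<partial>M) / 2)"

text \<open>
  As for Hilbert spaces, taking only standard probability spaces on sets of reals is no
  restriction: see \<open>group_cost_le_any_type\<close> below.
\<close>

definition group_cost :: "('g, 'b) monoid_scheme \<Rightarrow> ennreal" where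
  "group_cost G =
     (INF (M, \<alpha>)\<in>{(M :: real measure, \<alpha>). standard_prob_space M \<and> free_pmp_action G M \<alpha>}.
        cost_rel M (orbit_relation G M \<alpha>))"


section \<open>Conditions on groups\<close>

text \<open>\<open>group.ord G \<gamma> = 0\<close> expresses that \<open>\<gamma>\<close> has infinite order, cf. \<open>group.ord_eq_0\<close>.\<close>

definition torsion_free_group :: "('g, 'b) monoid_scheme \<Rightarrow> bool" where
  "torsion_free_group G \<longleftrightarrow> (\<forall>\<gamma>\<in>carrier G. \<gamma> \<noteq> \<one>\<^bsub>G\<^esub> \<longrightarrow> group.ord G \<gamma> = 0)"

definition two_generated :: "('g, 'b) monoid_scheme \<Rightarrow> bool" where
  "two_generated G \<longleftrightarrow> (\<exists>a\<in>carrier G. \<exists>b\<in>carrier G. generate G {a, b} = carrier G)"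


section \<open>Kazhdan pairs: independence of the carrier type\<close>

context hilbert_space
begin

lemma scalars [simp]:
  "carrier complex_ring = UNIV" "a \<oplus>\<^bsub>complex_ring\<^esub> b = a + b" "a \<otimes>\<^bsub>complex_ring\<^esub> b = a * b"
  "\<one>\<^bsub>complex_ring\<^esub> = 1" "\<zero>\<^bsub>complex_ring\<^esub> = 0"
  by (simp_all add: complex_ring_def)

lemma scalar_uminus [simp]: "\<ominus>\<^bsub>complex_ring\<^esub> a = - a"
  by (rule R.minus_equality) auto

lemma smult_carrier [simp, intro]: "x \<in> carrier H \<Longrightarrow> c \<odot> x \<in> carrier H"
  using smult_closed by simp

lemma minus_eq_smult:
  assumes "x \<in> carrier H" "y \<in> carrier H"
  shows "x \<ominus> y = x \<oplus> (-1) \<odot> y"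
  using smult_l_minus[of "1" y] smult_one[of y] assms by (simp add: M.minus_eq)

lemma cinner_add_right:
  assumes "x \<in> carrier H" "y \<in> carrier H" "z \<in> carrier H"
  shows "cinner H z (x \<oplus> y) = cinner H z x + cinner H z y"
proof -
  have "cinner H z (x \<oplus> y) = cnj (cinner H (x \<oplus> y) z)"
    using assms by (intro cinner_commute) auto
  also have "\<dots> = cnj (cinner H x z) + cnj (cinner H y z)"
    using assms by (simp add: cinner_add_left)
  also have "\<dots> = cinner H z x + cinner H z y"
    using assms by (simp add: cinner_commute[of z])
  finally show ?thesis .
qed

lemma cinner_smult_right:
  assumes "x \<in> carrier H" "z \<in> carrier H"
  shows "cinner H z (c \<odot> x) = cnj c * cinner H z x"
proof -
  have "cinner H z (c \<odot> x) = cnj (cinner H (c \<odot> x) z)"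
    using assms by (intro cinner_commute) auto
  also have "\<dots> = cnj c * cnj (cinner H x z)"
    using assms by (simp add: cinner_smult_left)
  finally show ?thesis
    using assms by (simp add: cinner_commute[of z])
qed

lemma cinner_self:
  assumes "x \<in> carrier H"
  shows "cinner H x x = of_real ((hnorm H x)\<^sup>2)"
proof -
  have "Im (cinner H x x) = 0"
    using cinner_commute[OF assms assms] by (metis complex_cnj_cancel_iff Reals_cnj_iff complex_is_Real_iff)
  then show ?thesis
    using cinner_nonneg[OF assms] by (simp add: hnorm_def complex_eq_iff)
qed

lemma hnorm_nonneg [simp]: "x \<in> carrier H \<Longrightarrow> 0 \<le> hnorm H x"
  by (simp add: hnorm_def cinner_nonneg)

lemma hnorm_power2: "x \<in> carrier H \<Longrightarrow> (hnorm H x)\<^sup>2 = Re (cinner H x x)"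
  by (simp add: hnorm_def cinner_nonneg)

lemma hnorm_eq_0: "\<lbrakk>x \<in> carrier H; hnorm H x = 0\<rbrakk> \<Longrightarrow> x = \<zero>"
  using cinner_self cinner_definite by simp

lemma hnorm_smult: 
  assumes "x \<in> carrier H" shows "hnorm H (c \<odot> x) = cmod c * hnorm H x"
proof -
  have "cinner H (c \<odot> x) (c \<odot> x) = (c * cnj c) * cinner H x x"
    using assms by (simp add: cinner_smult_left cinner_smult_right)
  also have "\<dots> = of_real ((cmod c * hnorm H x)\<^sup>2)"
    unfolding complex_norm_square[symmetric] cinner_self[OF assms] by (simp add: power_mult_distrib)
  finally show ?thesis
    using assms by (simp add: hnorm_def[of H "c \<odot> x"] del: of_real_power)
qed

lemma Re_cinner_le:
  assumes [simp]: "x \<in> carrier H" "y \<in> carrier H"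
  shows "Re (cinner H x y) \<le> hnorm H x * hnorm H y"
proof -
  let ?r = "Re (cinner H x y)"
  have q: "0 \<le> (hnorm H x)\<^sup>2 + 2 * t * ?r + t\<^sup>2 * (hnorm H y)\<^sup>2" for t :: real
  proof -
    have "cinner H y x = cnj (cinner H x y)"
      by (rule cinner_commute) auto
    moreover have "0 \<le> Re (cinner H (x \<oplus> of_real t \<odot> y) (x \<oplus> of_real t \<odot> y))"
      by (rule cinner_nonneg) simp
    ultimately show ?thesis
      by (simp add: cinner_add_left cinner_add_right cinner_smult_left cinner_smult_right
          hnorm_power2 algebra_simps) (simp add: power2_eq_square mult_ac)
  qed
  have "?r\<^sup>2 \<le> (hnorm H x)\<^sup>2 * (hnorm H y)\<^sup>2"
  proof (cases "hnorm H y = 0")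
    case True
    then have "y = \<zero>" by (simp add: hnorm_eq_0)
    then have "y = 0 \<odot> y" by (simp add: smult_l_null smult_r_null)
    then have "cinner H x y = 0"
      using cinner_smult_right[of y x 0] by simp
    then show ?thesis by simp
  next
    case False
    then have p: "(hnorm H y)\<^sup>2 > 0" by simp
    have "0 \<le> (hnorm H x)\<^sup>2 - ?r\<^sup>2 / (hnorm H y)\<^sup>2"
      using q[of "- ?r / (hnorm H y)\<^sup>2"] False by (simp add: field_simps power2_eq_square)
    with p show ?thesis by (simp add: field_simps)
  qed
  then have "?r\<^sup>2 \<le> (hnorm H x * hnorm H y)\<^sup>2"
    by (simp add: power_mult_distrib)
  then show ?thesis
    by (rule power2_le_imp_le) simp
qed

lemma hnorm_triangle:
  assumes [simp]: "x \<in> carrier H" "y \<in> carrier H"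
  shows "hnorm H (x \<oplus> y) \<le> hnorm H x + hnorm H y"
proof -
  have "cinner H y x = cnj (cinner H x y)"
    by (rule cinner_commute) auto
  then have "Re (cinner H (x \<oplus> y) (x \<oplus> y)) = (hnorm H x)\<^sup>2 + 2 * Re (cinner H x y) + (hnorm H y)\<^sup>2"
    by (simp add: cinner_add_left cinner_add_right hnorm_power2)
  also have "\<dots> \<le> (hnorm H x + hnorm H y)\<^sup>2"
    using Re_cinner_le[of x y] by (simp add: power2_sum)
  finally have "(hnorm H (x \<oplus> y))\<^sup>2 \<le> (hnorm H x + hnorm H y)\<^sup>2"
    by (simp add: hnorm_power2)
  then show ?thesis
    by (rule power2_le_imp_le) simp
qed

lemma hnorm_zero [simp]: "hnorm H \<zero> = 0"
  using hnorm_smult[of \<zero> 0] by (simp add: smult_r_null)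

lemma hdist_self: "x \<in> carrier H \<Longrightarrow> hnorm H (x \<ominus> x) = 0"
  by (simp add: M.r_neg M.minus_eq)

lemma hdist_commute:
  assumes [simp]: "x \<in> carrier H" "y \<in> carrier H"
  shows "hnorm H (x \<ominus> y) = hnorm H (y \<ominus> x)"
proof -
  have "x \<ominus> y = (-1) \<odot> (y \<ominus> x)"
    using smult_l_minus[of 1 "y \<ominus> x"] smult_one[of "y \<ominus> x"]
    by (simp add: M.minus_eq M.minus_add M.a_ac)
  then show ?thesis by (simp add: hnorm_smult)
qed

lemma hdist_triangle:
  assumes [simp]: "x \<in> carrier H" "y \<in> carrier H" "z \<in> carrier H"
  shows "hnorm H (x \<ominus> z) \<le> hnorm H (x \<ominus> y) + hnorm H (y \<ominus> z)"
proof -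
  have "x \<ominus> z = (x \<ominus> y) \<oplus> (y \<ominus> z)"
    by (simp add: M.minus_eq M.a_assoc M.r_neg1)
  then show ?thesis
    using hnorm_triangle[of "x \<ominus> y" "y \<ominus> z"] by simp
qed

lemma minus_eq_0:
  assumes [simp]: "x \<in> carrier H" "y \<in> carrier H" and "x \<ominus> y = \<zero>"
  shows "x = y"
proof -
  have "x = (x \<ominus> y) \<oplus> y" by (simp add: M.minus_eq M.a_assoc M.l_neg)
  then show ?thesis by (simp add: assms(3))
qed

lemma hdist_eq_0:
  assumes [simp]: "x \<in> carrier H" "y \<in> carrier H" and "hnorm H (x \<ominus> y) = 0"
  shows "x = y"
  by (rule minus_eq_0[OF assms(1,2) hnorm_eq_0[OF _ assms(3)]]) simp

lemma hdist_add:
  assumes [simp]: "x \<in> carrier H" "y \<in> carrier H" "a \<in> carrier H" "b \<in> carrier H"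
  shows "hnorm H ((x \<oplus> y) \<ominus> (a \<oplus> b)) \<le> hnorm H (x \<ominus> a) + hnorm H (y \<ominus> b)"
proof -
  have "(x \<oplus> y) \<ominus> (a \<oplus> b) = (x \<ominus> a) \<oplus> (y \<ominus> b)"
    by (simp add: M.minus_eq M.minus_add M.a_ac)
  then show ?thesis
    using hnorm_triangle[of "x \<ominus> a" "y \<ominus> b"] by simp
qed

lemma hdist_smult:
  assumes [simp]: "x \<in> carrier H" "a \<in> carrier H"
  shows "hnorm H (c \<odot> x \<ominus> c \<odot> a) = cmod c * hnorm H (x \<ominus> a)"
proof -
  have "c \<odot> x \<ominus> c \<odot> a = c \<odot> (x \<ominus> a)"
    using smult_r_distr[of c x "\<ominus> a"] smult_r_minus[of c a] by (simp add: M.minus_eq)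
  then show ?thesis by (simp add: hnorm_smult)
qed

lemma hdist_smult_scalar:
  assumes [simp]: "x \<in> carrier H"
  shows "hnorm H (c \<odot> x \<ominus> d \<odot> x) = cmod (c - d) * hnorm H x"
proof -
  have "c \<odot> x \<ominus> d \<odot> x = (c - d) \<odot> x"
    using smult_l_distr[of c "- d" x] smult_l_minus[of d x] by (simp add: M.minus_eq)
  then show ?thesis by (simp add: hnorm_smult)
qed

end

definition transport_subspace ::
  "('h, 'm) inner_space_scheme \<Rightarrow> 'h set \<Rightarrow> ('h \<Rightarrow> 'k) \<Rightarrow> 'k inner_space" where
  "transport_subspace H K f =
     (let g = inv_into K f in
      \<lparr>carrier = f ` K, mult = undefined, one = undefined, zero = f \<zero>\<^bsub>H\<^esub>,
       add = (\<lambda>a b. f (g a \<oplus>\<^bsub>H\<^esub> g b)), smult = (\<lambda>c a. f (c \<odot>\<^bsub>H\<^esub> g a)),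
       cinner = (\<lambda>a b. cinner H (g a) (g b))\<rparr>)"

lemma hilbert_space_transport:
  fixes H :: "('h, 'm) inner_space_scheme" and f :: "'h \<Rightarrow> 'k"
  assumes "hilbert_space H" and inj: "inj_on f K" and sub: "K \<subseteq> carrier H"
    and zero: "\<zero>\<^bsub>H\<^esub> \<in> K"
    and add: "\<And>x y. \<lbrakk>x \<in> K; y \<in> K\<rbrakk> \<Longrightarrow> x \<oplus>\<^bsub>H\<^esub> y \<in> K"
    and smult: "\<And>c x. x \<in> K \<Longrightarrow> c \<odot>\<^bsub>H\<^esub> x \<in> K"
    and closed: "\<And>s l. \<lbrakk>\<And>n::nat. s n \<in> K; l \<in> carrier H; (\<lambda>n. hnorm H (s n \<ominus>\<^bsub>H\<^esub> l)) \<longlonglongrightarrow> 0\<rbrakk> \<Longrightarrow> l \<in> K"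
  shows "hilbert_space (transport_subspace H K f)" (is "hilbert_space ?T")
    and "\<And>x y. \<lbrakk>x \<in> K; y \<in> K\<rbrakk> \<Longrightarrow> f x \<ominus>\<^bsub>transport_subspace H K f\<^esub> f y = f (x \<ominus>\<^bsub>H\<^esub> y)"
    and "\<And>x. x \<in> K \<Longrightarrow> hnorm (transport_subspace H K f) (f x) = hnorm H x"
proof -
  interpret H: hilbert_space H by fact
  have inv [simp]: "x \<in> K \<Longrightarrow> inv_into K f (f x) = x" for x
    using inj by simp
  have car [simp]: "x \<in> K \<Longrightarrow> x \<in> carrier H" for x using sub by auto
  have T [simp]: "carrier ?T = f ` K" "\<zero>\<^bsub>?T\<^esub> = f \<zero>\<^bsub>H\<^esub>"
    "\<And>x y. \<lbrakk>x \<in> K; y \<in> K\<rbrakk> \<Longrightarrow> f x \<oplus>\<^bsub>?T\<^esub> f y = f (x \<oplus>\<^bsub>H\<^esub> y)"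
    "\<And>c x. x \<in> K \<Longrightarrow> c \<odot>\<^bsub>?T\<^esub> f x = f (c \<odot>\<^bsub>H\<^esub> x)"
    "\<And>x y. \<lbrakk>x \<in> K; y \<in> K\<rbrakk> \<Longrightarrow> cinner ?T (f x) (f y) = cinner H x y"
    by (simp_all add: transport_subspace_def Let_def)
  note [simp] = zero add smult
  show nrm: "\<And>x. x \<in> K \<Longrightarrow> hnorm ?T (f x) = hnorm H x"
    by (simp add: hnorm_def)
  have ab: "abelian_group ?T"
  proof (rule abelian_groupI)
    show "\<exists>y\<in>carrier ?T. y \<oplus>\<^bsub>?T\<^esub> x = \<zero>\<^bsub>?T\<^esub>" if x: "x \<in> carrier ?T" for x
    proof -
      obtain u where u: "u \<in> K" "x = f u" using x by auto
      have "((-1) \<odot>\<^bsub>H\<^esub> u) \<oplus>\<^bsub>H\<^esub> u = \<zero>\<^bsub>H\<^esub>"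
        using H.minus_eq_smult[of u u] u by (simp add: H.M.a_comm H.M.minus_eq H.M.r_neg)
      with u show ?thesis by (intro bexI[of _ "f ((-1) \<odot>\<^bsub>H\<^esub> u)"]) auto
    qed
  qed (auto simp: H.M.a_ac)
  have cr: "cring complex_ring" by (rule H.R.is_cring)
  have md: "Module.module complex_ring ?T"
    by (rule moduleI[OF cr ab])
       (use H.smult_l_distr H.smult_r_distr H.smult_assoc1 H.smult_one in auto)
  show mns: "\<And>x y. \<lbrakk>x \<in> K; y \<in> K\<rbrakk> \<Longrightarrow> f x \<ominus>\<^bsub>?T\<^esub> f y = f (x \<ominus>\<^bsub>H\<^esub> y)"
  proof -
    fix x y assume xy: "x \<in> K" "y \<in> K"
    interpret T: Module.module complex_ring ?T by (rule md)
    have "f x \<ominus>\<^bsub>?T\<^esub> f y = f x \<oplus>\<^bsub>?T\<^esub> (-1) \<odot>\<^bsub>?T\<^esub> f y"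
      using T.smult_l_minus[of "1" "f y"] T.smult_one[of "f y"] xy 
      by (simp add: T.M.minus_eq del: T(3-))
    also have "\<dots> = f (x \<ominus>\<^bsub>H\<^esub> y)"
      using xy by (simp add: H.minus_eq_smult)
    finally show "f x \<ominus>\<^bsub>?T\<^esub> f y = f (x \<ominus>\<^bsub>H\<^esub> y)" .
  qed
  have mK: "x \<ominus>\<^bsub>H\<^esub> y \<in> K" if "x \<in> K" "y \<in> K" for x y
    using that by (simp add: H.minus_eq_smult)
  show "hilbert_space ?T"
  proof (rule hilbert_space.intro[OF md], unfold_locales)
    fix s :: "nat \<Rightarrow> _" assume s: "\<And>n. s n \<in> carrier ?T"
      and c: "\<And>e. e > 0 \<Longrightarrow> \<exists>N. \<forall>m\<ge>N. \<forall>n\<ge>N. hnorm ?T (s m \<ominus>\<^bsub>?T\<^esub> s n) < e"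
    define u where "u n = inv_into K f (s n)" for n
    have u: "u n \<in> K" "s n = f (u n)" for n
      using s[of n] unfolding u_def by (auto simp: inv_into_into f_inv_into_f)
    have "\<exists>l\<in>carrier H. (\<lambda>n. hnorm H (u n \<ominus>\<^bsub>H\<^esub> l)) \<longlonglongrightarrow> 0"
      using c by (intro H.complete) (auto simp: u mns nrm mK)
    then obtain l where l: "l \<in> carrier H" "(\<lambda>n. hnorm H (u n \<ominus>\<^bsub>H\<^esub> l)) \<longlonglongrightarrow> 0" by auto
    then have "l \<in> K" using closed[OF u(1)] by (simp only:)
    have "hnorm ?T (s n \<ominus>\<^bsub>?T\<^esub> f l) = hnorm H (u n \<ominus>\<^bsub>H\<^esub> l)" for n
      unfolding u(2) using \<open>l \<in> K\<close> u(1) by (simp only: mns nrm mK)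
    then have "(\<lambda>n. hnorm ?T (s n \<ominus>\<^bsub>?T\<^esub> f l)) \<longlonglongrightarrow> 0"
      using l(2) by (simp only:)
    moreover have "f l \<in> carrier ?T" unfolding T(1) using \<open>l \<in> K\<close> by (rule imageI)
    ultimately show "\<exists>l\<in>carrier ?T. (\<lambda>n. hnorm ?T (s n \<ominus>\<^bsub>?T\<^esub> l)) \<longlonglongrightarrow> 0"
      by (rule bexI)
  next
    fix x y assume "x \<in> carrier ?T" "y \<in> carrier ?T"
    then obtain a b where "a \<in> K" "b \<in> K" "x = f a" "y = f b" by auto
    then show "cinner ?T x y = cnj (cinner ?T y x)"
      using H.cinner_commute[of a b] by simp
  next
    fix x y z assume "x \<in> carrier ?T" "y \<in> carrier ?T" "z \<in> carrier ?T"
    then show "cinner ?T (x \<oplus>\<^bsub>?T\<^esub> y) z = cinner ?T x z + cinner ?T y z"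
      by (auto simp: H.cinner_add_left)
  next
    fix x y c assume "x \<in> carrier ?T" "y \<in> carrier ?T"
    then show "cinner ?T (c \<odot>\<^bsub>?T\<^esub> x) y = c * cinner ?T x y"
      by (auto simp: H.cinner_smult_left)
  next
    fix x assume "x \<in> carrier ?T"
    then show "0 \<le> Re (cinner ?T x x)"
      by (auto simp: H.cinner_nonneg)
  next
    fix x assume "x \<in> carrier ?T" "cinner ?T x x = 0"
    then show "x = \<zero>\<^bsub>?T\<^esub>"
      using H.cinner_definite[OF car] by fastforce
  qed
qed

text \<open>The closure of a set of vectors.\<close>

definition hclosure :: "('h, 'm) inner_space_scheme \<Rightarrow> 'h set \<Rightarrow> 'h set" where
  "hclosure H S = {x\<in>carrier H. \<forall>e>0. \<exists>s\<in>S. hnorm H (s \<ominus>\<^bsub>H\<^esub> x) < e}"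

lemma (in hilbert_space) hclosure_subset:
  assumes "S \<subseteq> carrier H" shows "S \<subseteq> hclosure H S"
proof
  fix x assume x: "x \<in> S"
  then have "hnorm H (x \<ominus> x) = 0" using assms by (auto simp: hdist_self)
  then show "x \<in> hclosure H S" using x assms by (force simp: hclosure_def)
qed

lemma (in hilbert_space) hclosure_add:
  assumes S: "S \<subseteq> carrier H" "\<And>x y. \<lbrakk>x \<in> S; y \<in> S\<rbrakk> \<Longrightarrow> x \<oplus> y \<in> S"
    and xy: "x \<in> hclosure H S" "y \<in> hclosure H S"
  shows "x \<oplus> y \<in> hclosure H S"
proof -
  have car: "x \<in> carrier H" "y \<in> carrier H" using xy by (auto simp: hclosure_def)
  have "\<exists>s\<in>S. hnorm H (s \<ominus> (x \<oplus> y)) < e" if "e > 0" for e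
  proof -
    have "e/2 > 0" using that by simp
    then obtain s t where st: "s \<in> S" "hnorm H (s \<ominus> x) < e/2" "t \<in> S" "hnorm H (t \<ominus> y) < e/2"
      using xy unfolding hclosure_def by blast
    then have "hnorm H ((s \<oplus> t) \<ominus> (x \<oplus> y)) < e"
      using hdist_add[of s t x y] S(1) car by force
    then show ?thesis using st S(2) by blast
  qed
  then show ?thesis using car by (simp add: hclosure_def)
qed

lemma (in hilbert_space) hclosure_smult:
  assumes S: "S \<subseteq> carrier H" "\<And>q x. \<lbrakk>q \<in> D; x \<in> S\<rbrakk> \<Longrightarrow> q \<odot> x \<in> S"
    and D: "\<And>c e. e > 0 \<Longrightarrow> \<exists>q\<in>D. cmod (q - c) < e"
    and x: "x \<in> hclosure H S"
  shows "c \<odot> x \<in> hclosure H S"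
proof -
  have car: "x \<in> carrier H" using x by (auto simp: hclosure_def)
  have "\<exists>s\<in>S. hnorm H (s \<ominus> c \<odot> x) < e" if e: "e > 0" for e
  proof -
    have n: "hnorm H x \<ge> 0" using car by simp
    obtain q where q: "q \<in> D" "cmod (q - c) < e / 2 / (hnorm H x + 1)"
      using D[of "e / 2 / (hnorm H x + 1)" c] e n by auto
    have "e / 2 / (cmod q + 1) > 0" using e by (simp add: add_nonneg_pos)
    then obtain s where s: "s \<in> S" "hnorm H (s \<ominus> x) < e / 2 / (cmod q + 1)"
      using x unfolding hclosure_def by blast
    have scar: "s \<in> carrier H" using s S by auto
    have 1: "cmod q * hnorm H (s \<ominus> x) < e / 2"
    proof -
      have "cmod q * hnorm H (s \<ominus> x) \<le> (cmod q + 1) * hnorm H (s \<ominus> x)"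
        using scar car by (intro mult_right_mono) auto
      also have "\<dots> < (cmod q + 1) * (e / 2 / (cmod q + 1))"
        using s by (intro mult_strict_left_mono) (auto simp: add_nonneg_pos)
      also have "\<dots> = e / 2"
      proof -
        have "p * (a / p) = a" if "p \<noteq> 0" for p a :: real using that by simp
        moreover have "cmod q + 1 \<noteq> 0" using norm_ge_zero[of q] by linarith
        ultimately show ?thesis by blast
      qed
      finally show ?thesis .
    qed
    have 2: "cmod (q - c) * hnorm H x \<le> e / 2"
    proof -
      have "cmod (q - c) * hnorm H x \<le> (e / 2 / (hnorm H x + 1)) * (hnorm H x + 1)"
        using q n e by (intro mult_mono) auto
      also have "\<dots> = e / 2"
      proof -
        have "a / p * p = a" if "p \<noteq> 0" for p a :: real using that by simp
        moreover have "hnorm H x + 1 \<noteq> 0" using n by linarith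
        ultimately show ?thesis by blast
      qed
      finally show ?thesis .
    qed
    have "hnorm H (q \<odot> s \<ominus> c \<odot> x) \<le> hnorm H (q \<odot> s \<ominus> q \<odot> x) + hnorm H (q \<odot> x \<ominus> c \<odot> x)"
      using scar car by (intro hdist_triangle) auto
    also have "\<dots> = cmod q * hnorm H (s \<ominus> x) + cmod (q - c) * hnorm H x"
      using scar car by (simp add: hdist_smult hdist_smult_scalar)
    also have "\<dots> < e" using 1 2 by simp
    finally show ?thesis using S(2)[OF q(1) s(1)] by blast
  qed
  then show ?thesis using car by (simp add: hclosure_def)
qed

lemma (in hilbert_space) hclosure_closed:
  assumes S: "S \<subseteq> carrier H"
    and s: "\<And>n::nat. s n \<in> hclosure H S" and l: "l \<in> carrier H"
    and lim: "(\<lambda>n. hnorm H (s n \<ominus> l)) \<longlonglongrightarrow> 0"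
  shows "l \<in> hclosure H S"
proof -
  have "\<exists>t\<in>S. hnorm H (t \<ominus> l) < e" if e: "e > 0" for e
  proof -
    have "eventually (\<lambda>n. hnorm H (s n \<ominus> l) < e / 2) sequentially"
      using lim e by (intro order_tendstoD(2)) auto
    then obtain n where n: "hnorm H (s n \<ominus> l) < e / 2"
      using eventually_happens by force
    have "e / 2 > 0" using e by simp
    then obtain t where t: "t \<in> S" "hnorm H (t \<ominus> s n) < e / 2"
      using s[of n] unfolding hclosure_def by blast
    have "hnorm H (t \<ominus> l) \<le> hnorm H (t \<ominus> s n) + hnorm H (s n \<ominus> l)"
      using S t l s[of n] by (intro hdist_triangle) (auto simp: hclosure_def)
    with n t show ?thesis by (intro bexI[of _ t]) auto
  qed
  then show ?thesis using l by (simp add: hclosure_def)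
qed

lemma (in hilbert_space) hclosure_inj_real:
  assumes S: "S \<subseteq> carrier H" "countable S"
  shows "\<exists>f :: 'h \<Rightarrow> real. inj_on f (hclosure H S)"
proof -
  define F where "F x = {prod_encode (n, to_nat_on S s) | n s. s \<in> S \<and> hnorm H (s \<ominus> x) < 1 / (real n + 1)}" for x
  have "inj_on F (hclosure H S)"
  proof
    fix x y assume x: "x \<in> hclosure H S" and y: "y \<in> hclosure H S" and eq: "F x = F y"
    have car: "x \<in> carrier H" "y \<in> carrier H" using x y by (auto simp: hclosure_def)
    have le: "hnorm H (x \<ominus> y) \<le> 2 / (real n + 1)" for n
    proof -
      have "1 / (real n + 1) > 0" by simp
      then obtain s where s: "s \<in> S" "hnorm H (s \<ominus> x) < 1 / (real n + 1)"
        using x unfolding hclosure_def by blast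
      then have "prod_encode (n, to_nat_on S s) \<in> F y"
        unfolding eq[symmetric] by (auto simp: F_def)
      then have "hnorm H (s \<ominus> y) < 1 / (real n + 1)"
        using s S(2) by (auto simp: F_def)
      moreover have "hnorm H (x \<ominus> y) \<le> hnorm H (x \<ominus> s) + hnorm H (s \<ominus> y)"
        using car s S by (intro hdist_triangle) auto
      moreover have "hnorm H (x \<ominus> s) = hnorm H (s \<ominus> x)"
        using car s S by (intro hdist_commute) auto
      ultimately show ?thesis using s by simp
    qed
    have "(\<lambda>n. 2 / (real n + 1)) \<longlonglongrightarrow> 0" by real_asymp
    then have "hnorm H (x \<ominus> y) \<le> 0"
      by (rule LIMSEQ_le_const) (use le in auto)
    then have "hnorm H (x \<ominus> y) = 0" using car by (simp add: order.antisym)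
    then show "x = y" using car by (simp add: hdist_eq_0)
  qed
  moreover obtain g :: "nat set \<Rightarrow> real" where "bij g"
    using nat_sets_eqpoll_reals unfolding eqpoll_def by auto
  ultimately have "inj_on (g \<circ> F) (hclosure H S)"
    by (intro comp_inj_on) (auto simp: bij_def inj_on_def)
  then show ?thesis by blast
qed

lemma unitary_operatorD:
  assumes "unitary_operator H U"
  shows "x \<in> carrier H \<Longrightarrow> U x \<in> carrier H"
    "inj_on U (carrier H)"
    "\<lbrakk>x \<in> carrier H; y \<in> carrier H\<rbrakk> \<Longrightarrow> U (x \<oplus>\<^bsub>H\<^esub> y) = U x \<oplus>\<^bsub>H\<^esub> U y"
    "x \<in> carrier H \<Longrightarrow> U (c \<odot>\<^bsub>H\<^esub> x) = c \<odot>\<^bsub>H\<^esub> U x"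
    "\<lbrakk>x \<in> carrier H; y \<in> carrier H\<rbrakk> \<Longrightarrow> cinner H (U x) (U y) = cinner H x y"
proof -
  have b: "bij_betw U (carrier H) (carrier H)"
    using assms unfolding unitary_operator_def by (elim conjE)
  show "x \<in> carrier H \<Longrightarrow> U x \<in> carrier H" using b by (rule bij_betwE[THEN bspec])
  show "inj_on U (carrier H)" using b by (rule bij_betw_imp_inj_on)
qed (use assms in \<open>auto simp: unitary_operator_def\<close>)

lemma (in hilbert_space) unitary_dist:
  assumes U: "unitary_operator H U" and [simp]: "x \<in> carrier H" "y \<in> carrier H"
  shows "hnorm H (U x \<ominus> U y) = hnorm H (x \<ominus> y)"
proof -
  have "U x \<ominus> U y = U (x \<ominus> y)"
    by (simp add: minus_eq_smult unitary_operatorD[OF U])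
  then show ?thesis by (simp add: hnorm_def unitary_operatorD[OF U])
qed

lemma (in hilbert_space) hclosure_unitary:
  assumes S: "S \<subseteq> carrier H" "\<And>x. x \<in> S \<Longrightarrow> U x \<in> S" and U: "unitary_operator H U"
    and x: "x \<in> hclosure H S"
  shows "U x \<in> hclosure H S"
proof -
  have car: "x \<in> carrier H" using x by (auto simp: hclosure_def)
  have "\<exists>s\<in>S. hnorm H (s \<ominus> U x) < e" if e: "e > 0" for e
  proof -
    obtain s where "s \<in> S" "hnorm H (s \<ominus> x) < e" using x e unfolding hclosure_def by blast
    then have "hnorm H (U s \<ominus> U x) < e" using unitary_dist[OF U, of s x] S car by auto
    then show ?thesis using S(2) \<open>s \<in> S\<close> by blast
  qed
  then show ?thesis using car by (simp add: hclosure_def unitary_operatorD[OF U])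
qed

lemma (in hilbert_space) countable_invariant_set:
  assumes D: "countable D" and I: "countable I" and U: "\<And>i. i \<in> I \<Longrightarrow> unitary_operator H (U i)"
    and \<xi>: "\<xi> \<in> carrier H"
  obtains S where "countable S" "S \<subseteq> carrier H" "\<xi> \<in> S" "\<zero> \<in> S"
    "\<And>x y. \<lbrakk>x \<in> S; y \<in> S\<rbrakk> \<Longrightarrow> x \<oplus> y \<in> S" "\<And>q x. \<lbrakk>q \<in> D; x \<in> S\<rbrakk> \<Longrightarrow> q \<odot> x \<in> S"
    "\<And>i x. \<lbrakk>i \<in> I; x \<in> S\<rbrakk> \<Longrightarrow> U i x \<in> S"
proof -
  define step where "step A = A \<union> (\<lambda>(x, y). x \<oplus> y) ` (A \<times> A) \<union> (\<lambda>(q, x). q \<odot> x) ` (D \<times> A)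
    \<union> (\<lambda>(i, x). U i x) ` (I \<times> A)" for A
  define B where "B n = (step ^^ n) {\<xi>, \<zero>}" for n
  have B0: "B 0 = {\<xi>, \<zero>}" and BS: "B (Suc n) = step (B n)" for n
    by (simp_all add: B_def)
  have cnt: "countable (B n)" for n
    by (induction n) (auto simp: B0 BS step_def D I)
  have car: "B n \<subseteq> carrier H" for n
  proof (induction n)
    case (Suc n)
    then show ?case
      by (auto simp: BS step_def subset_eq dest!: U intro: unitary_operatorD(1))
  qed (simp add: B0 \<xi>)
  have mono: "m \<le> n \<Longrightarrow> B m \<subseteq> B n" for m n
    by (rule lift_Suc_mono_le) (auto simp: BS step_def)
  show thesis
  proof (rule that[of "\<Union>n. B n"])
    show "x \<oplus> y \<in> (\<Union>n. B n)" if xy: "x \<in> (\<Union>n. B n)" "y \<in> (\<Union>n. B n)" for x y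
    proof -
      obtain m n where "x \<in> B m" "y \<in> B n" using xy by auto
      then have "x \<in> B (max m n)" "y \<in> B (max m n)"
        using mono[of m "max m n"] mono[of n "max m n"] by auto
      then have "x \<oplus> y \<in> B (Suc (max m n))" by (force simp: BS step_def)
      then show ?thesis by blast
    qed
    show "q \<odot> x \<in> (\<Union>n. B n)" if qx: "q \<in> D" "x \<in> (\<Union>n. B n)" for q x
    proof -
      obtain n where "x \<in> B n" using qx by auto
      then have "q \<odot> x \<in> B (Suc n)" using qx by (force simp: BS step_def)
      then show ?thesis by blast
    qed
    show "U i x \<in> (\<Union>n. B n)" if qx: "i \<in> I" "x \<in> (\<Union>n. B n)" for i x
    proof -
      obtain n where "x \<in> B n" using qx by auto
      then have "U i x \<in> B (Suc n)" using qx by (force simp: BS step_def)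
      then show ?thesis by blast
    qed
    show "\<xi> \<in> (\<Union>n. B n)" "\<zero> \<in> (\<Union>n. B n)"
      by (rule UN_I[of 0]; simp add: B0)+
  qed (use cnt car in auto)
qed

theorem kazhdan_pair_any_type:
  fixes H :: "('h, 'm) inner_space_scheme"
  assumes G: "group G" "countable (carrier G)" and kp: "kazhdan_pair G Q \<epsilon>"
    and H: "hilbert_space H" and \<pi>: "unitary_representation G H \<pi>"
    and ai: "has_almost_invariant_vector H \<pi> Q \<epsilon>"
  shows "has_invariant_vector G H \<pi>"
proof -
  interpret H: hilbert_space H by fact
  interpret G: group G by fact
  have U: "unitary_operator H (\<pi> g)" if "g \<in> carrier G" for g
    using \<pi> that by (simp add: unitary_representation_def)
  have hom: "\<pi> (g \<otimes>\<^bsub>G\<^esub> h) x = \<pi> g (\<pi> h x)" if "g \<in> carrier G" "h \<in> carrier G" "x \<in> carrier H" for g h x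
    using \<pi> that by (simp add: unitary_representation_def)
  have one: "\<pi> \<one>\<^bsub>G\<^esub> x = x" if "x \<in> carrier H" for x
  proof -
    have "\<pi> \<one>\<^bsub>G\<^esub> (\<pi> \<one>\<^bsub>G\<^esub> x) = \<pi> \<one>\<^bsub>G\<^esub> x" using hom[of "\<one>\<^bsub>G\<^esub>" "\<one>\<^bsub>G\<^esub>" x] that by simp
    then show ?thesis
      using unitary_operatorD(1,2)[OF U[OF G.one_closed]] that by (auto dest: inj_onD)
  qed
  obtain \<xi> where \<xi>: "\<xi> \<in> carrier H" "\<And>\<gamma>. \<gamma> \<in> Q \<Longrightarrow> hnorm H (\<pi> \<gamma> \<xi> \<ominus>\<^bsub>H\<^esub> \<xi>) < \<epsilon> * hnorm H \<xi>"
    using ai by (auto simp: has_almost_invariant_vector_def)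
  obtain D :: "complex set" where D: "countable D" "\<And>X. open X \<Longrightarrow> X \<noteq> {} \<Longrightarrow> \<exists>d\<in>D. d \<in> X"
    using countable_dense_exists by blast
  have dense: "\<exists>q\<in>D. cmod (q - c) < e" if "e > 0" for c e
    using D(2)[of "ball c e"] that by (auto simp: dist_norm norm_minus_commute)
  obtain S where S: "countable S" "S \<subseteq> carrier H" "\<xi> \<in> S" "\<zero>\<^bsub>H\<^esub> \<in> S"
    "\<And>x y. \<lbrakk>x \<in> S; y \<in> S\<rbrakk> \<Longrightarrow> x \<oplus>\<^bsub>H\<^esub> y \<in> S" "\<And>q x. \<lbrakk>q \<in> D; x \<in> S\<rbrakk> \<Longrightarrow> q \<odot>\<^bsub>H\<^esub> x \<in> S"
    "\<And>g x. \<lbrakk>g \<in> carrier G; x \<in> S\<rbrakk> \<Longrightarrow> \<pi> g x \<in> S"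
    using H.countable_invariant_set[where U = \<pi> and I = "carrier G", OF D(1) G(2) U \<xi>(1)] by blast
  define K where "K = hclosure H S"
  have K: "K \<subseteq> carrier H" "S \<subseteq> K"
    using H.hclosure_subset[OF S(2)] by (auto simp: K_def hclosure_def)
  obtain f :: "'h \<Rightarrow> real" where f: "inj_on f K"
    using H.hclosure_inj_real[OF S(2,1)] by (auto simp: K_def)
  have Kadd: "\<And>x y. \<lbrakk>x \<in> K; y \<in> K\<rbrakk> \<Longrightarrow> x \<oplus>\<^bsub>H\<^esub> y \<in> K"
    unfolding K_def using S by (intro H.hclosure_add) auto
  have Ksm: "\<And>c x. x \<in> K \<Longrightarrow> c \<odot>\<^bsub>H\<^esub> x \<in> K"
    unfolding K_def using H.hclosure_smult[OF S(2,6) dense] by blast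
  have K\<pi>: "\<And>g x. \<lbrakk>g \<in> carrier G; x \<in> K\<rbrakk> \<Longrightarrow> \<pi> g x \<in> K"
    unfolding K_def using H.hclosure_unitary[OF S(2,7) U] by blast
  have Kcl: "\<And>s l. \<lbrakk>\<And>n::nat. s n \<in> K; l \<in> carrier H; (\<lambda>n. hnorm H (s n \<ominus>\<^bsub>H\<^esub> l)) \<longlonglongrightarrow> 0\<rbrakk> \<Longrightarrow> l \<in> K"
    unfolding K_def using H.hclosure_closed[OF S(2)] by blast
  have K0: "\<zero>\<^bsub>H\<^esub> \<in> K" "\<xi> \<in> K" using S K by auto
  define T where "T = transport_subspace H K f"
  have TH: "hilbert_space T"
    unfolding T_def by (rule hilbert_space_transport(1)[OF H f K(1) K0(1)]) (use Kadd Ksm Kcl in blast)+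
  have Tminus: "f x \<ominus>\<^bsub>T\<^esub> f y = f (x \<ominus>\<^bsub>H\<^esub> y)" if "x \<in> K" "y \<in> K" for x y
    unfolding T_def
    by (rule hilbert_space_transport(2)[OF H f K(1) K0(1)]) (use Kadd Ksm Kcl that in blast)+
  have Tnorm: "hnorm T (f x) = hnorm H x" if "x \<in> K" for x
    unfolding T_def
    by (rule hilbert_space_transport(3)[OF H f K(1) K0(1)]) (use Kadd Ksm Kcl that in blast)+
  have inv [simp]: "x \<in> K \<Longrightarrow> inv_into K f (f x) = x" for x
    using f by simp
  have T [simp]: "carrier T = f ` K" "\<zero>\<^bsub>T\<^esub> = f \<zero>\<^bsub>H\<^esub>"
    "\<And>x y. \<lbrakk>x \<in> K; y \<in> K\<rbrakk> \<Longrightarrow> f x \<oplus>\<^bsub>T\<^esub> f y = f (x \<oplus>\<^bsub>H\<^esub> y)"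
    "\<And>c x. x \<in> K \<Longrightarrow> c \<odot>\<^bsub>T\<^esub> f x = f (c \<odot>\<^bsub>H\<^esub> x)"
    "\<And>x y. \<lbrakk>x \<in> K; y \<in> K\<rbrakk> \<Longrightarrow> cinner T (f x) (f y) = cinner H x y"
    by (simp_all add: T_def transport_subspace_def Let_def)
  define \<rho> where "\<rho> g = f \<circ> \<pi> g \<circ> inv_into K f" for g
  have \<rho> [simp]: "\<rho> g (f x) = f (\<pi> g x)" if "x \<in> K" for g x
    using that by (simp add: \<rho>_def)
  have Kc [simp]: "x \<in> K \<Longrightarrow> x \<in> carrier H" for x using K by auto
  note TH
  moreover have "unitary_representation G T \<rho>"
    unfolding unitary_representation_def
  proof (intro conjI ballI)
    fix g assume g: "g \<in> carrier G"
    have bij: "bij_betw (\<rho> g) (f ` K) (f ` K)"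
    proof (rule bij_betw_byWitness[where f' = "\<rho> (inv\<^bsub>G\<^esub> g)"])
      show "\<forall>a\<in>f ` K. \<rho> (inv\<^bsub>G\<^esub> g) (\<rho> g a) = a"
        using g K\<pi> hom[of "inv\<^bsub>G\<^esub> g" g] one by (auto simp: hom[symmetric])
      show "\<forall>a\<in>f ` K. \<rho> g (\<rho> (inv\<^bsub>G\<^esub> g) a) = a"
        using g K\<pi> one by (auto simp: hom[symmetric])
    qed (use g K\<pi> in auto)
    then show "unitary_operator T (\<rho> g)"
      using g by (auto simp: unitary_operator_def K\<pi> Kadd Ksm unitary_operatorD[OF U])
  qed (auto simp: K\<pi> hom)
  moreover have "has_almost_invariant_vector T \<rho> Q \<epsilon>"
    unfolding has_almost_invariant_vector_def
  proof (intro bexI ballI)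
    fix \<gamma> assume "\<gamma> \<in> Q"
    then have "\<gamma> \<in> carrier G" using kp by (auto simp: kazhdan_pair_def)
    then have p: "\<pi> \<gamma> \<xi> \<in> K" using K\<pi> K0 by blast
    then have d: "\<pi> \<gamma> \<xi> \<ominus>\<^bsub>H\<^esub> \<xi> \<in> K" using K0 by (simp add: H.minus_eq_smult Kadd Ksm)
    show "hnorm T (\<rho> \<gamma> (f \<xi>) \<ominus>\<^bsub>T\<^esub> f \<xi>) < \<epsilon> * hnorm T (f \<xi>)"
      using \<xi>(2)[OF \<open>\<gamma> \<in> Q\<close>] p d K0 by (simp add: Tminus Tnorm)
  qed (use K0 in auto)
  ultimately have "has_invariant_vector G T \<rho>"
    using kp by (auto simp: kazhdan_pair_def)
  then obtain x where x: "x \<in> K" "f x \<noteq> f \<zero>\<^bsub>H\<^esub>" "\<And>g. g \<in> carrier G \<Longrightarrow> f (\<pi> g x) = f x"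
    by (auto simp: has_invariant_vector_def)
  then have "\<pi> g x = x" if "g \<in> carrier G" for g
    using f K\<pi> that by (metis inj_onD)
  moreover have "x \<in> carrier H" "x \<noteq> \<zero>\<^bsub>H\<^esub>" using x by auto
  ultimately show ?thesis
    unfolding has_invariant_vector_def by blast
qed


section \<open>Cost: independence of the carrier type\<close>

lemma standard_borel_inj_real:
  assumes "standard_borel M"
  shows "\<exists>f :: 'x \<Rightarrow> real. inj_on f (space M)"
proof -
  obtain T where T: "completely_metrizable_space T" "second_countable T" "topspace T = space M"
    using assms unfolding standard_borel_def by blast
  obtain \<B> where "countable \<B> \<and> (\<forall>V\<in>\<B>. openin T V) \<and>
      (\<forall>U x. openin T U \<and> x \<in> U \<longrightarrow> (\<exists>V\<in>\<B>. x \<in> V \<and> V \<subseteq> U))"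
    using T(2) unfolding second_countable_def by (elim exE)
  then have B: "countable \<B>" "\<And>U x. \<lbrakk>openin T U; x \<in> U\<rbrakk> \<Longrightarrow> \<exists>V\<in>\<B>. x \<in> V \<and> V \<subseteq> U"
    by simp_all
  have "Hausdorff_space T"
    using T(1) by (simp add: completely_metrizable_imp_metrizable_space metrizable_imp_Hausdorff_space)
  define F where "F x = to_nat_on \<B> ` {V\<in>\<B>. x \<in> V}" for x
  have "inj_on F (space M)"
  proof (rule inj_onI, rule ccontr)
    fix x y assume xy: "x \<in> space M" "y \<in> space M" "F x = F y" "x \<noteq> y"
    then obtain U V where UV: "openin T U" "openin T V" "x \<in> U" "y \<in> V" "disjnt U V"
      using \<open>Hausdorff_space T\<close> T(3) unfolding Hausdorff_space_def by metis
    then obtain W where W: "W \<in> \<B>" "x \<in> W" "W \<subseteq> U" using B(2) by blast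
    have "to_nat_on \<B> W \<in> F x" unfolding F_def using W(1,2) by (intro imageI) simp
    then have "to_nat_on \<B> W \<in> F y" by (simp only: xy(3))
    then obtain W' where "W' \<in> \<B>" "y \<in> W'" "to_nat_on \<B> W = to_nat_on \<B> W'"
      unfolding F_def by blast
    then have "y \<in> W" using W(1) B(1) by simp
    then show False using W(3) UV by (auto simp: disjnt_iff)
  qed
  moreover obtain g :: "nat set \<Rightarrow> real" where "bij g"
    using nat_sets_eqpoll_reals unfolding eqpoll_def by auto
  ultimately have "inj_on (g \<circ> F) (space M)"
    by (intro comp_inj_on) (auto simp: bij_def inj_on_def)
  then show ?thesis by blast
qed

lemma standard_borel_embed_measure:
  assumes "standard_borel M" and f: "inj_on f (space M)"
  shows "standard_borel (embed_measure M f)"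
proof -
  obtain T where T: "completely_metrizable_space T" "second_countable T" "topspace T = space M"
    "sets M = sigma_sets (space M) {U. openin T U}"
    using assms unfolding standard_borel_def by blast
  let ?A = "f ` space M" and ?g = "inv_into (space M) f"
  define T' where "T' = pullback_topology ?A ?g T"
  have g: "?g \<in> ?A \<rightarrow> space M" by (auto intro: inv_into_into)
  have ts: "topspace T' = ?A"
    using g by (auto simp: T'_def topspace_pullback_topology T(3) inv_into_into)
  have "continuous_map T' T (id \<circ> ?g)"
    unfolding T'_def by (intro continuous_map_pullback) simp
  moreover have "continuous_map T T' f"
    unfolding T'_def
  proof (rule continuous_map_pullback')
    have "continuous_map T T id" by simp
    then show "continuous_map T T (?g \<circ> f)"
      by (rule continuous_map_eq) (use f in \<open>auto simp: T(3)\<close>)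
  qed (auto simp: T(3))
  ultimately have "homeomorphic_maps T T' f ?g"
    using f by (auto simp: homeomorphic_maps_def ts T(3) f_inv_into_f)
  then have hom: "T homeomorphic_space T'"
    unfolding homeomorphic_space_def by blast
  have im: "f ` B = ?g -` B \<inter> ?A" if "B \<subseteq> space M" for B
    using f that by (auto simp: inv_into_into f_inv_into_f image_iff subset_iff)
  have "sets (embed_measure M f) = {?g -` B \<inter> ?A |B. B \<in> sets M}"
    unfolding sets_embed_measure'[OF f]
    using im[OF sets.sets_into_space] by (intro Collect_cong ex_cong1) metis
  also have "\<dots> = sigma_sets ?A {?g -` B \<inter> ?A |B. B \<in> {U. openin T U}}"
    unfolding T(4) by (rule sigma_sets_vimage_commute[OF g])
  also have "{?g -` B \<inter> ?A |B. B \<in> {U. openin T U}} = {U. openin T' U}"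
    unfolding T'_def openin_pullback_topology by auto
  finally have "sets (embed_measure M f) = sigma_sets (space (embed_measure M f)) {U. openin T' U}"
    by (simp add: space_embed_measure)
  then show ?thesis
    unfolding standard_borel_def
    using T hom ts homeomorphic_completely_metrizable_space[OF hom]
      homeomorphic_space_second_countability[OF hom]
    by (intro exI[of _ T']) (simp add: space_embed_measure)
qed

lemma nn_integral_embed_measure_le:
  assumes f: "inj_on f (space M)"
  shows "nn_integral (embed_measure M f) h \<le> nn_integral M (\<lambda>x. h (f x))"
proof -
  let ?N = "embed_measure M f"
  have "integral\<^sup>S ?N s \<le> nn_integral M (\<lambda>x. h (f x))" if s: "simple_function ?N s" "s \<le> h" for s
  proof -
    have "integral\<^sup>S ?N s = nn_integral ?N s"
      using s by (simp add: nn_integral_eq_simple_integral)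
    also have "\<dots> = nn_integral M (\<lambda>x. s (f x))"
      using s by (intro nn_integral_embed_measure'[OF f] borel_measurable_simple_function)
    also have "\<dots> \<le> nn_integral M (\<lambda>x. h (f x))"
      using s by (intro nn_integral_mono) (auto simp: le_fun_def)
    finally show ?thesis .
  qed
  then show ?thesis
    unfolding nn_integral_def[of ?N] by (intro SUP_least) auto
qed

lemma graph_degree_image:
  assumes f: "inj_on f X" and G: "\<G> \<subseteq> X \<times> X" and x: "x \<in> X"
  shows "graph_degree (map_prod f f ` \<G>) (f x) = graph_degree \<G> x"
proof -
  have "(map_prod f f ` \<G>) `` {f x} = f ` (\<G> `` {x})"
  proof (intro subset_antisym subsetI)
    fix w assume "w \<in> (map_prod f f ` \<G>) `` {f x}"
    then obtain a b where ab: "f a = f x" "w = f b" "(a, b) \<in> \<G>" by auto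
    then have "a = x" using inj_onD[OF f ab(1)] G x by blast
    then show "w \<in> f ` (\<G> `` {x})" using ab by blast
  next
    fix w assume "w \<in> f ` (\<G> `` {x})"
    then obtain b where b: "w = f b" "(x, b) \<in> \<G>" by blast
    have "map_prod f f (x, b) \<in> map_prod f f ` \<G>" using b(2) by (rule imageI)
    then show "w \<in> (map_prod f f ` \<G>) `` {f x}" using b(1) by simp
  qed
  moreover have "inj_on f (\<G> `` {x})"
    using f by (rule inj_on_subset) (use G in auto)
  ultimately show ?thesis
    by (simp add: graph_degree_def emeasure_count_space card_image finite_image_iff)
qed

lemma component_image:
  assumes f: "inj_on f X" and G: "\<G> \<subseteq> X \<times> X" and x: "x \<in> X"
  shows "(map_prod f f ` \<G>)\<^sup>* `` {f x} = f ` (\<G>\<^sup>* `` {x})"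
proof -
  let ?H = "map_prod f f ` \<G>"
  have X: "y \<in> X" if "(x, y) \<in> \<G>\<^sup>*" for y
    using that by (induction rule: rtrancl_induct) (use x G in auto)
  have 1: "(f x, f y) \<in> ?H\<^sup>*" if "(x, y) \<in> \<G>\<^sup>*" for y
    using that
  proof (induction rule: rtrancl_induct)
    case (step y z)
    then have "(f y, f z) \<in> ?H" using imageI[of "(y, z)" \<G> "map_prod f f"] by simp
    with step show ?case by (meson rtrancl.rtrancl_into_rtrancl)
  qed simp
  have 2: "\<exists>y. w = f y \<and> (x, y) \<in> \<G>\<^sup>*" if "(f x, w) \<in> ?H\<^sup>*" for w
    using that
  proof (induction rule: rtrancl_induct)
    case (step v w)
    then obtain y where y: "v = f y" "(x, y) \<in> \<G>\<^sup>*" by blast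
    obtain a b where ab: "v = f a" "w = f b" "(a, b) \<in> \<G>" using step(2) by auto
    then have "a = y" using y X[OF y(2)] f G by (auto dest: inj_onD)
    then show ?case using ab y by (metis rtrancl.rtrancl_into_rtrancl)
  qed auto
  show ?thesis using 1 2 by blast
qed

theorem group_cost_le_any_type:
  fixes M :: "'x measure"
  assumes std: "standard_prob_space M" and act: "free_pmp_action G M \<alpha>"
  shows "group_cost G \<le> cost_rel M (orbit_relation G M \<alpha>)"
proof -
  obtain f :: "'x \<Rightarrow> real" where f: "inj_on f (space M)"
    using standard_borel_inj_real std unfolding standard_prob_space_def by blast
  define N where "N = embed_measure M f"
  define g where "g = inv_into (space M) f"
  have gf [simp]: "x \<in> space M \<Longrightarrow> g (f x) = x" for x using f by (simp add: g_def)
  have sp: "space N = f ` space M" by (simp add: N_def space_embed_measure)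
  have mf: "f \<in> measurable M N" unfolding N_def by (rule measurable_embed_measure2'[OF f])
  have mg: "g \<in> measurable N M"
    unfolding N_def
    by (rule measurable_embed_measure1) (simp cong: measurable_cong)
  have N: "N = distr M N f" unfolding N_def by (rule embed_measure_eq_distr'[OF f])
  interpret M: prob_space M using std by (simp add: standard_prob_space_def)
  have "prob_space N" by (subst N) (rule M.prob_space_distr[OF mf])
  then have stdN: "standard_prob_space N"
    using std standard_borel_embed_measure[OF _ f] by (simp add: standard_prob_space_def N_def)
  interpret act: group_action G "space M" \<alpha> using act by (simp add: free_pmp_action_def)
  interpret G: group G using act.group_hom by (simp add: group_hom_def)
  have closed [simp]: "\<alpha> h x \<in> space M" if "h \<in> carrier G" "x \<in> space M" for h x
    using act.element_image that by blast
  define \<beta> where "\<beta> h = restrict (\<lambda>y. f (\<alpha> h (g y))) (space N)" for h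
  have \<beta> [simp]: "\<beta> h (f x) = f (\<alpha> h x)" if "x \<in> space M" for h x
    using that by (simp add: \<beta>_def sp)
  have one: "\<alpha> \<one>\<^bsub>G\<^esub> x = x" if "x \<in> space M" for x
    using act.id_eq_one that by (metis restrict_apply')
  have bij: "\<beta> h \<in> Bij (space N)" if h: "h \<in> carrier G" for h
  proof -
    have "bij_betw (\<beta> h) (space N) (space N)"
    proof (rule bij_betw_byWitness[where f' = "\<beta> (inv\<^bsub>G\<^esub> h)"])
      show "\<forall>a\<in>space N. \<beta> (inv\<^bsub>G\<^esub> h) (\<beta> h a) = a"
        using h one by (auto simp: sp act.composition_rule[symmetric])
      show "\<forall>a\<in>space N. \<beta> h (\<beta> (inv\<^bsub>G\<^esub> h) a) = a"
        using h one by (auto simp: sp act.composition_rule[symmetric])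
    qed (use h in \<open>auto simp: sp\<close>)
    then show ?thesis by (simp add: Bij_def \<beta>_def)
  qed
  have comp: "\<beta> (h \<otimes>\<^bsub>G\<^esub> k) = compose (space N) (\<beta> h) (\<beta> k)" if "h \<in> carrier G" "k \<in> carrier G" for h k
  proof
    fix y show "\<beta> (h \<otimes>\<^bsub>G\<^esub> k) y = compose (space N) (\<beta> h) (\<beta> k) y"
    proof (cases "y \<in> space N")
      case True
      then obtain x where "x \<in> space M" "y = f x" by (auto simp: sp)
      with True that show ?thesis by (simp add: compose_eq act.composition_rule)
    qed (simp add: \<beta>_def compose_def)
  qed
  have actN: "group_action G (space N) \<beta>"
    unfolding group_action_def group_hom_def group_hom_axioms_def
  proof (intro conjI G.is_group group_BijGroup)
    show "\<beta> \<in> hom G (BijGroup (space N))"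
      using bij comp by (auto simp: hom_def BijGroup_def)
  qed
  have pmp: "\<beta> h \<in> measurable N N" "distr N N (\<beta> h) = N" if h: "h \<in> carrier G" for h
  proof -
    have mh: "\<alpha> h \<in> measurable M M" "distr M M (\<alpha> h) = M"
      using act h by (auto simp: free_pmp_action_def)
    have "(\<lambda>x. f (\<alpha> h x)) \<in> measurable M N"
      using measurable_comp[OF mh(1) mf] by (simp add: comp_def)
    then have m: "(\<lambda>x. \<beta> h (f x)) \<in> measurable M N"
      by (simp cong: measurable_cong)
    then show mb: "\<beta> h \<in> measurable N N"
      unfolding N_def by (rule measurable_embed_measure1)
    have "distr N N (\<beta> h) = distr (distr M N f) N (\<beta> h)" using N by simp
    also have "\<dots> = distr M N (\<beta> h \<circ> f)" by (rule distr_distr[OF mb mf])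
    also have "\<dots> = distr M N (f \<circ> \<alpha> h)" by (rule distr_cong) auto
    also have "\<dots> = distr (distr M M (\<alpha> h)) N f" by (rule distr_distr[OF mf mh(1), symmetric])
    also have "\<dots> = N" using mh N by simp
    finally show "distr N N (\<beta> h) = N" .
  qed
  have "AE x in M. \<forall>h\<in>carrier G. h \<noteq> \<one>\<^bsub>G\<^esub> \<longrightarrow> \<alpha> h x \<noteq> x"
    using act by (simp add: free_pmp_action_def)
  then have "AE x in M. \<forall>h\<in>carrier G. h \<noteq> \<one>\<^bsub>G\<^esub> \<longrightarrow> \<beta> h (f x) \<noteq> f x"
    using AE_space by eventually_elim (use f in \<open>auto dest: inj_onD\<close>)
  then have "AE y in N. \<forall>h\<in>carrier G. h \<noteq> \<one>\<^bsub>G\<^esub> \<longrightarrow> \<beta> h y \<noteq> y"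
    unfolding N_def by (subst AE_embed_measure'[OF f])
  then have "free_pmp_action G N \<beta>"
    using actN pmp by (simp add: free_pmp_action_def)
  then have "group_cost G \<le> cost_rel N (orbit_relation G N \<beta>)"
    unfolding group_cost_def using stdN by (intro INF_lower2[of "(N, \<beta>)"]) auto
  also have "\<dots> \<le> cost_rel M (orbit_relation G M \<alpha>)"
    unfolding cost_rel_def
  proof (rule INF_mono)
    fix \<G> assume "\<G> \<in> {\<G>. graphing M (orbit_relation G M \<alpha>) \<G>}"
    then have gr: "\<G> \<in> sets (M \<Otimes>\<^sub>M M)" "sym \<G>" "irrefl \<G>"
      and ae: "AE x in M. \<G>\<^sup>* `` {x} = orbit_relation G M \<alpha> `` {x}"
      by (auto simp: graphing_def borel_graph_def)
    have sub: "\<G> \<subseteq> space M \<times> space M"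
      using sets.sets_into_space[OF gr(1)] by (simp add: space_pair_measure)
    define \<H> where "\<H> = map_prod f f ` \<G>"
    have eq: "\<H> = (\<lambda>p. (g (fst p), g (snd p))) -` \<G> \<inter> space (N \<Otimes>\<^sub>M N)"
    proof
      show "\<H> \<subseteq> (\<lambda>p. (g (fst p), g (snd p))) -` \<G> \<inter> space (N \<Otimes>\<^sub>M N)"
        using sub by (auto simp: \<H>_def space_pair_measure sp)
      show "(\<lambda>p. (g (fst p), g (snd p))) -` \<G> \<inter> space (N \<Otimes>\<^sub>M N) \<subseteq> \<H>"
      proof
        fix p assume p: "p \<in> (\<lambda>p. (g (fst p), g (snd p))) -` \<G> \<inter> space (N \<Otimes>\<^sub>M N)"
        then obtain a b where "a \<in> space M" "b \<in> space M" "p = (f a, f b)"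
          by (auto simp: space_pair_measure sp)
        with p show "p \<in> \<H>" by (auto simp: \<H>_def intro!: rev_image_eqI[of "(a, b)"])
      qed
    qed
    have "(\<lambda>p. (g (fst p), g (snd p))) \<in> measurable (N \<Otimes>\<^sub>M N) (M \<Otimes>\<^sub>M M)"
      using mg by measurable
    then have "\<H> \<in> sets (N \<Otimes>\<^sub>M N)"
      unfolding eq using gr(1) by (rule measurable_sets)
    moreover have "sym \<H>"
      using gr(2) unfolding \<H>_def sym_def by force
    moreover have "irrefl \<H>"
      using gr(3) f sub unfolding \<H>_def irrefl_def by (auto dest!: inj_onD)
    moreover have "AE y in N. \<H>\<^sup>* `` {y} = orbit_relation G N \<beta> `` {y}"
      unfolding N_def AE_embed_measure'[OF f]
      using ae AE_space
    proof eventually_elim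
      case (elim x)
      have "\<H>\<^sup>* `` {f x} = f ` (orbit_relation G M \<alpha> `` {x})"
        using component_image[OF f sub elim(2)] elim(1) by (simp add: \<H>_def)
      also have "\<dots> = orbit_relation G N \<beta> `` {f x}"
        using elim(2) by (auto simp: orbit_relation_def orbit_def sp)
      finally show ?case unfolding N_def .
    qed
    ultimately have "graphing N (orbit_relation G N \<beta>) \<H>"
      by (simp add: graphing_def borel_graph_def)
    moreover have "(\<integral>\<^sup>+ y. graph_degree \<H> y \<partial>N) / 2 \<le> (\<integral>\<^sup>+ x. graph_degree \<G> x \<partial>M) / 2"
    proof -
      have "(\<integral>\<^sup>+ y. graph_degree \<H> y \<partial>N) \<le> (\<integral>\<^sup>+ x. graph_degree \<H> (f x) \<partial>M)"
        unfolding N_def by (rule nn_integral_embed_measure_le[OF f])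
      also have "\<dots> = (\<integral>\<^sup>+ x. graph_degree \<G> x \<partial>M)"
        unfolding \<H>_def by (intro nn_integral_cong graph_degree_image[OF f sub])
      finally show ?thesis by (rule divide_right_mono_ennreal)
    qed
    ultimately show "\<exists>\<H>\<in>{\<H>. graphing N (orbit_relation G N \<beta>) \<H>}.
        (\<integral>\<^sup>+ y. graph_degree \<H> y \<partial>N) / 2 \<le> (\<integral>\<^sup>+ x. graph_degree \<G> x \<partial>M) / 2"
      by blast
  qed
  finally show ?thesis .
qed

end

theory Submission
  imports Defs
begin

text \<open>
  Let \<open>\<gamma> \<in> Q\<close> have infinite order, let \<open>c\<close> be another element of the Kazhdan set \<open>Q\<close>, and let \<open>\<Gamma>\<close> act
  by a Bernoulli shift on \<open>X\<close>, so that \<open>\<gamma>\<close> alone acts ergodically. The graph in which \<open>x\<close> is joined to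
  \<open>qx\<close> for every \<open>q \<in> Q\<close> generates the orbit relation \<open>E\<close> at cost at most \<open>card Q\<close>. Keeping the edges
  \<open>(x, cx)\<close> only for \<open>x\<close> in a set \<open>A\<close> lowers the bound on the cost to \<open>card Q - 1 + \<mu>(A)\<close>; it remains
  to see that \<open>\<mu>(A)\<close> can be taken arbitrarily close to \<open>1 - \<epsilon>\<^sup>2 / 2\<close> without losing connectedness.

  Let \<open>F \<subseteq> E\<close> be the relation generated by the smaller graph. The pairs of a point \<open>x\<close> and an \<open>F\<close>-class
  inside its orbit form a measure space on which \<open>\<Gamma>\<close> acts, moving \<open>x\<close> and keeping the class.
  In the unitary representation on the square integrable functions on this space, the indicator of the
  pairs \<open>(x, [x]\<^sub>F)\<close> has norm \<open>1\<close> and is moved by \<open>q\<close> by the square root of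
  \<open>2 (1 - \<mu>{x. qx \<in> [x]\<^sub>F})\<close>, which is less than \<open>\<epsilon>\<close> as soon as \<open>\<mu>(A) > 1 - \<epsilon>\<^sup>2 / 2\<close>. Hence there is a
  non-zero invariant vector. As \<open>F\<close> contains the orbit relation of the ergodic element \<open>\<gamma>\<close>, the modulus of
  that vector is a constant, and a non-zero constant is square integrable only if almost every orbit
  consists of finitely many \<open>F\<close>-classes (\<open>finitely_many_classes\<close>). By ergodicity their number
  is constant. Choose \<open>A\<close>, of measure slightly above \<open>1 - \<epsilon>\<^sup>2 / 2\<close>, such that this number is least possible.
  If \<open>F\<close> were smaller than \<open>E\<close>, some missing edges \<open>(x, cx)\<close> would join different \<open>F\<close>-classes; adding a
  small set of them to \<open>A\<close> would merge classes and contradict minimality (\<open>connected_percolation\<close>).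

  The regular representation supplies the boundary cases: a Kazhdan pair of an infinite group satisfies
  \<open>\<epsilon>\<^sup>2 \<le> 2\<close>, and its Kazhdan set does not consist of a single element of infinite order, so that \<open>c\<close> exists.
  For the second claim, every finite generating set of a group with property (T) belongs to some Kazhdan
  pair, so the supremum defining the Kazhdan constant is over a non-empty set and inherits the bound.
\<close>

section \<open>The Hilbert space of square integrable functions\<close>

definition square_integrable :: "'a measure \<Rightarrow> ('a \<Rightarrow> complex) \<Rightarrow> bool" where
  "square_integrable N f \<longleftrightarrow> f \<in> borel_measurable N \<and> (\<integral>\<^sup>+x. ennreal ((cmod (f x))\<^sup>2) \<partial>N) < \<infinity>"

text \<open>
  A choice of representative that depends only on the almost-everywhere class (\<open>ae_rep_cong\<close>). Vectors
  of the Hilbert space are the functions equal to their representative, so that almost-everywhere equality of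
  vectors is equality and no quotient type is involved.
\<close>

definition ae_rep :: "'a measure \<Rightarrow> ('a \<Rightarrow> complex) \<Rightarrow> 'a \<Rightarrow> complex" where
  "ae_rep N f = (SOME g. g \<in> borel_measurable N \<and> (AE x in N. g x = f x))"

definition L2 :: "'a measure \<Rightarrow> ('a \<Rightarrow> complex) inner_space" where
  "L2 N = \<lparr>carrier = {f. square_integrable N f \<and> ae_rep N f = f}, mult = undefined, one = undefined,
     zero = ae_rep N (\<lambda>_. 0), add = (\<lambda>f g. ae_rep N (\<lambda>x. f x + g x)),
     smult = (\<lambda>c f. ae_rep N (\<lambda>x. c * f x)), cinner = (\<lambda>f g. \<integral>x. f x * cnj (g x) \<partial>N)\<rparr>"

lemma ae_rep:
  assumes "f \<in> borel_measurable N"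
  shows ae_rep_measurable: "ae_rep N f \<in> borel_measurable N"
    and ae_rep_AE: "AE x in N. ae_rep N f x = f x"
proof -
  have "ae_rep N f \<in> borel_measurable N \<and> (AE x in N. ae_rep N f x = f x)"
    unfolding ae_rep_def by (rule someI[of _ f]) (use assms in auto)
  then show "ae_rep N f \<in> borel_measurable N" "AE x in N. ae_rep N f x = f x" by auto
qed

lemma ae_rep_cong:
  assumes "AE x in N. f x = g x"
  shows "ae_rep N f = ae_rep N g"
proof -
  have "(AE x in N. h x = f x) \<longleftrightarrow> (AE x in N. h x = g x)" for h :: "'a \<Rightarrow> complex"
  proof
    assume "AE x in N. h x = f x" with assms show "AE x in N. h x = g x" by eventually_elim simp
  next
    assume "AE x in N. h x = g x" with assms show "AE x in N. h x = f x" by eventually_elim simp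
  qed
  then show ?thesis by (simp add: ae_rep_def)
qed

lemma square_integrable_measurable: "square_integrable N f \<Longrightarrow> f \<in> borel_measurable N"
  by (simp add: square_integrable_def)

lemma square_integrable_integrable:
  "square_integrable N f \<longleftrightarrow> f \<in> borel_measurable N \<and> integrable N (\<lambda>x. (cmod (f x))\<^sup>2)"
  by (auto simp: square_integrable_def integrable_iff_bounded)

lemma square_integrable_cong_AE:
  assumes "square_integrable N f" "g \<in> borel_measurable N" "AE x in N. g x = f x"
  shows "square_integrable N g"
proof -
  have "(\<integral>\<^sup>+x. ennreal ((cmod (g x))\<^sup>2) \<partial>N) = (\<integral>\<^sup>+x. ennreal ((cmod (f x))\<^sup>2) \<partial>N)"
    by (rule nn_integral_cong_AE) (use assms(3) in \<open>eventually_elim, simp\<close>)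
  then show ?thesis using assms by (simp add: square_integrable_def)
qed

lemma cmod_add_square: "(cmod (a + b))\<^sup>2 \<le> 2 * (cmod a)\<^sup>2 + 2 * (cmod b)\<^sup>2"
proof -
  have "(cmod (a + b))\<^sup>2 \<le> (cmod a + cmod b)\<^sup>2"
    by (intro power_mono norm_triangle_ineq) simp
  also have "\<dots> \<le> 2 * (cmod a)\<^sup>2 + 2 * (cmod b)\<^sup>2"
    using sum_squares_bound[of "cmod a" "cmod b"] by (simp add: power2_sum)
  finally show ?thesis .
qed

lemma square_integrable_add:
  assumes f: "square_integrable N f" and g: "square_integrable N g"
  shows "square_integrable N (\<lambda>x. f x + g x)"
proof -
  have [measurable]: "f \<in> borel_measurable N" "g \<in> borel_measurable N"
    using f g by (auto simp: square_integrable_def)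
  have "integrable N (\<lambda>x. 2 * (cmod (f x))\<^sup>2 + 2 * (cmod (g x))\<^sup>2)"
    using f g by (simp add: square_integrable_integrable)
  then have "integrable N (\<lambda>x. (cmod (f x + g x))\<^sup>2)"
    by (rule Bochner_Integration.integrable_bound) (auto intro!: AE_I2 cmod_add_square)
  then show ?thesis by (simp add: square_integrable_integrable)
qed

lemma square_integrable_cmult:
  assumes f: "square_integrable N f"
  shows "square_integrable N (\<lambda>x. c * f x)"
  using f by (auto simp: square_integrable_integrable norm_mult power_mult_distrib)

lemma square_integrable_diff:
  assumes f: "square_integrable N f" and g: "square_integrable N g"
  shows "square_integrable N (\<lambda>x. f x - g x)"
  using square_integrable_add[OF f square_integrable_cmult[OF g, of "-1"]] by simp

lemma square_integrable_ae_rep: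
  assumes "square_integrable N f" shows "square_integrable N (ae_rep N f)"
  using ae_rep[OF square_integrable_measurable[OF assms]] assms by (blast intro: square_integrable_cong_AE)

lemma square_integrable_prod:
  assumes f: "square_integrable N f" and g: "square_integrable N g"
  shows "integrable N (\<lambda>x. f x * cnj (g x))"
proof -
  have [measurable]: "f \<in> borel_measurable N" "g \<in> borel_measurable N"
    using f g by (auto simp: square_integrable_def)
  have [measurable]: "(\<lambda>x. cnj (g x)) \<in> borel_measurable N"
    by (rule borel_measurable_continuous_on[where f = cnj]) (auto intro: continuous_intros)
  have "integrable N (\<lambda>x. (cmod (f x))\<^sup>2 + (cmod (g x))\<^sup>2)"
    using f g by (simp add: square_integrable_integrable)
  moreover have "norm (f x * cnj (g x)) \<le> norm ((cmod (f x))\<^sup>2 + (cmod (g x))\<^sup>2)" for x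
  proof -
    have "0 \<le> cmod (f x) * cmod (g x)" by simp
    then have "cmod (f x) * cmod (g x) \<le> (cmod (f x))\<^sup>2 + (cmod (g x))\<^sup>2"
      using sum_squares_bound[of "cmod (f x)" "cmod (g x)"] by linarith
    then show ?thesis by (simp add: norm_mult)
  qed
  ultimately show ?thesis
    by (intro Bochner_Integration.integrable_bound[where g = "\<lambda>x. f x * cnj (g x)"] AE_I2) measurable
qed

text \<open>
  Along a subsequence \<open>u\<close> whose square distances from index \<open>j\<close> on are below \<open>4\<^sup>-\<^sup>j\<close> one has
  \<open>\<Sum>\<^sub>j 2\<^sup>j |u\<^sub>j\<^sub>+\<^sub>1 - u\<^sub>j|\<^sup>2 < \<infinity>\<close> almost everywhere. There the increments are eventually at most
  \<open>2\<^sup>-\<^sup>j\<^sup>/\<^sup>2\<close>, hence summable; the pointwise limit is the limit in norm by Fatou's lemma.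
\<close>

lemma riesz_fischer:
  fixes s :: "nat \<Rightarrow> 'a \<Rightarrow> complex"
  assumes s: "\<And>n. square_integrable N (s n)"
    and cauchy: "\<And>e. e > 0 \<Longrightarrow> \<exists>K. \<forall>m\<ge>K. \<forall>n\<ge>K. (\<integral>\<^sup>+x. ennreal ((cmod (s m x - s n x))\<^sup>2) \<partial>N) < ennreal e"
  shows "\<exists>l. square_integrable N l \<and> (\<forall>e>0. \<exists>K. \<forall>n\<ge>K. (\<integral>\<^sup>+x. ennreal ((cmod (s n x - l x))\<^sup>2) \<partial>N) \<le> ennreal e)"
proof -
  have sm [measurable]: "s n \<in> borel_measurable N" for n
    using s by (simp add: square_integrable_def)
  have "\<forall>j. \<exists>K. \<forall>m\<ge>K. \<forall>n\<ge>K. (\<integral>\<^sup>+x. ennreal ((cmod (s m x - s n x))\<^sup>2) \<partial>N) < ennreal ((1/4)^j)"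
    using cauchy by simp
  then obtain K where K: "\<And>j m n. \<lbrakk>m \<ge> K j; n \<ge> K j\<rbrakk> \<Longrightarrow>
      (\<integral>\<^sup>+x. ennreal ((cmod (s m x - s n x))\<^sup>2) \<partial>N) < ennreal ((1/4)^j)"
    by metis
  \<comment> \<open>Summing the thresholds makes them increasing, and each is still at least the required one.\<close>
  define k where "k j = (\<Sum>i\<le>j. K i)" for j
  have kK: "K i \<le> k j" if "i \<le> j" for i j
    unfolding k_def using that by (intro member_le_sum) auto
  define u where "u j = s (k j)" for j
  have um [measurable]: "u j \<in> borel_measurable N" for j by (simp add: u_def)
  define d where "d j x = 2^j * (cmod (u (Suc j) x - u j x))\<^sup>2" for j x
  have dm [measurable]: "d j \<in> borel_measurable N" for j unfolding d_def by measurable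
  have "(\<integral>\<^sup>+x. (\<Sum>j. ennreal (d j x)) \<partial>N) = (\<Sum>j. \<integral>\<^sup>+x. ennreal (d j x) \<partial>N)"
    by (rule nn_integral_suminf) measurable
  also have "\<dots> \<le> (\<Sum>j. ennreal ((1/2)^j))"
  proof (rule suminf_le)
    fix j
    have "(\<integral>\<^sup>+x. ennreal (d j x) \<partial>N) = ennreal (2^j) * (\<integral>\<^sup>+x. ennreal ((cmod (u (Suc j) x - u j x))\<^sup>2) \<partial>N)"
      unfolding d_def by (subst nn_integral_cmult[symmetric]) (auto simp: ennreal_mult)
    also have "\<dots> \<le> ennreal (2^j) * ennreal ((1/4)^j)"
      unfolding u_def by (intro mult_left_mono less_imp_le[OF K] kK) auto
    also have "\<dots> = ennreal ((1/2)^j)"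
      by (simp add: ennreal_mult[symmetric] power_mult_distrib[symmetric])
    finally show "(\<integral>\<^sup>+x. ennreal (d j x) \<partial>N) \<le> ennreal ((1/2)^j)" .
  qed auto
  also have "\<dots> = ennreal (\<Sum>j. (1/2)^j)"
    by (rule suminf_ennreal2) (auto intro: summable_geometric)
  also have "\<dots> < \<infinity>" by simp
  finally have "AE x in N. (\<Sum>j. ennreal (d j x)) \<noteq> \<infinity>"
    by (intro nn_integral_noteq_infinite) auto
  then have conv: "AE x in N. (\<lambda>j. u j x) \<longlonglongrightarrow> lim (\<lambda>j. u j x)"
  proof eventually_elim
    case (elim x)
    have "summable (\<lambda>j. d j x)"
      using elim by (intro summable_suminf_not_top) (auto simp: d_def)
    then have "(\<lambda>j. d j x) \<longlonglongrightarrow> 0" by (rule summable_LIMSEQ_zero)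
    then have "eventually (\<lambda>j. d j x < 1) sequentially"
      by (rule order_tendstoD) simp
    then have ev: "eventually (\<lambda>j. cmod (u (Suc j) x - u j x) \<le> (sqrt (1/2))^j) sequentially"
    proof eventually_elim
      case (elim j)
      have "(cmod (u (Suc j) x - u j x))\<^sup>2 \<le> (1/2)^j"
        using elim by (simp add: d_def field_simps)
      also have "\<dots> = ((sqrt (1/2))^j)\<^sup>2"
        by (simp add: power_mult[symmetric] mult.commute[of j 2]) (simp add: power_mult)
      finally show ?case by (rule power2_le_imp_le) simp
    qed
    have "summable (\<lambda>j. (sqrt (1/2))^j)"
      by (rule summable_geometric) (simp add: real_sqrt_lt_1_iff)
    with ev have "summable (\<lambda>j. u (Suc j) x - u j x)"
      by (rule summable_comparison_test_ev)
    then have "convergent (\<lambda>n. \<Sum>j<n. u (Suc j) x - u j x)"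
      by (simp add: summable_iff_convergent)
    then have "convergent (\<lambda>n. u n x - u 0 x)"
      unfolding sum_lessThan_telescope[of "\<lambda>j. u j x"] .
    then have "convergent (\<lambda>n. (u n x - u 0 x) + u 0 x)"
      by (intro convergent_add convergent_const)
    then show ?case by (simp add: convergent_LIMSEQ_iff)
  qed
  define l where "l x = lim (\<lambda>j. u j x)" for x
  have lm [measurable]: "l \<in> borel_measurable N"
    unfolding l_def by (rule borel_measurable_lim_metric) measurable
  have dist: "(\<integral>\<^sup>+x. ennreal ((cmod (s n x - l x))\<^sup>2) \<partial>N) \<le> ennreal ((1/4)^i)" if n: "n \<ge> k i" for n i
  proof -
    have "(\<integral>\<^sup>+x. ennreal ((cmod (s n x - l x))\<^sup>2) \<partial>N)
        = (\<integral>\<^sup>+x. liminf (\<lambda>j. ennreal ((cmod (s n x - u j x))\<^sup>2)) \<partial>N)"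
    proof (rule nn_integral_cong_AE, use conv in eventually_elim)
      case (elim x)
      have "(\<lambda>j. ennreal ((cmod (s n x - u j x))\<^sup>2)) \<longlonglongrightarrow> ennreal ((cmod (s n x - l x))\<^sup>2)"
        using elim unfolding l_def by (intro tendsto_intros)
      then have "liminf (\<lambda>j. ennreal ((cmod (s n x - u j x))\<^sup>2)) = ennreal ((cmod (s n x - l x))\<^sup>2)"
        by (intro lim_imp_Liminf) auto
      then show ?case by (rule sym)
    qed
    also have "\<dots> \<le> liminf (\<lambda>j. \<integral>\<^sup>+x. ennreal ((cmod (s n x - u j x))\<^sup>2) \<partial>N)"
      by (rule nn_integral_liminf) measurable
    also have "\<dots> \<le> ennreal ((1/4)^i)"
    proof (rule Liminf_le)
      have "(\<integral>\<^sup>+x. ennreal ((cmod (s n x - u j x))\<^sup>2) \<partial>N) \<le> ennreal ((1/4)^i)" if "j \<ge> i" for j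
        unfolding u_def using kK[of i i] n kK[OF that] by (intro less_imp_le[OF K]) auto
      then show "\<forall>\<^sub>F j in sequentially. (\<integral>\<^sup>+x. ennreal ((cmod (s n x - u j x))\<^sup>2) \<partial>N) \<le> ennreal ((1/4)^i)"
        by (auto simp: eventually_sequentially)
    qed simp
    finally show ?thesis .
  qed
  have "square_integrable N (\<lambda>x. s (k 0) x - l x)"
    using dist[of 0 "k 0"] by (auto simp: square_integrable_def intro: le_less_trans)
  then have "square_integrable N (\<lambda>x. s (k 0) x - (s (k 0) x - l x))"
    by (rule square_integrable_diff[OF s])
  moreover have "\<exists>K. \<forall>n\<ge>K. (\<integral>\<^sup>+x. ennreal ((cmod (s n x - l x))\<^sup>2) \<partial>N) \<le> ennreal e" if e: "e > 0" for e
  proof -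
    obtain i where "(1/4)^i < e" using real_arch_pow_inv[OF e, of "1/4"] by auto
    then have "\<forall>n\<ge>k i. (\<integral>\<^sup>+x. ennreal ((cmod (s n x - l x))\<^sup>2) \<partial>N) \<le> ennreal e"
      using dist[where i = i] by (meson order_trans ennreal_leI less_imp_le)
    then show ?thesis by blast
  qed
  ultimately show ?thesis by (intro exI[of _ l]) auto
qed

lemma L2_simps [simp]:
  "carrier (L2 N) = {f. square_integrable N f \<and> ae_rep N f = f}"
  "\<zero>\<^bsub>L2 N\<^esub> = ae_rep N (\<lambda>_. 0)"
  "f \<oplus>\<^bsub>L2 N\<^esub> g = ae_rep N (\<lambda>x. f x + g x)"
  "c \<odot>\<^bsub>L2 N\<^esub> f = ae_rep N (\<lambda>x. c * f x)"
  "cinner (L2 N) f g = (\<integral>x. f x * cnj (g x) \<partial>N)"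
  by (simp_all add: L2_def)

lemma ae_rep_in_L2: "square_integrable N f \<Longrightarrow> ae_rep N f \<in> carrier (L2 N)"
  by (auto intro!: square_integrable_ae_rep ae_rep_cong ae_rep_AE square_integrable_measurable)

lemma L2_eqI: "\<lbrakk>f \<in> carrier (L2 N); g \<in> carrier (L2 N); AE x in N. f x = g x\<rbrakk> \<Longrightarrow> f = g"
  using ae_rep_cong[of f g N] by simp

lemma integral_norm_square:
  fixes f :: "'a \<Rightarrow> complex"
  shows "(\<integral>x. f x * cnj (f x) \<partial>N) = of_real (\<integral>x. (cmod (f x))\<^sup>2 \<partial>N)"
  unfolding complex_norm_square[symmetric] by (simp del: of_real_power)

lemma hnorm_L2:
  "square_integrable N f \<Longrightarrow> hnorm (L2 N) f = sqrt (\<integral>x. (cmod (f x))\<^sup>2 \<partial>N)"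
  by (simp add: hnorm_def integral_norm_square)

lemma ennreal_L2:
  "square_integrable N f \<Longrightarrow> (\<integral>\<^sup>+x. ennreal ((cmod (f x))\<^sup>2) \<partial>N) = ennreal (\<integral>x. (cmod (f x))\<^sup>2 \<partial>N)"
  by (rule nn_integral_eq_integral) (auto simp: square_integrable_integrable)

lemma L2_measurable: "f \<in> carrier (L2 N) \<Longrightarrow> f \<in> borel_measurable N"
  by (simp add: square_integrable_def)

lemma L2_AE:
  assumes "f \<in> carrier (L2 N)" "g \<in> carrier (L2 N)"
  shows "AE x in N. (f \<oplus>\<^bsub>L2 N\<^esub> g) x = f x + g x" "AE x in N. (c \<odot>\<^bsub>L2 N\<^esub> f) x = c * f x"
    "AE x in N. \<zero>\<^bsub>L2 N\<^esub> x = 0"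
  using assms[THEN L2_measurable] by (auto intro!: ae_rep_AE simp del: L2_simps(1))

lemma L2_closed:
  assumes "f \<in> carrier (L2 N)" "g \<in> carrier (L2 N)"
  shows "f \<oplus>\<^bsub>L2 N\<^esub> g \<in> carrier (L2 N)" "c \<odot>\<^bsub>L2 N\<^esub> f \<in> carrier (L2 N)" "\<zero>\<^bsub>L2 N\<^esub> \<in> carrier (L2 N)"
  unfolding L2_simps(2-4)
  by (intro ae_rep_in_L2 square_integrable_add square_integrable_cmult; use assms in simp)
     (intro ae_rep_in_L2 square_integrable_add square_integrable_cmult; use assms in \<open>simp add: square_integrable_def\<close>)+

lemma module_L2: "Module.module complex_ring (L2 N)"
proof -
  note [simp del] = L2_simps(1)
  note cl = L2_closed[where N = N]
  have cr: "cring complex_ring"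
    unfolding complex_ring_def
    by unfold_locales (auto simp: algebra_simps Units_def intro: exI[of _ "- _"])
  have ab: "abelian_group (L2 N)"
  proof (rule abelian_groupI)
    fix x y z assume x: "x \<in> carrier (L2 N)" and y: "y \<in> carrier (L2 N)" and z: "z \<in> carrier (L2 N)"
    show "x \<oplus>\<^bsub>L2 N\<^esub> y \<in> carrier (L2 N)" using x y by (rule cl)
    show "x \<oplus>\<^bsub>L2 N\<^esub> y \<oplus>\<^bsub>L2 N\<^esub> z = x \<oplus>\<^bsub>L2 N\<^esub> (y \<oplus>\<^bsub>L2 N\<^esub> z)"
    proof (rule L2_eqI)
      show "AE t in N. (x \<oplus>\<^bsub>L2 N\<^esub> y \<oplus>\<^bsub>L2 N\<^esub> z) t = (x \<oplus>\<^bsub>L2 N\<^esub> (y \<oplus>\<^bsub>L2 N\<^esub> z)) t"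
        using L2_AE(1)[OF x y] L2_AE(1)[OF y z] L2_AE(1)[OF cl(1)[OF x y] z] L2_AE(1)[OF x cl(1)[OF y z]]
        by eventually_elim (simp del: L2_simps)
    qed (intro cl x y z)+
    show "x \<oplus>\<^bsub>L2 N\<^esub> y = y \<oplus>\<^bsub>L2 N\<^esub> x" by (simp add: add.commute)
    show "\<zero>\<^bsub>L2 N\<^esub> \<oplus>\<^bsub>L2 N\<^esub> x = x"
    proof (rule L2_eqI)
      show "AE t in N. (\<zero>\<^bsub>L2 N\<^esub> \<oplus>\<^bsub>L2 N\<^esub> x) t = x t"
        using L2_AE(1)[OF cl(3)[OF x x] x] L2_AE(3)[OF x x]
        by eventually_elim (simp del: L2_simps)
    qed (intro cl(1) cl(3)[OF x x] x)+
    show "\<exists>y\<in>carrier (L2 N). y \<oplus>\<^bsub>L2 N\<^esub> x = \<zero>\<^bsub>L2 N\<^esub>"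
    proof (intro bexI)
      show m: "(-1) \<odot>\<^bsub>L2 N\<^esub> x \<in> carrier (L2 N)" using cl(2)[OF x x] .
      show "(-1) \<odot>\<^bsub>L2 N\<^esub> x \<oplus>\<^bsub>L2 N\<^esub> x = \<zero>\<^bsub>L2 N\<^esub>"
      proof (rule L2_eqI)
        show "AE t in N. ((-1) \<odot>\<^bsub>L2 N\<^esub> x \<oplus>\<^bsub>L2 N\<^esub> x) t = \<zero>\<^bsub>L2 N\<^esub> t"
          using L2_AE(1)[OF m x] L2_AE(2)[OF x x, of "-1"] L2_AE(3)[OF x x]
          by eventually_elim (simp del: L2_simps)
      qed (intro cl(1) cl(3)[OF x x] x m)+
    qed
  next
    show "\<zero>\<^bsub>L2 N\<^esub> \<in> carrier (L2 N)"
      unfolding L2_simps(2) by (rule ae_rep_in_L2) (simp add: square_integrable_def)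
  qed
  have sc: "carrier complex_ring = UNIV" "\<And>a b. a \<oplus>\<^bsub>complex_ring\<^esub> b = a + b"
    "\<And>a b. a \<otimes>\<^bsub>complex_ring\<^esub> b = a * b" "\<one>\<^bsub>complex_ring\<^esub> = 1"
    by (auto simp: complex_ring_def)
  show ?thesis
  proof (rule moduleI[OF cr ab], unfold sc)
    fix a b and x y assume x: "x \<in> carrier (L2 N)" and y: "y \<in> carrier (L2 N)"
    note c2 = cl(2)[OF x x] cl(2)[OF y y]
    show "a \<odot>\<^bsub>L2 N\<^esub> x \<in> carrier (L2 N)" by (rule c2)
    show "(a + b) \<odot>\<^bsub>L2 N\<^esub> x = a \<odot>\<^bsub>L2 N\<^esub> x \<oplus>\<^bsub>L2 N\<^esub> b \<odot>\<^bsub>L2 N\<^esub> x"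
    proof (rule L2_eqI)
      show "AE t in N. ((a + b) \<odot>\<^bsub>L2 N\<^esub> x) t = (a \<odot>\<^bsub>L2 N\<^esub> x \<oplus>\<^bsub>L2 N\<^esub> b \<odot>\<^bsub>L2 N\<^esub> x) t"
        using L2_AE(1)[OF c2(1) c2(1), of a b] L2_AE(2)[OF x x, of a] L2_AE(2)[OF x x, of b]
          L2_AE(2)[OF x x, of "a + b"]
        by eventually_elim (simp add: ring_distribs del: L2_simps)
    qed (intro cl(1) c2)+
    show "a \<odot>\<^bsub>L2 N\<^esub> (x \<oplus>\<^bsub>L2 N\<^esub> y) = a \<odot>\<^bsub>L2 N\<^esub> x \<oplus>\<^bsub>L2 N\<^esub> a \<odot>\<^bsub>L2 N\<^esub> y"
    proof (rule L2_eqI)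
      show "AE t in N. (a \<odot>\<^bsub>L2 N\<^esub> (x \<oplus>\<^bsub>L2 N\<^esub> y)) t = (a \<odot>\<^bsub>L2 N\<^esub> x \<oplus>\<^bsub>L2 N\<^esub> a \<odot>\<^bsub>L2 N\<^esub> y) t"
        using L2_AE(1)[OF c2(1) c2(2), of a a] L2_AE(2)[OF x x, of a] L2_AE(2)[OF y y, of a]
          L2_AE(1)[OF x y] L2_AE(2)[OF cl(1)[OF x y] x, of a]
        by eventually_elim (simp add: ring_distribs del: L2_simps)
    qed (intro cl(1) c2 cl(2)[OF cl(1)[OF x y] x])+
    show "(a * b) \<odot>\<^bsub>L2 N\<^esub> x = a \<odot>\<^bsub>L2 N\<^esub> (b \<odot>\<^bsub>L2 N\<^esub> x)"
    proof (rule L2_eqI)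
      show "AE t in N. ((a * b) \<odot>\<^bsub>L2 N\<^esub> x) t = (a \<odot>\<^bsub>L2 N\<^esub> (b \<odot>\<^bsub>L2 N\<^esub> x)) t"
        using L2_AE(2)[OF x x, of "a * b"] L2_AE(2)[OF x x, of b] L2_AE(2)[OF c2(1) x, of a b]
        by eventually_elim (simp del: L2_simps)
    qed (intro c2 cl(2)[OF c2(1) x])+
    show "1 \<odot>\<^bsub>L2 N\<^esub> x = x"
    proof (rule L2_eqI)
      show "AE t in N. (1 \<odot>\<^bsub>L2 N\<^esub> x) t = x t"
        using L2_AE(2)[OF x x, of 1] by eventually_elim simp
    qed (intro c2 x)+
  qed
qed

lemma L2_minus_AE:
  assumes f: "f \<in> carrier (L2 N)" and g: "g \<in> carrier (L2 N)"
  shows "f \<ominus>\<^bsub>L2 N\<^esub> g \<in> carrier (L2 N)" "AE x in N. (f \<ominus>\<^bsub>L2 N\<^esub> g) x = f x - g x"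
proof -
  interpret M: Module.module complex_ring "L2 N" by (rule module_L2)
  show "f \<ominus>\<^bsub>L2 N\<^esub> g \<in> carrier (L2 N)" using f g by (intro M.M.minus_closed)
  have "(f \<ominus>\<^bsub>L2 N\<^esub> g) \<oplus>\<^bsub>L2 N\<^esub> g = f"
    using f g by (simp add: M.M.minus_eq M.M.a_assoc M.M.l_neg del: L2_simps)
  then have "AE x in N. f x = (f \<ominus>\<^bsub>L2 N\<^esub> g) x + g x"
    using L2_AE(1)[OF \<open>f \<ominus>\<^bsub>L2 N\<^esub> g \<in> carrier (L2 N)\<close> g] by (simp del: L2_simps)
  then show "AE x in N. (f \<ominus>\<^bsub>L2 N\<^esub> g) x = f x - g x" by eventually_elim simp
qed

lemma hdist_L2:
  assumes f: "f \<in> carrier (L2 N)" and g: "g \<in> carrier (L2 N)"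
  shows "hnorm (L2 N) (f \<ominus>\<^bsub>L2 N\<^esub> g) = sqrt (\<integral>x. (cmod (f x - g x))\<^sup>2 \<partial>N)"
proof -
  note d = L2_minus_AE[OF f g]
  have [measurable]: "f \<in> borel_measurable N" "g \<in> borel_measurable N" "f \<ominus>\<^bsub>L2 N\<^esub> g \<in> borel_measurable N"
    using f g d(1) by (auto simp del: L2_simps dest!: L2_measurable)
  have "(\<integral>x. (cmod ((f \<ominus>\<^bsub>L2 N\<^esub> g) x))\<^sup>2 \<partial>N) = (\<integral>x. (cmod (f x - g x))\<^sup>2 \<partial>N)"
    by (rule integral_cong_AE) (use d(2) in \<open>measurable, eventually_elim, simp\<close>)
  then show ?thesis using d(1) by (simp add: hnorm_L2)
qed

lemma hilbert_space_L2: "hilbert_space (L2 N)"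
proof (rule hilbert_space.intro[OF module_L2], unfold_locales)
  fix x y z assume "x \<in> carrier (L2 N)" "y \<in> carrier (L2 N)" "z \<in> carrier (L2 N)"
  note xyz = this
  have sq: "square_integrable N x" "square_integrable N y" "square_integrable N z" using xyz by auto
  note [measurable] = sq[THEN square_integrable_measurable]
  have [measurable]: "(\<lambda>t. cnj (z t)) \<in> borel_measurable N" 
    by (rule borel_measurable_continuous_on[where f = cnj]) (auto intro: continuous_intros)
  have [measurable]: "x \<oplus>\<^bsub>L2 N\<^esub> y \<in> borel_measurable N"
    using L2_closed(1)[OF xyz(1,2)] by (rule L2_measurable)
  have "cinner (L2 N) (x \<oplus>\<^bsub>L2 N\<^esub> y) z = (\<integral>t. x t * cnj (z t) + y t * cnj (z t) \<partial>N)"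
    unfolding L2_simps(5)
    by (rule integral_cong_AE)
       (use L2_AE(1)[OF xyz(1,2)] in \<open>measurable, eventually_elim, simp add: ring_distribs del: L2_simps\<close>)
  also have "\<dots> = cinner (L2 N) x z + cinner (L2 N) y z"
    using sq by (simp add: square_integrable_prod)
  finally show "cinner (L2 N) (x \<oplus>\<^bsub>L2 N\<^esub> y) z = cinner (L2 N) x z + cinner (L2 N) y z" .
next
  fix x y c assume xy: "x \<in> carrier (L2 N)" "y \<in> carrier (L2 N)"
  have sq: "square_integrable N x" "square_integrable N y" using xy by auto
  note [measurable] = sq[THEN square_integrable_measurable]
  have [measurable]: "(\<lambda>t. cnj (y t)) \<in> borel_measurable N" 
    by (rule borel_measurable_continuous_on[where f = cnj]) (auto intro: continuous_intros)
  have [measurable]: "c \<odot>\<^bsub>L2 N\<^esub> x \<in> borel_measurable N"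
    using L2_closed(2)[OF xy] by (rule L2_measurable)
  have "cinner (L2 N) (c \<odot>\<^bsub>L2 N\<^esub> x) y = (\<integral>t. c * (x t * cnj (y t)) \<partial>N)"
    unfolding L2_simps(5)
    by (rule integral_cong_AE)
       (use L2_AE(2)[OF xy, of c] in \<open>measurable, eventually_elim, simp del: L2_simps\<close>)
  also have "\<dots> = c * cinner (L2 N) x y" by simp
  finally show "cinner (L2 N) (c \<odot>\<^bsub>L2 N\<^esub> x) y = c * cinner (L2 N) x y" .
next
  fix x y assume xy: "x \<in> carrier (L2 N)" "y \<in> carrier (L2 N)"
  have "cnj (cinner (L2 N) y x) = (\<integral>t. cnj (y t * cnj (x t)) \<partial>N)"
    unfolding L2_simps(5) by (simp del: complex_cnj_mult)
  then show "cinner (L2 N) x y = cnj (cinner (L2 N) y x)" by (simp add: mult.commute)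
next
  fix x assume x: "x \<in> carrier (L2 N)"
  then show "0 \<le> Re (cinner (L2 N) x x)"
    by (simp add: integral_norm_square)
next
  fix x assume x: "x \<in> carrier (L2 N)" and 0: "cinner (L2 N) x x = 0"
  have i: "integrable N (\<lambda>t. (cmod (x t))\<^sup>2)" using x by (simp add: square_integrable_integrable)
  have "(\<integral>t. (cmod (x t))\<^sup>2 \<partial>N) = 0" using 0 x by (simp add: integral_norm_square)
  then have "AE t in N. (cmod (x t))\<^sup>2 = 0"
    using integral_nonneg_eq_0_iff_AE[OF i] by simp
  then have "AE t in N. x t = \<zero>\<^bsub>L2 N\<^esub> t"
    using L2_AE(3)[OF x x] by eventually_elim (simp del: L2_simps)
  then show "x = \<zero>\<^bsub>L2 N\<^esub>" by (rule L2_eqI[OF x L2_closed(3)[OF x x]])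
next
  fix s :: "nat \<Rightarrow> _" assume s: "\<And>n. s n \<in> carrier (L2 N)"
    and c: "\<And>e. e > 0 \<Longrightarrow> \<exists>K. \<forall>m\<ge>K. \<forall>n\<ge>K. hnorm (L2 N) (s m \<ominus>\<^bsub>L2 N\<^esub> s n) < e"
  have sq: "square_integrable N (s n)" for n using s by simp
  have "\<exists>l. square_integrable N l \<and> (\<forall>e>0. \<exists>K. \<forall>n\<ge>K. (\<integral>\<^sup>+x. ennreal ((cmod (s n x - l x))\<^sup>2) \<partial>N) \<le> ennreal e)"
  proof (rule riesz_fischer[OF sq])
    fix e :: real assume e: "e > 0"
    then obtain K where K: "\<forall>m\<ge>K. \<forall>n\<ge>K. hnorm (L2 N) (s m \<ominus>\<^bsub>L2 N\<^esub> s n) < sqrt e"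
      using c[of "sqrt e"] by auto
    have "(\<integral>\<^sup>+x. ennreal ((cmod (s m x - s n x))\<^sup>2) \<partial>N) < ennreal e" if "m \<ge> K" "n \<ge> K" for m n
      using K that e
      by (auto simp: ennreal_L2 square_integrable_diff sq hdist_L2[OF s s] ennreal_less_iff simp del: L2_simps)
    then show "\<exists>K. \<forall>m\<ge>K. \<forall>n\<ge>K. (\<integral>\<^sup>+x. ennreal ((cmod (s m x - s n x))\<^sup>2) \<partial>N) < ennreal e" by blast
  qed
  then obtain l where l: "square_integrable N l"
    "\<And>e. e > 0 \<Longrightarrow> \<exists>K. \<forall>n\<ge>K. (\<integral>\<^sup>+x. ennreal ((cmod (s n x - l x))\<^sup>2) \<partial>N) \<le> ennreal e" by blast
  define l' where "l' = ae_rep N l"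
  have l': "l' \<in> carrier (L2 N)" unfolding l'_def by (rule ae_rep_in_L2[OF l(1)])
  have ael: "AE x in N. l' x = l x"
    unfolding l'_def by (rule ae_rep_AE) (use l(1) in \<open>simp add: square_integrable_def\<close>)
  have [measurable]: "l \<in> borel_measurable N" "l' \<in> borel_measurable N" "\<And>n. s n \<in> borel_measurable N"
    using l(1) l' s by (auto simp: square_integrable_def)
  have h: "hnorm (L2 N) (s n \<ominus>\<^bsub>L2 N\<^esub> l') = sqrt (\<integral>x. (cmod (s n x - l x))\<^sup>2 \<partial>N)" for n
    unfolding hdist_L2[OF s l']
    by (intro arg_cong[where f = sqrt] integral_cong_AE) (use ael in \<open>measurable, eventually_elim, simp\<close>)
  have "(\<lambda>n. hnorm (L2 N) (s n \<ominus>\<^bsub>L2 N\<^esub> l')) \<longlonglongrightarrow> 0"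
  proof (rule LIMSEQ_I)
    fix e :: real assume e: "e > 0"
    then have "e\<^sup>2 / 2 > 0" by simp
    then obtain K where K: "\<forall>n\<ge>K. (\<integral>\<^sup>+x. ennreal ((cmod (s n x - l x))\<^sup>2) \<partial>N) \<le> ennreal (e\<^sup>2 / 2)"
      using l(2) by blast
    have "norm (hnorm (L2 N) (s n \<ominus>\<^bsub>L2 N\<^esub> l') - 0) < e" if "n \<ge> K" for n
    proof -
      have "(\<integral>x. (cmod (s n x - l x))\<^sup>2 \<partial>N) \<le> e\<^sup>2 / 2"
        using K that e by (auto simp: ennreal_L2 square_integrable_diff sq l(1))
      also have "\<dots> < e\<^sup>2" using e by simp
      finally show ?thesis unfolding h using e by (simp add: real_less_lsqrt)
    qed
    then show "\<exists>no. \<forall>n\<ge>no. norm (hnorm (L2 N) (s n \<ominus>\<^bsub>L2 N\<^esub> l') - 0) < e" by blast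
  qed
  with l' show "\<exists>l\<in>carrier (L2 N). (\<lambda>n. hnorm (L2 N) (s n \<ominus>\<^bsub>L2 N\<^esub> l)) \<longlonglongrightarrow> 0" by (intro bexI[of _ l'])
qed

section \<open>Kazhdan pairs and measure preserving actions\<close>

text \<open>
  This is the defining property of a Kazhdan pair for the Koopman representation \<open>f \<mapsto> f \<circ> T k\<^sup>-\<^sup>1\<close>: the squared
  displacement of the indicator of \<open>S\<close> is the measure of the set where \<open>S\<close> and its translate differ. The
  function \<open>h\<close> is the squared modulus of an invariant vector. The group laws are only required almost
  everywhere because the action on classes below satisfies \<open>T \<one> z = z\<close> only outside a null set.
\<close>

lemma kazhdan_koopman:
  fixes \<Gamma> :: "('g, 'b) monoid_scheme" (structure) and N :: "'z measure"
  assumes G: "group \<Gamma>" "countable (carrier \<Gamma>)" and kp: "kazhdan_pair \<Gamma> Q \<epsilon>"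
    and T: "\<And>k. k \<in> carrier \<Gamma> \<Longrightarrow> T k \<in> measurable N N" "\<And>k. k \<in> carrier \<Gamma> \<Longrightarrow> distr N N (T k) = N"
    and Tmult: "\<And>k l. \<lbrakk>k \<in> carrier \<Gamma>; l \<in> carrier \<Gamma>\<rbrakk> \<Longrightarrow> AE z in N. T (k \<otimes> l) z = T k (T l z)"
    and Tone: "AE z in N. T \<one> z = z"
    and S: "S \<in> sets N" "emeasure N S < \<infinity>"
    and ai: "\<And>q. q \<in> Q \<Longrightarrow> measure N {z\<in>space N. T q z \<in> S \<longleftrightarrow> z \<notin> S} < \<epsilon>\<^sup>2 * measure N S"
  obtains h :: "'z \<Rightarrow> real" where "h \<in> borel_measurable N" "\<And>z. h z \<ge> 0" "(\<integral>\<^sup>+z. ennreal (h z) \<partial>N) < \<infinity>"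
    "\<And>k. k \<in> carrier \<Gamma> \<Longrightarrow> AE z in N. h (T k z) = h z" "\<not> (AE z in N. h z = 0)"
proof -
  interpret G: group \<Gamma> by fact
  have AET: "AE z in N. P (T k z)" if "k \<in> carrier \<Gamma>" "AE z in N. P z" for k P
    using AE_distrD[OF T(1)[OF that(1)]] that T(2) by metis
  define \<pi> where "\<pi> k f = ae_rep N (\<lambda>z. f (T (inv k) z))" for k f
  have comp: "square_integrable N (\<lambda>z. f (T k z))" if "k \<in> carrier \<Gamma>" "square_integrable N f" for k f
  proof -
    have [measurable]: "f \<in> borel_measurable N" "T k \<in> measurable N N"
      using that T by (auto simp: square_integrable_def)
    have "(\<integral>\<^sup>+z. ennreal ((cmod (f (T k z)))\<^sup>2) \<partial>N) = (\<integral>\<^sup>+z. ennreal ((cmod (f z))\<^sup>2) \<partial>distr N N (T k))"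
      by (subst nn_integral_distr) auto
    then show ?thesis using that(2) T(2)[OF that(1)] by (simp add: square_integrable_def)
  qed
  have \<pi>_in: "\<pi> k f \<in> carrier (L2 N)" if "k \<in> carrier \<Gamma>" "f \<in> carrier (L2 N)" for k f
    unfolding \<pi>_def using that by (intro ae_rep_in_L2 comp) auto
  have \<pi>_AE: "AE z in N. \<pi> k f z = f (T (inv k) z)" if "k \<in> carrier \<Gamma>" "f \<in> carrier (L2 N)" for k f
    unfolding \<pi>_def using that by (intro ae_rep_AE square_integrable_measurable comp) auto
  have \<pi>_mult: "\<pi> (k \<otimes> l) f = \<pi> k (\<pi> l f)"
    if k: "k \<in> carrier \<Gamma>" and l: "l \<in> carrier \<Gamma>" and f: "f \<in> carrier (L2 N)" for k l f
  proof (rule L2_eqI)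
    have "AE z in N. T (inv (k \<otimes> l)) z = T (inv l) (T (inv k) z)"
      using Tmult[of "inv l" "inv k"] k l by (simp add: G.inv_mult_group)
    moreover have "AE z in N. \<pi> l f (T (inv k) z) = f (T (inv l) (T (inv k) z))"
      using k by (intro AET \<pi>_AE l f) auto
    ultimately show "AE z in N. \<pi> (k \<otimes> l) f z = \<pi> k (\<pi> l f) z"
      using \<pi>_AE[OF k \<pi>_in[OF l f]] \<pi>_AE[OF G.m_closed[OF k l] f] by eventually_elim simp
  qed (intro \<pi>_in G.m_closed k l f)+
  have \<pi>_one: "\<pi> \<one> f = f" if f: "f \<in> carrier (L2 N)" for f
  proof (rule L2_eqI)
    show "AE z in N. \<pi> \<one> f z = f z"
      using \<pi>_AE[OF G.one_closed f] Tone by eventually_elim simp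
  qed (intro \<pi>_in G.one_closed f)+
  have int_T: "(\<integral>z. F (T k z) \<partial>N) = (\<integral>z. F z \<partial>N)"
    if "k \<in> carrier \<Gamma>" "F \<in> borel_measurable N" for k and F :: "'z \<Rightarrow> 'c :: {banach, second_countable_topology}"
    using integral_distr[OF T(1)[OF that(1)] that(2)] T(2)[OF that(1)] by simp
  have rep: "unitary_representation \<Gamma> (L2 N) \<pi>"
    unfolding unitary_representation_def
  proof (intro conjI ballI \<pi>_mult)
    fix k assume k: "k \<in> carrier \<Gamma>"
    note [simp del] = L2_simps(1)
    have k': "inv k \<in> carrier \<Gamma>" using k by simp
    show "unitary_operator (L2 N) (\<pi> k)"
      unfolding unitary_operator_def
    proof (intro conjI ballI allI)
      show "bij_betw (\<pi> k) (carrier (L2 N)) (carrier (L2 N))"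
      proof (rule bij_betw_byWitness[where f' = "\<pi> (inv k)"])
        show "\<forall>f\<in>carrier (L2 N). \<pi> (inv k) (\<pi> k f) = f"
          using k by (auto simp: \<pi>_mult[symmetric] \<pi>_one)
        show "\<forall>f\<in>carrier (L2 N). \<pi> k (\<pi> (inv k) f) = f"
          using k by (auto simp: \<pi>_mult[symmetric] \<pi>_one)
      qed (use k \<pi>_in in auto)
    next
      fix f g assume f: "f \<in> carrier (L2 N)" and g: "g \<in> carrier (L2 N)"
      show "\<pi> k (f \<oplus>\<^bsub>L2 N\<^esub> g) = \<pi> k f \<oplus>\<^bsub>L2 N\<^esub> \<pi> k g"
      proof (rule L2_eqI)
        show "AE z in N. \<pi> k (f \<oplus>\<^bsub>L2 N\<^esub> g) z = (\<pi> k f \<oplus>\<^bsub>L2 N\<^esub> \<pi> k g) z"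
          using \<pi>_AE[OF k L2_closed(1)[OF f g]] \<pi>_AE[OF k f] \<pi>_AE[OF k g]
            L2_AE(1)[OF \<pi>_in[OF k f] \<pi>_in[OF k g]] AET[OF k' L2_AE(1)[OF f g]]
          by eventually_elim (simp del: L2_simps)
      qed (intro \<pi>_in L2_closed(1) k f g)+
      have [measurable]: "f \<in> borel_measurable N" "g \<in> borel_measurable N"
        "\<pi> k f \<in> borel_measurable N" "\<pi> k g \<in> borel_measurable N" "T (inv k) \<in> measurable N N"
        using f g \<pi>_in[OF k f] \<pi>_in[OF k g] T(1)[OF k'] by (auto dest: L2_measurable)
      have cm [measurable]: "(\<lambda>z. cnj (u z)) \<in> borel_measurable N" if "u \<in> borel_measurable N" for u
        using that by (intro borel_measurable_continuous_on[where f = cnj]) (auto intro: continuous_intros)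
      have "cinner (L2 N) (\<pi> k f) (\<pi> k g)
          = (\<integral>z. (\<lambda>z. f z * cnj (g z)) (T (inv k) z) \<partial>N)"
        unfolding L2_simps(5)
      proof (rule integral_cong_AE)
        have [measurable]: "(\<lambda>z. f z * cnj (g z)) \<in> borel_measurable N" by measurable
        show "(\<lambda>z. (\<lambda>z. f z * cnj (g z)) (T (inv k) z)) \<in> borel_measurable N"
          by (rule measurable_compose[of "T (inv k)" N N]) measurable
        show "AE z in N. \<pi> k f z * cnj (\<pi> k g z) = (\<lambda>z. f z * cnj (g z)) (T (inv k) z)"
          using \<pi>_AE[OF k f] \<pi>_AE[OF k g] by eventually_elim simp
      qed measurable
      also have "\<dots> = cinner (L2 N) f g"
        unfolding L2_simps(5) by (rule int_T[OF k']) measurable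
      finally show "cinner (L2 N) (\<pi> k f) (\<pi> k g) = cinner (L2 N) f g" .
    next
      fix c f assume f: "f \<in> carrier (L2 N)"
      show "\<pi> k (c \<odot>\<^bsub>L2 N\<^esub> f) = c \<odot>\<^bsub>L2 N\<^esub> \<pi> k f"
      proof (rule L2_eqI)
        show "AE z in N. \<pi> k (c \<odot>\<^bsub>L2 N\<^esub> f) z = (c \<odot>\<^bsub>L2 N\<^esub> \<pi> k f) z"
          using \<pi>_AE[OF k L2_closed(2)[OF f f], of c] \<pi>_AE[OF k f]
            L2_AE(2)[OF \<pi>_in[OF k f] f, of c] AET[OF k' L2_AE(2)[OF f f, of c]]
          by eventually_elim (simp del: L2_simps)
      qed (intro \<pi>_in L2_closed(2)[where g = f] k f)+
    qed
  qed
  define \<xi> where "\<xi> = ae_rep N (indicator S)"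
  have sqS: "square_integrable N (indicator S)"
  proof -
    have "(cmod (indicator S z))\<^sup>2 = indicator S z" for z by (simp add: indicator_def)
    then show ?thesis using S by (simp add: square_integrable_def ennreal_indicator)
  qed
  have \<xi>: "\<xi> \<in> carrier (L2 N)" unfolding \<xi>_def by (rule ae_rep_in_L2[OF sqS])
  have \<xi>_AE: "AE z in N. \<xi> z = indicator S z"
    unfolding \<xi>_def using S by (intro ae_rep_AE) simp
  have [measurable]: "\<xi> \<in> borel_measurable N" "S \<in> sets N" using L2_measurable[OF \<xi>] S by auto
  have norm\<xi>: "(hnorm (L2 N) \<xi>)\<^sup>2 = measure N S"
  proof -
    have "(\<integral>z. (cmod (\<xi> z))\<^sup>2 \<partial>N) = (\<integral>z. indicator S z \<partial>N)"
      by (rule integral_cong_AE) (use \<xi>_AE in \<open>measurable, eventually_elim, simp add: indicator_def\<close>)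
    also have "\<dots> = measure N S" using S by (simp add: Int_absorb1 sets.sets_into_space)
    finally show ?thesis using \<xi> by (simp add: hnorm_L2)
  qed
  have Qc: "Q \<subseteq> carrier \<Gamma>" and epos: "\<epsilon> > 0" using kp by (auto simp: kazhdan_pair_def)
  have "has_almost_invariant_vector (L2 N) \<pi> Q \<epsilon>"
    unfolding has_almost_invariant_vector_def
  proof (intro bexI ballI)
    fix q assume q: "q \<in> Q"
    then have qc: "q \<in> carrier \<Gamma>" using Qc by auto
    have [measurable]: "T q \<in> measurable N N" "\<pi> q \<xi> \<in> borel_measurable N"
      using T(1) qc \<pi>_in[OF qc \<xi>] by (auto dest: L2_measurable simp del: L2_simps)
    have 1: "(\<lambda>z. (cmod (\<pi> q \<xi> z - \<xi> z))\<^sup>2) \<in> borel_measurable N" by measurable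
    have "AE z in N. T \<one> z = T (inv q) (T q z)"
      using Tmult[OF G.inv_closed[OF qc] qc] qc by simp
    then have "AE z in N. T (inv q) (T q z) = z"
      using Tone by eventually_elim simp
    then have AEq: "AE z in N. \<pi> q \<xi> (T q z) - \<xi> (T q z) = indicator S z - indicator S (T q z)"
      using AET[OF qc \<pi>_AE[OF qc \<xi>]] AET[OF qc \<xi>_AE] \<xi>_AE by eventually_elim simp
    \<comment> \<open>Substituting \<open>T q z\<close> for \<open>z\<close> turns the translate by \<open>q\<^sup>-\<^sup>1\<close> in the representation into one by \<open>q\<close>.\<close>
    have "(\<integral>z. (cmod (\<pi> q \<xi> z - \<xi> z))\<^sup>2 \<partial>N) = (\<integral>z. (cmod (\<pi> q \<xi> (T q z) - \<xi> (T q z)))\<^sup>2 \<partial>N)"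
      by (rule int_T[OF qc 1, symmetric])
    also have "\<dots> = (\<integral>z. indicator {z\<in>space N. T q z \<in> S \<longleftrightarrow> z \<notin> S} z \<partial>N)"
    proof (rule integral_cong_AE)
      show "AE z in N. (cmod (\<pi> q \<xi> (T q z) - \<xi> (T q z)))\<^sup>2 = indicator {z\<in>space N. T q z \<in> S \<longleftrightarrow> z \<notin> S} z"
        using AEq AE_space by eventually_elim (auto simp: indicator_def)
    qed measurable
    also have "\<dots> = measure N {z\<in>space N. T q z \<in> S \<longleftrightarrow> z \<notin> S}"
      by (simp add: Int_absorb1)
    finally have "hnorm (L2 N) (\<pi> q \<xi> \<ominus>\<^bsub>L2 N\<^esub> \<xi>) = sqrt (measure N {z\<in>space N. T q z \<in> S \<longleftrightarrow> z \<notin> S})"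
      using hdist_L2[OF \<pi>_in[OF qc \<xi>] \<xi>] by simp
    also have "\<dots> < sqrt (\<epsilon>\<^sup>2 * (hnorm (L2 N) \<xi>)\<^sup>2)"
      using ai[OF q] norm\<xi> by simp
    also have "\<dots> = \<epsilon> * hnorm (L2 N) \<xi>"
      using epos hilbert_space.hnorm_nonneg[OF hilbert_space_L2 \<xi>] by (simp add: real_sqrt_mult)
    finally show "hnorm (L2 N) (\<pi> q \<xi> \<ominus>\<^bsub>L2 N\<^esub> \<xi>) < \<epsilon> * hnorm (L2 N) \<xi>" .
  qed (rule \<xi>)
  then have "has_invariant_vector \<Gamma> (L2 N) \<pi>"
    by (rule kazhdan_pair_any_type[OF G kp hilbert_space_L2 rep])
  then obtain \<eta> where \<eta>: "\<eta> \<in> carrier (L2 N)" "\<eta> \<noteq> \<zero>\<^bsub>L2 N\<^esub>" "\<And>k. k \<in> carrier \<Gamma> \<Longrightarrow> \<pi> k \<eta> = \<eta>"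
    by (auto simp: has_invariant_vector_def)
  show thesis
  proof (rule that[of "\<lambda>z. (cmod (\<eta> z))\<^sup>2"])
    have [measurable]: "\<eta> \<in> borel_measurable N" using \<eta>(1) by (rule L2_measurable)
    show "(\<lambda>z. (cmod (\<eta> z))\<^sup>2) \<in> borel_measurable N" by measurable
    show "(\<integral>\<^sup>+z. ennreal ((cmod (\<eta> z))\<^sup>2) \<partial>N) < \<infinity>" using \<eta>(1) by (simp add: square_integrable_def)
    show "AE z in N. (cmod (\<eta> (T k z)))\<^sup>2 = (cmod (\<eta> z))\<^sup>2" if k: "k \<in> carrier \<Gamma>" for k
    proof -
      have "AE z in N. \<eta> z = \<eta> (T k z)"
        using \<pi>_AE[OF G.inv_closed[OF k] \<eta>(1)] \<eta>(3)[OF G.inv_closed[OF k]] k by simp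
      then show ?thesis by eventually_elim simp
    qed
    show "\<not> (AE z in N. (cmod (\<eta> z))\<^sup>2 = 0)"
    proof
      assume "AE z in N. (cmod (\<eta> z))\<^sup>2 = 0"
      then have "AE z in N. \<eta> z = \<zero>\<^bsub>L2 N\<^esub> z"
        using L2_AE(3)[OF \<eta>(1) \<eta>(1)] by eventually_elim (simp del: L2_simps)
      then show False using L2_eqI[OF \<eta>(1) L2_closed(3)[OF \<eta>(1) \<eta>(1)]] \<eta>(2) by blast
    qed
  qed simp
qed

text \<open>
  An invariant function on the group is constant, hence not summable on an infinite group unless it
  vanishes. So the regular representation has no invariant vector, and no finite set may be almost invariant.
\<close>

lemma kazhdan_regular_representation:
  fixes \<Gamma> :: "('g, 'b) monoid_scheme" (structure)
  assumes G: "group \<Gamma>" "countable (carrier \<Gamma>)" "infinite (carrier \<Gamma>)" and kp: "kazhdan_pair \<Gamma> Q \<epsilon>"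
    and S: "finite S" "S \<subseteq> carrier \<Gamma>"
  shows "\<exists>q\<in>Q. \<epsilon>\<^sup>2 * real (card S) \<le> real (card {z\<in>carrier \<Gamma>. q \<otimes> z \<in> S \<longleftrightarrow> z \<notin> S})"
proof (rule ccontr)
  assume "\<not> ?thesis"
  then have less: "real (card {z\<in>carrier \<Gamma>. q \<otimes> z \<in> S \<longleftrightarrow> z \<notin> S}) < \<epsilon>\<^sup>2 * real (card S)" if "q \<in> Q" for q
    using that by (auto simp: not_le)
  interpret G: group \<Gamma> by fact
  let ?N = "count_space (carrier \<Gamma>)"
  have Qc: "Q \<subseteq> carrier \<Gamma>" using kp by (auto simp: kazhdan_pair_def)
  have bij: "bij_betw (\<lambda>z. k \<otimes> z) (carrier \<Gamma>) (carrier \<Gamma>)" if "k \<in> carrier \<Gamma>" for k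
    by (rule bij_betw_byWitness[where f' = "\<lambda>z. inv k \<otimes> z"])
       (use that in \<open>auto simp: G.m_assoc[symmetric]\<close>)
  have fin: "finite {z\<in>carrier \<Gamma>. q \<otimes> z \<in> S \<longleftrightarrow> z \<notin> S}" if q: "q \<in> Q" for q
  proof (rule finite_subset)
    show "{z\<in>carrier \<Gamma>. q \<otimes> z \<in> S \<longleftrightarrow> z \<notin> S} \<subseteq> S \<union> (\<lambda>s. inv q \<otimes> s) ` S"
    proof
      fix z assume z: "z \<in> {z\<in>carrier \<Gamma>. q \<otimes> z \<in> S \<longleftrightarrow> z \<notin> S}"
      moreover have "z = inv q \<otimes> (q \<otimes> z)" using z q Qc by (auto simp: G.m_assoc[symmetric])
      ultimately show "z \<in> S \<union> (\<lambda>s. inv q \<otimes> s) ` S" by blast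
    qed
  qed (use S in auto)
  obtain h :: "'g \<Rightarrow> real" where h: "\<And>z. h z \<ge> 0" "(\<integral>\<^sup>+z. ennreal (h z) \<partial>?N) < \<infinity>"
    "\<And>k. k \<in> carrier \<Gamma> \<Longrightarrow> AE z in ?N. h (k \<otimes> z) = h z" "\<not> (AE z in ?N. h z = 0)"
  proof (rule kazhdan_koopman[OF G(1,2) kp, where N = ?N and T = "\<lambda>k z. k \<otimes> z" and S = S])
    fix k assume k: "k \<in> carrier \<Gamma>"
    then show "(\<lambda>z. k \<otimes> z) \<in> measurable ?N ?N" by auto
    show "distr ?N ?N (\<lambda>z. k \<otimes> z) = ?N" by (rule distr_bij_count_space[OF bij[OF k]])
  next
    fix q assume "q \<in> Q"
    then show "measure ?N {z\<in>space ?N. q \<otimes> z \<in> S \<longleftrightarrow> z \<notin> S} < \<epsilon>\<^sup>2 * measure ?N S"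
      using less fin S by (simp add: measure_count_space)
  qed (use S in \<open>auto simp: AE_count_space emeasure_count_space G.m_assoc of_nat_less_top\<close>)
  have const: "h z = h \<one>" if "z \<in> carrier \<Gamma>" for z
  proof -
    have "\<forall>w\<in>carrier \<Gamma>. h (z \<otimes> w) = h w" using h(3)[OF that] by (simp add: AE_count_space)
    then have "h (z \<otimes> \<one>) = h \<one>" using G.one_closed by (rule bspec)
    then show ?thesis using that by simp
  qed
  have "(\<integral>\<^sup>+z. ennreal (h z) \<partial>?N) = (\<integral>\<^sup>+z. ennreal (h \<one>) \<partial>?N)"
    by (rule nn_integral_cong, rule arg_cong[where f = ennreal], rule const) simp
  also have "\<dots> = ennreal (h \<one>) * \<infinity>"
    using G(3) by (simp add: emeasure_count_space)
  finally have "h \<one> = 0"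
    using h(1)[of "\<one>"] h(2) by (cases "h \<one> = 0") (auto simp: ennreal_mult_top less_le)
  then have "\<forall>z\<in>carrier \<Gamma>. h z = 0" using const by metis
  with h(4) show False by (simp add: AE_count_space)
qed

text \<open>A translate of a single point differs from it in at most two points.\<close>

lemma kazhdan_pair_square_le_2:
  fixes \<Gamma> :: "('g, 'b) monoid_scheme" (structure)
  assumes G: "group \<Gamma>" "countable (carrier \<Gamma>)" "infinite (carrier \<Gamma>)" and kp: "kazhdan_pair \<Gamma> Q \<epsilon>"
  shows "\<epsilon>\<^sup>2 \<le> 2"
proof -
  interpret G: group \<Gamma> by fact
  obtain q where q: "q \<in> Q"
    "\<epsilon>\<^sup>2 * 1 \<le> real (card {z\<in>carrier \<Gamma>. q \<otimes> z \<in> {\<one>} \<longleftrightarrow> z \<notin> {\<one>}})"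
    using kazhdan_regular_representation[OF G kp, of "{\<one>}"] by auto
  have qc: "q \<in> carrier \<Gamma>" using q kp by (auto simp: kazhdan_pair_def)
  have "{z\<in>carrier \<Gamma>. q \<otimes> z \<in> {\<one>} \<longleftrightarrow> z \<notin> {\<one>}} \<subseteq> {\<one>, inv q}"
  proof
    fix z assume "z \<in> {z\<in>carrier \<Gamma>. q \<otimes> z \<in> {\<one>} \<longleftrightarrow> z \<notin> {\<one>}}"
    then have z: "z \<in> carrier \<Gamma>" "z = \<one> \<or> q \<otimes> z = \<one>" by auto
    have "z = inv q" if "q \<otimes> z = \<one>"
      using G.inv_equality[OF G.inv_comm[OF that qc z(1)] qc z(1)] by (rule sym)
    with z show "z \<in> {\<one>, inv q}" by blast
  qed
  then have "card {z\<in>carrier \<Gamma>. q \<otimes> z \<in> {\<one>} \<longleftrightarrow> z \<notin> {\<one>}} \<le> card {\<one>, inv q}"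
    by (rule card_mono[rotated]) simp
  also have "\<dots> \<le> 2" by (simp add: card_insert_if)
  finally show ?thesis using q(2) by linarith
qed

text \<open>
  An infinite cyclic group is amenable: a translate of the interval of powers \<open>\<gamma>\<^sup>i\<close>, \<open>i < m\<close>, by \<open>\<gamma>\<close> differs from
  it in two points only, however large \<open>m\<close> is.
\<close>

lemma kazhdan_pair_not_cyclic:
  fixes \<Gamma> :: "('g, 'b) monoid_scheme" (structure)
  assumes G: "group \<Gamma>" "countable (carrier \<Gamma>)" "infinite (carrier \<Gamma>)" and kp: "kazhdan_pair \<Gamma> Q \<epsilon>"
    and \<gamma>: "\<gamma> \<in> Q" "group.ord \<Gamma> \<gamma> = 0"
  shows "Q \<noteq> {\<gamma>}"
proof
  assume Q: "Q = {\<gamma>}"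
  interpret G: group \<Gamma> by fact
  have \<gamma>c: "\<gamma> \<in> carrier \<Gamma>" and epos: "\<epsilon> > 0" using \<gamma> kp by (auto simp: kazhdan_pair_def)
  obtain m :: nat where m: "2 / \<epsilon>\<^sup>2 < real m" using reals_Archimedean2 by blast
  have inj: "inj_on (\<lambda>i::nat. \<gamma> [^] i) {..<m}"
  proof (rule inj_onI)
    fix i j :: nat assume "\<gamma> [^] i = \<gamma> [^] j"
    then have "\<gamma> [^] int i = \<gamma> [^] int j" by (simp add: int_pow_int)
    then show "i = j" using \<gamma> \<gamma>c by (simp add: G.int_pow_eq)
  qed
  let ?S = "(\<lambda>i::nat. \<gamma> [^] i) ` {..<m}"
  have card: "card ?S = m" using card_image[OF inj] by simp
  have "{z\<in>carrier \<Gamma>. \<gamma> \<otimes> z \<in> ?S \<longleftrightarrow> z \<notin> ?S} \<subseteq> {inv \<gamma>, \<gamma> [^] (m - 1)}"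
  proof
    fix z assume "z \<in> {z\<in>carrier \<Gamma>. \<gamma> \<otimes> z \<in> ?S \<longleftrightarrow> z \<notin> ?S}"
    then have zc: "z \<in> carrier \<Gamma>" and z: "\<gamma> \<otimes> z \<in> ?S \<longleftrightarrow> z \<notin> ?S" by auto
    show "z \<in> {inv \<gamma>, \<gamma> [^] (m - 1)}"
    proof (cases "z \<in> ?S")
      case True
      then obtain i where i: "i < m" "z = \<gamma> [^] i" by auto
      have "\<gamma> \<otimes> z = \<gamma> [^] Suc i" unfolding i(2) by (rule G.nat_pow_Suc2[OF \<gamma>c, symmetric])
      moreover have "\<gamma> \<otimes> z \<notin> ?S" using z True by blast
      ultimately have "\<not> Suc i < m" by (metis imageI lessThan_iff)
      then have "i = m - 1" using i by simp
      then show ?thesis using i by simp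
    next
      case False
      then obtain i where i: "i < m" "\<gamma> \<otimes> z = \<gamma> [^] i" using z by auto
      show ?thesis
      proof (cases i)
        case 0
        then have "\<gamma> \<otimes> z = \<one>" using i by simp
        then have "z \<otimes> \<gamma> = \<one>" using G.inv_comm zc \<gamma>c by blast
        then show ?thesis using G.inv_equality zc \<gamma>c by auto
      next
        case (Suc j)
        then have "\<gamma> \<otimes> z = \<gamma> \<otimes> \<gamma> [^] j"
          using i(2) G.nat_pow_Suc2[OF \<gamma>c, of j] by simp
        then have "z = \<gamma> [^] j" using \<gamma>c zc by simp
        then show ?thesis using False i Suc by auto
      qed
    qed
  qed
  then have "card {z\<in>carrier \<Gamma>. \<gamma> \<otimes> z \<in> ?S \<longleftrightarrow> z \<notin> ?S} \<le> card {inv \<gamma>, \<gamma> [^] (m - 1)}"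
    by (rule card_mono[rotated]) simp
  also have "\<dots> \<le> 2" by (simp add: card_insert_if)
  finally have "\<epsilon>\<^sup>2 * real m \<le> 2"
    using kazhdan_regular_representation[OF G kp, of ?S] \<gamma>c unfolding Q card by fastforce
  with m epos show False by (simp add: field_simps)
qed

text \<open>
  \<open>L\<close> is the length of a word for \<open>g\<close>. It is chosen before the representation and the vector; this
  uniformity is what allows Kazhdan pairs to be transferred between generating sets.
\<close>

lemma displacement_generate:
  fixes \<Gamma> :: "('g, 'b) monoid_scheme" (structure)
  assumes G: "group \<Gamma>" and Q: "Q \<subseteq> carrier \<Gamma>" and g: "g \<in> generate \<Gamma> Q"
  shows "\<exists>L::nat. \<forall>(H :: 'h inner_space) \<pi> \<xi> t. hilbert_space H \<and> unitary_representation \<Gamma> H \<pi> \<and> \<xi> \<in> carrier H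
    \<and> (\<forall>q\<in>Q. hnorm H (\<pi> q \<xi> \<ominus>\<^bsub>H\<^esub> \<xi>) \<le> t) \<longrightarrow> hnorm H (\<pi> g \<xi> \<ominus>\<^bsub>H\<^esub> \<xi>) \<le> real L * t"
  using g
proof (induction rule: generate.induct)
  interpret G: group \<Gamma> by fact
  have U: "unitary_operator H (\<pi> k)" if "unitary_representation \<Gamma> H \<pi>" "k \<in> carrier \<Gamma>" for H :: "'h inner_space" and \<pi> k
    using that by (simp add: unitary_representation_def)
  have mult: "\<pi> (k \<otimes> l) x = \<pi> k (\<pi> l x)" if "unitary_representation \<Gamma> H \<pi>" "k \<in> carrier \<Gamma>"
      "l \<in> carrier \<Gamma>" "x \<in> carrier H" for H :: "'h inner_space" and \<pi> k l x
    using that by (simp add: unitary_representation_def)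
  have pone: "\<pi> \<one> x = x" if r: "unitary_representation \<Gamma> H \<pi>" and x: "x \<in> carrier H"
    for H :: "'h inner_space" and \<pi> x
  proof -
    have "\<pi> \<one> (\<pi> \<one> x) = \<pi> \<one> x" using mult[OF r G.one_closed G.one_closed x] by simp
    then show ?thesis
      using unitary_operatorD(1,2)[OF U[OF r G.one_closed]] x by (auto dest: inj_onD)
  qed
  {
    case one
    show ?case
    proof (intro exI[of _ 0] allI impI; elim conjE)
      fix H :: "'h inner_space" and \<pi> \<xi> t
      assume H: "hilbert_space H" "unitary_representation \<Gamma> H \<pi>" "\<xi> \<in> carrier H"
      then show "hnorm H (\<pi> \<one> \<xi> \<ominus>\<^bsub>H\<^esub> \<xi>) \<le> real 0 * t"
        using pone[OF H(2,3)] hilbert_space.hdist_self[OF H(1,3)] by simp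
    qed
  next
    case (incl h)
    then show ?case by (intro exI[of _ 1]) auto
  next
    case (inv h)
    show ?case
    proof (intro exI[of _ 1] allI impI; elim conjE)
      fix H :: "'h inner_space" and \<pi> \<xi> t
      assume H: "hilbert_space H" "unitary_representation \<Gamma> H \<pi>" "\<xi> \<in> carrier H"
        and t: "\<forall>q\<in>Q. hnorm H (\<pi> q \<xi> \<ominus>\<^bsub>H\<^esub> \<xi>) \<le> t"
      interpret H: hilbert_space H by fact
      have hc: "h \<in> carrier \<Gamma>" using inv Q by auto
      have c: "\<pi> h \<xi> \<in> carrier H" "\<pi> (inv h) \<xi> \<in> carrier H"
        using unitary_operatorD(1)[OF U[OF H(2)] H(3)] hc by auto
      have "\<pi> (inv h) (\<pi> h \<xi>) = \<xi>"
        using mult[OF H(2) _ hc H(3), of "inv h"] pone[OF H(2,3)] hc by simp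
      then have "hnorm H (\<pi> (inv h) \<xi> \<ominus>\<^bsub>H\<^esub> \<xi>) = hnorm H (\<xi> \<ominus>\<^bsub>H\<^esub> \<pi> h \<xi>)"
        using H.unitary_dist[OF U[OF H(2), of "inv h"] H(3) c(1)] hc by simp
      then show "hnorm H (\<pi> (inv h) \<xi> \<ominus>\<^bsub>H\<^esub> \<xi>) \<le> real 1 * t"
        using t inv H.hdist_commute[OF H(3) c(1)] by simp
    qed
  next
    case (eng h1 h2)
    have hc: "h1 \<in> carrier \<Gamma>" "h2 \<in> carrier \<Gamma>" using eng(1,2) G.generate_in_carrier[OF Q] by auto
    obtain L1 L2 :: nat where L: "\<forall>(H :: 'h inner_space) \<pi> \<xi> t. hilbert_space H \<and> unitary_representation \<Gamma> H \<pi> \<and> \<xi> \<in> carrier H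
      \<and> (\<forall>q\<in>Q. hnorm H (\<pi> q \<xi> \<ominus>\<^bsub>H\<^esub> \<xi>) \<le> t) \<longrightarrow> hnorm H (\<pi> h1 \<xi> \<ominus>\<^bsub>H\<^esub> \<xi>) \<le> real L1 * t"
      "\<forall>(H :: 'h inner_space) \<pi> \<xi> t. hilbert_space H \<and> unitary_representation \<Gamma> H \<pi> \<and> \<xi> \<in> carrier H
      \<and> (\<forall>q\<in>Q. hnorm H (\<pi> q \<xi> \<ominus>\<^bsub>H\<^esub> \<xi>) \<le> t) \<longrightarrow> hnorm H (\<pi> h2 \<xi> \<ominus>\<^bsub>H\<^esub> \<xi>) \<le> real L2 * t"
      using eng by blast
    show ?case
    proof (intro exI[of _ "L1 + L2"] allI impI; elim conjE)
      fix H :: "'h inner_space" and \<pi> \<xi> t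
      assume H: "hilbert_space H" "unitary_representation \<Gamma> H \<pi>" "\<xi> \<in> carrier H"
        and t: "\<forall>q\<in>Q. hnorm H (\<pi> q \<xi> \<ominus>\<^bsub>H\<^esub> \<xi>) \<le> t"
      interpret H: hilbert_space H by fact
      have c: "\<pi> h1 \<xi> \<in> carrier H" "\<pi> h2 \<xi> \<in> carrier H" "\<pi> h1 (\<pi> h2 \<xi>) \<in> carrier H"
        using unitary_operatorD(1)[OF U[OF H(2)]] hc H(3) by blast+
      have "hnorm H (\<pi> (h1 \<otimes> h2) \<xi> \<ominus>\<^bsub>H\<^esub> \<xi>)
          \<le> hnorm H (\<pi> h1 (\<pi> h2 \<xi>) \<ominus>\<^bsub>H\<^esub> \<pi> h1 \<xi>) + hnorm H (\<pi> h1 \<xi> \<ominus>\<^bsub>H\<^esub> \<xi>)"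
        unfolding mult[OF H(2) hc H(3)] by (rule H.hdist_triangle[OF c(3,1) H(3)])
      also have "hnorm H (\<pi> h1 (\<pi> h2 \<xi>) \<ominus>\<^bsub>H\<^esub> \<pi> h1 \<xi>) = hnorm H (\<pi> h2 \<xi> \<ominus>\<^bsub>H\<^esub> \<xi>)"
        by (rule H.unitary_dist[OF U[OF H(2) hc(1)] c(2) H(3)])
      finally show "hnorm H (\<pi> (h1 \<otimes> h2) \<xi> \<ominus>\<^bsub>H\<^esub> \<xi>) \<le> real (L1 + L2) * t"
        using L(1)[rule_format, of H \<pi> \<xi> t] L(2)[rule_format, of H \<pi> \<xi> t] H t by (simp add: algebra_simps)
    qed
  }
qed

text \<open>
  The elements of a given Kazhdan set \<open>Q'\<close> are words of bounded length in \<open>Q\<close>, so a vector moved little enough by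
  \<open>Q\<close> is moved by \<open>Q'\<close> less than its constant requires.
\<close>

lemma property_T_generating_set:
  fixes \<Gamma> :: "('g, 'b) monoid_scheme" (structure)
  assumes G: "group \<Gamma>" and T: "property_T \<Gamma>"
    and Q: "finite Q" "Q \<subseteq> carrier \<Gamma>" "generate \<Gamma> Q = carrier \<Gamma>" "Q \<noteq> {}"
  shows "\<exists>\<epsilon>. kazhdan_pair \<Gamma> Q \<epsilon>"
proof -
  obtain Q' \<epsilon>' where kp: "kazhdan_pair \<Gamma> Q' \<epsilon>'" using T by (auto simp: property_T_def)
  have Q': "finite Q'" "Q' \<subseteq> carrier \<Gamma>" "\<epsilon>' > 0" using kp by (auto simp: kazhdan_pair_def)
  have "\<forall>g\<in>Q'. \<exists>L::nat. \<forall>(H :: real inner_space) \<pi> \<xi> t. hilbert_space H \<and> unitary_representation \<Gamma> H \<pi> \<and> \<xi> \<in> carrier H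
    \<and> (\<forall>q\<in>Q. hnorm H (\<pi> q \<xi> \<ominus>\<^bsub>H\<^esub> \<xi>) \<le> t) \<longrightarrow> hnorm H (\<pi> g \<xi> \<ominus>\<^bsub>H\<^esub> \<xi>) \<le> real L * t"
    using displacement_generate[OF G Q(2)] Q(3) Q'(2) by blast
  then obtain L :: "'g \<Rightarrow> nat" where L: "\<And>g (H :: real inner_space) \<pi> \<xi> t. \<lbrakk>g \<in> Q'; hilbert_space H; unitary_representation \<Gamma> H \<pi>;
      \<xi> \<in> carrier H; \<forall>q\<in>Q. hnorm H (\<pi> q \<xi> \<ominus>\<^bsub>H\<^esub> \<xi>) \<le> t\<rbrakk> \<Longrightarrow> hnorm H (\<pi> g \<xi> \<ominus>\<^bsub>H\<^esub> \<xi>) \<le> real (L g) * t"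
    by metis
  define K where "K = Suc (\<Sum>g\<in>Q'. L g)"
  have Kpos: "real K > 0" unfolding K_def by (rule of_nat_0_less_iff[THEN iffD2]) (rule zero_less_Suc)
  have LK: "L g < K" if "g \<in> Q'" for g
    unfolding K_def using member_le_sum[of g Q' L] that Q'(1) by simp
  have "kazhdan_pair \<Gamma> Q (\<epsilon>' / real K)"
    unfolding kazhdan_pair_def
  proof (intro conjI allI impI; (elim conjE)?)
    show "0 < \<epsilon>' / real K" using Q' Kpos by simp
    fix H :: "real inner_space" and \<pi>
    assume H: "hilbert_space H" "unitary_representation \<Gamma> H \<pi>" "has_almost_invariant_vector H \<pi> Q (\<epsilon>' / real K)"
    interpret H: hilbert_space H by fact
    obtain \<xi> where \<xi>: "\<xi> \<in> carrier H" "\<And>q. q \<in> Q \<Longrightarrow> hnorm H (\<pi> q \<xi> \<ominus>\<^bsub>H\<^esub> \<xi>) < \<epsilon>' / real K * hnorm H \<xi>"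
      using H(3) by (auto simp: has_almost_invariant_vector_def)
    have pos: "hnorm H \<xi> > 0"
    proof (rule ccontr)
      assume "\<not> hnorm H \<xi> > 0"
      then have 0: "hnorm H \<xi> = 0" using H.hnorm_nonneg[OF \<xi>(1)] by simp
      obtain q where q: "q \<in> Q" using Q(4) by auto
      have "unitary_operator H (\<pi> q)" using q Q(2) H(2) by (auto simp: unitary_representation_def)
      then have "\<pi> q \<xi> \<in> carrier H" using \<xi>(1) by (rule unitary_operatorD(1))
      then have "\<pi> q \<xi> \<ominus>\<^bsub>H\<^esub> \<xi> \<in> carrier H" using \<xi>(1) by (rule H.M.minus_closed)
      then have "0 \<le> hnorm H (\<pi> q \<xi> \<ominus>\<^bsub>H\<^esub> \<xi>)" by (rule H.hnorm_nonneg)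
      with \<xi>(2)[OF q] show False unfolding 0 by linarith
    qed
      have "has_almost_invariant_vector H \<pi> Q' \<epsilon>'"
        unfolding has_almost_invariant_vector_def
      proof (intro bexI[OF _ \<xi>(1)] ballI)
        fix g assume g: "g \<in> Q'"
        have "hnorm H (\<pi> g \<xi> \<ominus>\<^bsub>H\<^esub> \<xi>) \<le> real (L g) * (\<epsilon>' / real K * hnorm H \<xi>)"
          using \<xi>(2) by (intro L g H(1,2) \<xi>(1)) (auto intro: less_imp_le)
        also have "\<dots> < real K * (\<epsilon>' / real K * hnorm H \<xi>)"
          using LK[OF g] pos Q'(3) Kpos by (intro mult_strict_right_mono) auto
        also have "\<dots> = \<epsilon>' * hnorm H \<xi>" using Kpos by simp
        finally show "hnorm H (\<pi> g \<xi> \<ominus>\<^bsub>H\<^esub> \<xi>) < \<epsilon>' * hnorm H \<xi>" .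
      qed
      then show "has_invariant_vector \<Gamma> H \<pi>" using kp H by (auto simp: kazhdan_pair_def)
  qed (use Q in auto)
  then show ?thesis by blast
qed

section \<open>Invariant random equivalence relations on the group\<close>

locale pmp_action =
  fixes \<Gamma> :: "('g, 'b) monoid_scheme" (structure) and M :: "'x measure" and \<alpha> :: "'g \<Rightarrow> 'x \<Rightarrow> 'x"
  assumes prob: "prob_space M"
    and act: "group_action \<Gamma> (space M) \<alpha>"
    and act_meas: "\<And>k. k \<in> carrier \<Gamma> \<Longrightarrow> \<alpha> k \<in> measurable M M"
    and act_distr: "\<And>k. k \<in> carrier \<Gamma> \<Longrightarrow> distr M M (\<alpha> k) = M"
    and count: "countable (carrier \<Gamma>)"

sublocale pmp_action \<subseteq> prob_space M by (rule prob)

sublocale pmp_action \<subseteq> group_action \<Gamma> "space M" \<alpha> by (rule act)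

sublocale pmp_action \<subseteq> grp: group \<Gamma>
  using act unfolding group_action_def group_hom_def by blast

context pmp_action begin

lemma act_closed [simp]: "\<lbrakk>k \<in> carrier \<Gamma>; x \<in> space M\<rbrakk> \<Longrightarrow> \<alpha> k x \<in> space M"
  using element_image by blast

lemma act_mult: "\<lbrakk>k \<in> carrier \<Gamma>; l \<in> carrier \<Gamma>; x \<in> space M\<rbrakk> \<Longrightarrow> \<alpha> (k \<otimes> l) x = \<alpha> k (\<alpha> l x)"
  by (rule composition_rule)

lemma act_one [simp]: "x \<in> space M \<Longrightarrow> \<alpha> \<one> x = x"
  using id_eq_one by (metis restrict_apply')

lemma act_inv [simp]:
  "\<lbrakk>k \<in> carrier \<Gamma>; x \<in> space M\<rbrakk> \<Longrightarrow> \<alpha> (inv k) (\<alpha> k x) = x"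
  "\<lbrakk>k \<in> carrier \<Gamma>; x \<in> space M\<rbrakk> \<Longrightarrow> \<alpha> k (\<alpha> (inv k) x) = x"
  by (simp_all add: act_mult[symmetric])

lemma AE_act: "\<lbrakk>k \<in> carrier \<Gamma>; AE x in M. P x\<rbrakk> \<Longrightarrow> AE x in M. P (\<alpha> k x)"
  using AE_distrD[OF act_meas] act_distr by metis

definition ergodic_element :: "'g \<Rightarrow> bool" where
  "ergodic_element \<gamma> \<longleftrightarrow>
     (\<forall>A\<in>sets M. (AE x in M. \<alpha> \<gamma> x \<in> A \<longleftrightarrow> x \<in> A) \<longrightarrow> prob A = 0 \<or> prob A = 1)"

text \<open>All sublevel sets are null or conull; the constant is the infimum of the levels with conull sublevel set.\<close>

lemma ergodic_invariant_function:
  fixes f :: "'x \<Rightarrow> real"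
  assumes erg: "ergodic_element \<gamma>" and \<gamma>: "\<gamma> \<in> carrier \<Gamma>" and f [measurable]: "f \<in> borel_measurable M"
    and inv: "AE x in M. f (\<alpha> \<gamma> x) = f x"
  obtains c where "AE x in M. f x = c"
proof -
  have dich: "(AE x in M. f x > t) \<or> (AE x in M. f x \<le> t)" for t
  proof -
    let ?A = "{x\<in>space M. f x \<le> t}"
    have "AE x in M. \<alpha> \<gamma> x \<in> ?A \<longleftrightarrow> x \<in> ?A"
      using inv AE_space by eventually_elim (use \<gamma> in simp)
    then have "prob ?A = 0 \<or> prob ?A = 1" using erg unfolding ergodic_element_def by auto
    then show ?thesis
    proof
      assume "prob ?A = 0"
      then have "AE x in M. x \<notin> ?A" by (subst (asm) prob_eq_0) auto
      then have "AE x in M. f x > t" using AE_space by eventually_elim (simp add: not_le)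
      then show ?thesis ..
    next
      assume "prob ?A = 1"
      then have "AE x in M. x \<in> ?A" by (subst (asm) prob_eq_1) auto
      then have "AE x in M. f x \<le> t" by eventually_elim simp
      then show ?thesis ..
    qed
  qed
  define U where "U = {t. AE x in M. f x \<le> t}"
  have ne: "U \<noteq> {}"
  proof
    assume "U = {}"
    then have "AE x in M. f x > real n" for n using dich[of "real n"] by (auto simp: U_def)
    then have "AE x in M. \<forall>n. f x > real n" by (simp add: AE_all_countable)
    then have "AE x in M. False"
      by eventually_elim (meson reals_Archimedean2 less_asym)
    then show False by simp
  qed
  have bdd: "bdd_below U"
  proof (rule ccontr)
    assume nb: "\<not> bdd_below U"
    have "AE x in M. f x \<le> - real n" for n
    proof -
      obtain t where t: "t \<in> U" "t < - real n" using nb by (auto simp: bdd_below_def not_le)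
      then have "AE x in M. f x \<le> t" by (simp add: U_def)
      then show ?thesis by eventually_elim (use t in auto)
    qed
    then have "AE x in M. \<forall>n. f x \<le> - real n" by (simp add: AE_all_countable)
    then have "AE x in M. False"
    proof eventually_elim
      case (elim x)
      obtain n where "- f x < real n" using reals_Archimedean2 by blast
      then show ?case using elim[rule_format, of n] by linarith
    qed
    then show False by simp
  qed
  have up: "AE x in M. f x \<le> Inf U + 1 / real (Suc n)" for n
  proof -
    obtain t where t: "t \<in> U" "t < Inf U + 1 / real (Suc n)"
      using cInf_lessD[OF ne, of "Inf U + 1 / real (Suc n)"] by auto
    then have "AE x in M. f x \<le> t" by (simp add: U_def)
    then show ?thesis by eventually_elim (use t in auto)
  qed
  have down: "AE x in M. f x > Inf U - 1 / real (Suc n)" for n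
  proof (rule ccontr)
    assume "\<not> ?thesis"
    then have "Inf U - 1 / real (Suc n) \<in> U" using dich by (auto simp: U_def)
    then have "Inf U \<le> Inf U - 1 / real (Suc n)" using bdd by (rule cInf_lower)
    then show False by (simp add: field_simps)
  qed
  have "AE x in M. \<forall>n. f x \<le> Inf U + 1 / real (Suc n) \<and> f x > Inf U - 1 / real (Suc n)"
    using up down by (simp add: AE_all_countable AE_conj_iff)
  then have "AE x in M. f x = Inf U"
  proof eventually_elim
    case (elim x)
    show ?case
    proof (rule ccontr)
      assume "f x \<noteq> Inf U"
      then obtain n where "1 / real (Suc n) < \<bar>f x - Inf U\<bar>"
        using nat_approx_posE[of "\<bar>f x - Inf U\<bar>"] by auto
      with elim[rule_format, of n] show False by linarith
    qed
  qed
  then show thesis by (rule that)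
qed

end

text \<open>
  A subrelation \<open>F\<close> of the orbit relation, pulled back to the group along the orbit maps: \<open>(g, h) \<in> R x\<close>
  stands for \<open>gx F hx\<close>. Equivariance expresses that \<open>R x\<close> and \<open>R (kx)\<close> describe the same classes as seen
  from two points of one orbit.
\<close>

locale random_equivalence = pmp_action \<Gamma> M \<alpha>
  for \<Gamma> :: "('g, 'b) monoid_scheme" (structure) and M :: "'x measure" and \<alpha> +
  fixes R :: "'x \<Rightarrow> ('g \<times> 'g) set"
  assumes equivR: "\<And>x. x \<in> space M \<Longrightarrow> equiv (carrier \<Gamma>) (R x)"
    and measR: "\<And>g h. \<lbrakk>g \<in> carrier \<Gamma>; h \<in> carrier \<Gamma>\<rbrakk> \<Longrightarrow> {x\<in>space M. (g, h) \<in> R x} \<in> sets M"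
    and equivariant: "\<And>k g h x. \<lbrakk>k \<in> carrier \<Gamma>; g \<in> carrier \<Gamma>; h \<in> carrier \<Gamma>; x \<in> space M\<rbrakk>
      \<Longrightarrow> (g, h) \<in> R (\<alpha> k x) \<longleftrightarrow> (g \<otimes> k, h \<otimes> k) \<in> R x"
begin

text \<open>
  Labelling a class by its first element in an enumeration of the group turns the bundle of classes over \<open>M\<close>
  into a measurable subset of \<open>carrier \<Gamma> \<times> space M\<close>.
\<close>

definition class_rep :: "'x \<Rightarrow> 'g \<Rightarrow> 'g" where
  "class_rep x g = arg_min (to_nat_on (carrier \<Gamma>)) (\<lambda>h. h \<in> carrier \<Gamma> \<and> (g, h) \<in> R x)"

definition transversal :: "'x \<Rightarrow> 'g set" where
  "transversal x = {g\<in>carrier \<Gamma>. class_rep x g = g}"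

lemma R_refl: "\<lbrakk>x \<in> space M; g \<in> carrier \<Gamma>\<rbrakk> \<Longrightarrow> (g, g) \<in> R x"
  using equivR by (auto simp: equiv_def refl_on_def)

lemma R_sym: "\<lbrakk>x \<in> space M; (g, h) \<in> R x\<rbrakk> \<Longrightarrow> (h, g) \<in> R x"
  using equivR by (auto simp: equiv_def sym_def)

lemma R_trans: "\<lbrakk>x \<in> space M; (g, h) \<in> R x; (h, k) \<in> R x\<rbrakk> \<Longrightarrow> (g, k) \<in> R x"
  using equivR by (auto simp: equiv_def trans_def)

lemma class_rep:
  assumes "x \<in> space M" "g \<in> carrier \<Gamma>"
  shows class_rep_closed: "class_rep x g \<in> carrier \<Gamma>" and class_rep_R: "(g, class_rep x g) \<in> R x"
  using arg_min_natI[of "\<lambda>h. h \<in> carrier \<Gamma> \<and> (g, h) \<in> R x" g "to_nat_on (carrier \<Gamma>)"] assms R_refl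
  by (auto simp: class_rep_def)

lemma class_rep_least:
  "\<lbrakk>h \<in> carrier \<Gamma>; (g, h) \<in> R x\<rbrakk> \<Longrightarrow> to_nat_on (carrier \<Gamma>) (class_rep x g) \<le> to_nat_on (carrier \<Gamma>) h"
  unfolding class_rep_def by (rule arg_min_nat_le) simp

lemma class_rep_eqI:
  assumes "x \<in> space M" "(g, h) \<in> R x"
  shows "class_rep x g = class_rep x h"
proof -
  have "(g, k) \<in> R x \<longleftrightarrow> (h, k) \<in> R x" for k
    using assms R_sym R_trans by blast
  then show ?thesis by (simp add: class_rep_def)
qed

lemma class_rep_eq_iff:
  assumes "x \<in> space M" "g \<in> carrier \<Gamma>" "h \<in> carrier \<Gamma>"
  shows "class_rep x g = class_rep x h \<longleftrightarrow> (g, h) \<in> R x"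
  using assms class_rep_eqI class_rep_R R_sym R_trans by metis

lemma class_rep_idem [simp]:
  "\<lbrakk>x \<in> space M; g \<in> carrier \<Gamma>\<rbrakk> \<Longrightarrow> class_rep x (class_rep x g) = class_rep x g"
  by (rule sym, rule class_rep_eqI) (auto intro: class_rep_R)

lemma class_rep_transversal: "\<lbrakk>x \<in> space M; g \<in> carrier \<Gamma>\<rbrakk> \<Longrightarrow> class_rep x g \<in> transversal x"
  by (simp add: transversal_def class_rep_closed)

lemma class_rep_measurable [measurable]:
  assumes g: "g \<in> carrier \<Gamma>"
  shows "(\<lambda>x. class_rep x g) \<in> measurable M (count_space (carrier \<Gamma>))"
proof (subst measurable_count_space_eq_countable[OF count], intro conjI ballI)
  show "(\<lambda>x. class_rep x g) \<in> space M \<rightarrow> carrier \<Gamma>" using g class_rep_closed by auto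
  fix h assume h: "h \<in> carrier \<Gamma>"
  let ?i = "to_nat_on (carrier \<Gamma>)"
  have "(\<lambda>x. class_rep x g) -` {h} \<inter> space M =
      {x\<in>space M. (g, h) \<in> R x} - (\<Union>k\<in>{k\<in>carrier \<Gamma>. ?i k < ?i h}. {x\<in>space M. (g, k) \<in> R x})"
  proof (intro subset_antisym subsetI)
    fix x assume x: "x \<in> (\<lambda>x. class_rep x g) -` {h} \<inter> space M"
    then show "x \<in> {x\<in>space M. (g, h) \<in> R x} - (\<Union>k\<in>{k\<in>carrier \<Gamma>. ?i k < ?i h}. {x\<in>space M. (g, k) \<in> R x})"
      using class_rep_R[of x g] g class_rep_least[of _ g x] by (auto simp: not_less[symmetric])
  next
    fix x assume "x \<in> {x\<in>space M. (g, h) \<in> R x} - (\<Union>k\<in>{k\<in>carrier \<Gamma>. ?i k < ?i h}. {x\<in>space M. (g, k) \<in> R x})"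
    then have x: "x \<in> space M" "(g, h) \<in> R x" "\<And>k. \<lbrakk>k \<in> carrier \<Gamma>; (g, k) \<in> R x\<rbrakk> \<Longrightarrow> ?i h \<le> ?i k"
      by (auto simp: not_less)
    then have "?i h = ?i (class_rep x g)"
      using g h class_rep_closed[of x g] class_rep_R[of x g] class_rep_least[of h g x] by (intro antisym) auto
    then have "h = class_rep x g"
      using inj_on_to_nat_on[OF count] h class_rep_closed[OF x(1) g] by (auto dest: inj_onD)
    with x show "x \<in> (\<lambda>x. class_rep x g) -` {h} \<inter> space M" by auto
  qed
  also have "\<dots> \<in> sets M"
    using g h measR by (intro sets.Diff sets.countable_UN') (auto intro: countable_subset[OF _ count])
  finally show "(\<lambda>x. class_rep x g) -` {h} \<inter> space M \<in> sets M" .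
qed

lemma class_rep_shift:
  assumes "x \<in> space M" "g \<in> carrier \<Gamma>" "k \<in> carrier \<Gamma>"
  shows "class_rep (\<alpha> k x) (class_rep x g \<otimes> inv k) = class_rep (\<alpha> k x) (g \<otimes> inv k)"
proof (rule class_rep_eqI)
  note [simp] = class_rep_closed[OF assms(1,2)]
  have "(class_rep x g, g) \<in> R x" using class_rep_R[OF assms(1,2)] R_sym assms by blast
  then show "(class_rep x g \<otimes> inv k, g \<otimes> inv k) \<in> R (\<alpha> k x)"
    using assms by (simp add: equivariant grp.m_assoc)
qed (use assms in simp)

lemma transversal_shift_bij:
  assumes x: "x \<in> space M" and k: "k \<in> carrier \<Gamma>"
  shows "bij_betw (\<lambda>g. class_rep (\<alpha> k x) (g \<otimes> inv k)) (transversal x) (transversal (\<alpha> k x))"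
proof (rule bij_betw_byWitness[where f' = "\<lambda>g. class_rep x (g \<otimes> k)"])
  show "\<forall>g\<in>transversal x. class_rep x (class_rep (\<alpha> k x) (g \<otimes> inv k) \<otimes> k) = g"
    using class_rep_shift[of "\<alpha> k x" _ "inv k"] x k
    by (auto simp: transversal_def grp.m_assoc)
  show "\<forall>g\<in>transversal (\<alpha> k x). class_rep (\<alpha> k x) (class_rep x (g \<otimes> k) \<otimes> inv k) = g"
    using class_rep_shift[of x _ k] x k
    by (auto simp: transversal_def grp.m_assoc)
qed (use x k in \<open>auto simp: transversal_def class_rep_closed\<close>)

text \<open>
  The space of pairs of a point \<open>x\<close> and a class of \<open>R x\<close>, with the measure that counts classes and
  integrates over \<open>x\<close>. It is written as a density on the full product to keep the product \<open>\<sigma>\<close>-algebra.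
\<close>

definition class_space :: "('g \<times> 'x) measure" where
  "class_space = density (count_space (carrier \<Gamma>) \<Otimes>\<^sub>M M) (indicator {(g, x). x \<in> space M \<and> g \<in> transversal x})"

text \<open>
  The action that moves the point and keeps the class: as \<open>gx = (g k\<^sup>-\<^sup>1)(kx)\<close>, the class
  of \<open>g\<close> seen from \<open>x\<close> is the class of \<open>g k\<^sup>-\<^sup>1\<close> seen from \<open>kx\<close>.
\<close>

definition class_shift :: "'g \<Rightarrow> 'g \<times> 'x \<Rightarrow> 'g \<times> 'x" where
  "class_shift k = (\<lambda>(g, x). (class_rep (\<alpha> k x) (g \<otimes> inv k), \<alpha> k x))"

lemma class_space_simps [simp]:
  "space class_space = carrier \<Gamma> \<times> space M"
  "sets class_space = sets (count_space (carrier \<Gamma>) \<Otimes>\<^sub>M M)"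
  by (simp_all add: class_space_def space_pair_measure)

lemma measurable_pair_sets:
  assumes "\<And>g. g \<in> carrier \<Gamma> \<Longrightarrow> {x\<in>space M. P g x} \<in> sets M"
  shows "{z\<in>space (count_space (carrier \<Gamma>) \<Otimes>\<^sub>M M). P (fst z) (snd z)} \<in> sets (count_space (carrier \<Gamma>) \<Otimes>\<^sub>M M)"
  using assms by (intro predE measurable_pair_measure_countable1 count) (simp add: pred_def)

lemma transversal_meas: "g \<in> carrier \<Gamma> \<Longrightarrow> {x\<in>space M. g \<in> transversal x} \<in> sets M"
proof -
  assume g: "g \<in> carrier \<Gamma>"
  have "(\<lambda>x. class_rep x g) -` {g} \<inter> space M \<in> sets M"
    using class_rep_measurable[OF g] g by (auto intro!: measurable_sets[of _ _ "count_space (carrier \<Gamma>)"])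
  moreover have "(\<lambda>x. class_rep x g) -` {g} \<inter> space M = {x\<in>space M. g \<in> transversal x}"
    using g by (auto simp: transversal_def)
  ultimately show ?thesis by simp
qed

lemma transversal_space_sets [measurable]:
  "{(g, x). x \<in> space M \<and> g \<in> transversal x} \<in> sets (count_space (carrier \<Gamma>) \<Otimes>\<^sub>M M)"
proof -
  have "{(g, x). x \<in> space M \<and> g \<in> transversal x} =
      {z\<in>space (count_space (carrier \<Gamma>) \<Otimes>\<^sub>M M). fst z \<in> transversal (snd z)}"
    by (auto simp: space_pair_measure transversal_def)
  also have "\<dots> \<in> sets (count_space (carrier \<Gamma>) \<Otimes>\<^sub>M M)"
    by (rule measurable_pair_sets[OF transversal_meas])
  finally show ?thesis .
qed

lemma
  fixes f :: "'g \<times> 'x \<Rightarrow> ennreal"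
  assumes f [measurable]: "f \<in> borel_measurable (count_space (carrier \<Gamma>) \<Otimes>\<^sub>M M)"
  shows class_sum_measurable: "(\<lambda>x. \<integral>\<^sup>+g. f (g, x) \<partial>count_space (transversal x)) \<in> borel_measurable M"
    and nn_integral_class_space: "(\<integral>\<^sup>+z. f z \<partial>class_space) = (\<integral>\<^sup>+x. (\<integral>\<^sup>+g. f (g, x) \<partial>count_space (transversal x)) \<partial>M)"
proof -
  let ?Z = "{(g, x). x \<in> space M \<and> g \<in> transversal x}"
  interpret C: sigma_finite_measure "count_space (carrier \<Gamma>)"
    by (rule sigma_finite_measure_count_space_countable[OF count])
  interpret P: pair_sigma_finite "count_space (carrier \<Gamma>)" M ..
  have sum: "(\<integral>\<^sup>+g. indicator ?Z (g, x) * f (g, x) \<partial>count_space (carrier \<Gamma>))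
        = (\<integral>\<^sup>+g. f (g, x) \<partial>count_space (transversal x))" if x: "x \<in> space M" for x
  proof -
    have sub: "transversal x \<subseteq> carrier \<Gamma>" by (auto simp: transversal_def)
    have "(\<integral>\<^sup>+g. indicator ?Z (g, x) * f (g, x) \<partial>count_space (carrier \<Gamma>))
        = (\<integral>\<^sup>+g. f (g, x) * indicator (transversal x) g \<partial>count_space (carrier \<Gamma>))"
      using x by (intro nn_integral_cong) (auto simp: indicator_def)
    also have "\<dots> = (\<integral>\<^sup>+g. f (g, x) \<partial>count_space (transversal x))"
      using sub by (subst (1 2) nn_integral_count_space_indicator)
        (auto intro!: nn_integral_cong simp: indicator_def)
    finally show ?thesis .
  qed
  have "(\<lambda>(x, g). indicator ?Z (g, x) * f (g, x)) \<in> borel_measurable (M \<Otimes>\<^sub>M count_space (carrier \<Gamma>))"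
    by measurable
  then have "(\<lambda>x. \<integral>\<^sup>+g. indicator ?Z (g, x) * f (g, x) \<partial>count_space (carrier \<Gamma>)) \<in> borel_measurable M"
    by (rule C.borel_measurable_nn_integral)
  then show "(\<lambda>x. \<integral>\<^sup>+g. f (g, x) \<partial>count_space (transversal x)) \<in> borel_measurable M"
    by (rule measurable_cong[THEN iffD1, rotated]) (rule sum)
  have "(\<integral>\<^sup>+z. f z \<partial>class_space) = (\<integral>\<^sup>+z. indicator ?Z z * f z \<partial>(count_space (carrier \<Gamma>) \<Otimes>\<^sub>M M))"
    unfolding class_space_def by (rule nn_integral_density) measurable
  also have "\<dots> = (\<integral>\<^sup>+x. (\<integral>\<^sup>+g. indicator ?Z (g, x) * f (g, x) \<partial>count_space (carrier \<Gamma>)) \<partial>M)"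
    by (rule P.nn_integral_snd[symmetric]) measurable
  also have "\<dots> = (\<integral>\<^sup>+x. (\<integral>\<^sup>+g. f (g, x) \<partial>count_space (transversal x)) \<partial>M)"
    by (rule nn_integral_cong) (rule sum)
  finally show "(\<integral>\<^sup>+z. f z \<partial>class_space) = (\<integral>\<^sup>+x. (\<integral>\<^sup>+g. f (g, x) \<partial>count_space (transversal x)) \<partial>M)" .
qed

lemma AE_class_spaceD:
  assumes "AE z in class_space. P z"
  shows "AE x in M. \<forall>g\<in>transversal x. P (g, x)"
proof -
  let ?Z = "{(g, x). x \<in> space M \<and> g \<in> transversal x}"
  interpret C: sigma_finite_measure "count_space (carrier \<Gamma>)"
    by (rule sigma_finite_measure_count_space_countable[OF count])
  interpret P: pair_sigma_finite "count_space (carrier \<Gamma>)" M ..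
  have "AE z in count_space (carrier \<Gamma>) \<Otimes>\<^sub>M M. (0 :: ennreal) < indicator ?Z z \<longrightarrow> P z"
    using assms unfolding class_space_def by (subst (asm) AE_density) measurable
  then have "AE g in count_space (carrier \<Gamma>). AE x in M. (0 :: ennreal) < indicator ?Z (g, x) \<longrightarrow> P (g, x)"
    by (rule P.AE_pair)
  then have "AE x in M. \<forall>g\<in>carrier \<Gamma>. (0 :: ennreal) < indicator ?Z (g, x) \<longrightarrow> P (g, x)"
    by (simp add: AE_count_space AE_ball_countable[OF count])
  then show ?thesis
    using AE_space by eventually_elim (auto simp: transversal_def)
qed

lemma class_shift_measurable:
  assumes k: "k \<in> carrier \<Gamma>"
  shows "class_shift k \<in> measurable class_space class_space"
proof -
  have "class_shift k \<in> measurable (count_space (carrier \<Gamma>) \<Otimes>\<^sub>M M) (count_space (carrier \<Gamma>) \<Otimes>\<^sub>M M)"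
  proof (rule measurable_pair_measure_countable1[OF count])
    fix g assume g: "g \<in> carrier \<Gamma>"
    have [measurable]: "\<alpha> k \<in> measurable M M" by (rule act_meas[OF k])
    have "(\<lambda>x. class_rep x (g \<otimes> inv k)) \<in> measurable M (count_space (carrier \<Gamma>))"
      using g k by (intro class_rep_measurable) simp
    then have [measurable]: "(\<lambda>x. class_rep (\<alpha> k x) (g \<otimes> inv k)) \<in> measurable M (count_space (carrier \<Gamma>))"
      by (rule measurable_compose[OF act_meas[OF k]])
    show "(\<lambda>x. class_shift k (g, x)) \<in> measurable M (count_space (carrier \<Gamma>) \<Otimes>\<^sub>M M)"
      unfolding class_shift_def by simp
  qed
  then show ?thesis by (simp cong: measurable_cong_sets)
qed

text \<open>
  Over each \<open>x\<close> the shift is a bijection from the classes at \<open>x\<close> to those at \<open>kx\<close>, so it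
  preserves the sum over the fibre; the base measure is preserved by assumption.
\<close>

lemma class_shift_distr:
  assumes k: "k \<in> carrier \<Gamma>"
  shows "distr class_space class_space (class_shift k) = class_space"
proof (rule measure_eqI)
  fix S assume "S \<in> sets (distr class_space class_space (class_shift k))"
  then have S [measurable]: "S \<in> sets (count_space (carrier \<Gamma>) \<Otimes>\<^sub>M M)" by simp
  have T [measurable]: "class_shift k \<in> measurable class_space class_space" by (rule class_shift_measurable[OF k])
  have T' [measurable]: "class_shift k \<in> measurable (count_space (carrier \<Gamma>) \<Otimes>\<^sub>M M) (count_space (carrier \<Gamma>) \<Otimes>\<^sub>M M)"
    using T by (simp cong: measurable_cong_sets)
  define F where "F x = (\<integral>\<^sup>+g. indicator S (g, x) \<partial>count_space (transversal x))" for x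
  have Fm: "F \<in> borel_measurable M" unfolding F_def by (rule class_sum_measurable) measurable
  have "emeasure (distr class_space class_space (class_shift k)) S = (\<integral>\<^sup>+z. indicator S z \<partial>distr class_space class_space (class_shift k))"
    by simp
  also have "\<dots> = (\<integral>\<^sup>+z. indicator S (class_shift k z) \<partial>class_space)"
    by (rule nn_integral_distr[OF T]) (use S in \<open>auto intro: borel_measurable_indicator\<close>)
  also have "\<dots> = (\<integral>\<^sup>+x. (\<integral>\<^sup>+g. indicator S (class_shift k (g, x)) \<partial>count_space (transversal x)) \<partial>M)"
    by (rule nn_integral_class_space) measurable
  also have "\<dots> = (\<integral>\<^sup>+x. F (\<alpha> k x) \<partial>M)"
    unfolding F_def
  proof (rule nn_integral_cong)
    fix x assume x: "x \<in> space M"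
    show "(\<integral>\<^sup>+g. indicator S (class_shift k (g, x)) \<partial>count_space (transversal x))
        = (\<integral>\<^sup>+g. indicator S (g, \<alpha> k x) \<partial>count_space (transversal (\<alpha> k x)))"
      using nn_integral_bij_count_space[OF transversal_shift_bij[OF x k], of "\<lambda>g. indicator S (g, \<alpha> k x)"]
      by (simp add: class_shift_def)
  qed
  also have "\<dots> = (\<integral>\<^sup>+x. F x \<partial>distr M M (\<alpha> k))"
    by (rule nn_integral_distr[OF act_meas[OF k], symmetric]) (simp add: Fm)
  also have "\<dots> = (\<integral>\<^sup>+x. F x \<partial>M)" unfolding act_distr[OF k] ..
  also have "\<dots> = (\<integral>\<^sup>+z. indicator S z \<partial>class_space)"
    unfolding F_def by (rule nn_integral_class_space[symmetric]) measurable
  also have "\<dots> = emeasure class_space S" by simp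
  finally show "emeasure (distr class_space class_space (class_shift k)) S = emeasure class_space S" .
qed simp

text \<open>
  The set \<open>S\<close> of pairs of a point and its own class has measure \<open>1\<close>, and differs from its translate by \<open>q\<close> over
  those \<open>x\<close> only for which \<open>\<one>\<close> and \<open>q\<close> lie in different classes, in two points each. So the Kazhdan pair
  provides an invariant integrable function \<open>h \<noteq> 0\<close> on the class space. Its value \<open>a x\<close> at the own class of
  \<open>x\<close> is invariant under \<open>\<gamma>\<close>, because \<open>x\<close> and \<open>\<gamma>x\<close> have the same class, hence constant. Every
  class at \<open>x\<close> is the own class of another point of the orbit, so \<open>h\<close> itself is a positive constant, and
  integrability bounds the number of classes.
\<close>

theorem finitely_many_classes:
  assumes kp: "kazhdan_pair \<Gamma> Q \<epsilon>" and Q: "\<And>q. q \<in> Q \<Longrightarrow> 1 - \<epsilon>\<^sup>2 / 2 < prob {x\<in>space M. (\<one>, q) \<in> R x}"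
    and \<gamma>: "\<gamma> \<in> carrier \<Gamma>" "ergodic_element \<gamma>" "AE x in M. (\<one>, \<gamma>) \<in> R x"
  shows "AE x in M. finite (transversal x)"
proof -
  let ?C = "count_space (carrier \<Gamma>)" and ?one = "\<one>"
  have Qc: "Q \<subseteq> carrier \<Gamma>" using kp by (auto simp: kazhdan_pair_def)
  define S where "S = {z\<in>space (?C \<Otimes>\<^sub>M M). fst z = class_rep (snd z) ?one}"
  have S [measurable]: "S \<in> sets (?C \<Otimes>\<^sub>M M)"
    unfolding S_def
  proof (rule measurable_pair_sets)
    fix g assume g: "g \<in> carrier \<Gamma>"
    have "(\<lambda>x. class_rep x ?one) -` {g} \<inter> space M \<in> sets M"
      using class_rep_measurable[of ?one] g by (auto intro!: measurable_sets[of _ _ ?C])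
    also have "(\<lambda>x. class_rep x ?one) -` {g} \<inter> space M = {x\<in>space M. g = class_rep x ?one}" by auto
    finally show "{x\<in>space M. g = class_rep x ?one} \<in> sets M" .
  qed
  have card_sum: "(\<integral>\<^sup>+g. indicator A (g, x) \<partial>count_space (transversal x)) = emeasure (count_space UNIV) {g\<in>transversal x. (g, x) \<in> A}"
    for A x
  proof -
    have "(\<integral>\<^sup>+g. indicator A (g, x) \<partial>count_space (transversal x))
        = (\<integral>\<^sup>+g. indicator {g\<in>transversal x. (g, x) \<in> A} g \<partial>count_space (transversal x))"
      by (intro nn_integral_cong) (auto simp: indicator_def)
    also have "\<dots> = emeasure (count_space (transversal x)) {g\<in>transversal x. (g, x) \<in> A}"
      by (rule nn_integral_indicator) auto
    also have "\<dots> = emeasure (count_space UNIV) {g\<in>transversal x. (g, x) \<in> A}"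
      by (auto simp: emeasure_count_space)
    finally show ?thesis .
  qed
  have emS: "emeasure class_space S = 1"
  proof -
    have "emeasure class_space S = (\<integral>\<^sup>+z. indicator S z \<partial>class_space)" by simp
    also have "\<dots> = (\<integral>\<^sup>+x. (\<integral>\<^sup>+g. indicator S (g, x) \<partial>count_space (transversal x)) \<partial>M)"
      by (rule nn_integral_class_space) measurable
    also have "\<dots> = (\<integral>\<^sup>+x. 1 \<partial>M)"
    proof (rule nn_integral_cong)
      fix x assume x: "x \<in> space M"
      then have "{g\<in>transversal x. (g, x) \<in> S} = {class_rep x ?one}"
        using class_rep_transversal[OF x, of ?one] by (auto simp: S_def space_pair_measure class_rep_closed)
      then show "(\<integral>\<^sup>+g. indicator S (g, x) \<partial>count_space (transversal x)) = 1"
        unfolding card_sum by simp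
    qed
    also have "\<dots> = 1" by (simp add: emeasure_space_1)
    finally show ?thesis .
  qed
  have shift: "class_shift (k \<otimes> l) z = class_shift k (class_shift l z)"
    if kl: "k \<in> carrier \<Gamma>" "l \<in> carrier \<Gamma>" and z: "z \<in> space class_space" for k l z
  proof -
    obtain g x where gx: "z = (g, x)" "g \<in> carrier \<Gamma>" "x \<in> space M" using z by (cases z) auto
    have "class_rep (\<alpha> k (\<alpha> l x)) (class_rep (\<alpha> l x) (g \<otimes> inv l) \<otimes> inv k)
        = class_rep (\<alpha> k (\<alpha> l x)) (g \<otimes> inv l \<otimes> inv k)"
      using kl gx by (intro class_rep_shift) auto
    then show ?thesis
      using kl gx by (simp add: class_shift_def act_mult grp.inv_mult_group grp.m_assoc)
  qed
  obtain h :: "'g \<times> 'x \<Rightarrow> real" where h: "h \<in> borel_measurable class_space" "\<And>z. h z \<ge> 0"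
    "(\<integral>\<^sup>+z. ennreal (h z) \<partial>class_space) < \<infinity>"
    "\<And>k. k \<in> carrier \<Gamma> \<Longrightarrow> AE z in class_space. h (class_shift k z) = h z" "\<not> (AE z in class_space. h z = 0)"
  proof (rule kazhdan_koopman[OF grp.is_group count kp, where N = class_space and T = class_shift and S = S])
    show "AE z in class_space. class_shift (k \<otimes> l) z = class_shift k (class_shift l z)"
      if "k \<in> carrier \<Gamma>" "l \<in> carrier \<Gamma>" for k l
      using that shift by (intro AE_I2)
    have "AE z in ?C \<Otimes>\<^sub>M M. (0 :: ennreal) < indicator {(g, x). x \<in> space M \<and> g \<in> transversal x} z \<longrightarrow> class_shift ?one z = z"
      by (intro AE_I2) (auto simp: class_shift_def transversal_def indicator_def)
    then show "AE z in class_space. class_shift ?one z = z"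
      unfolding class_space_def by (subst AE_density) measurable
    fix q assume q: "q \<in> Q"
    then have qc: "q \<in> carrier \<Gamma>" using Qc by auto
    let ?W = "{z\<in>space class_space. class_shift q z \<in> S \<longleftrightarrow> z \<notin> S}"
    let ?D = "{x\<in>space M. (?one, q) \<in> R x}"
    have D [measurable]: "?D \<in> sets M" using qc by (intro measR) auto
    have W [measurable]: "?W \<in> sets (?C \<Otimes>\<^sub>M M)"
    proof -
      have [measurable]: "class_shift q \<in> measurable class_space class_space" by (rule class_shift_measurable[OF qc])
      have [measurable]: "S \<in> sets class_space" by simp
      have "?W \<in> sets class_space" by measurable
      then show ?thesis by simp
    qed
    have W': "?W \<in> sets class_space" using W by simp
    have "emeasure class_space ?W = (\<integral>\<^sup>+z. indicator ?W z \<partial>class_space)"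
      by (rule nn_integral_indicator[OF W', symmetric])
    also have "\<dots> = (\<integral>\<^sup>+x. (\<integral>\<^sup>+g. indicator ?W (g, x) \<partial>count_space (transversal x)) \<partial>M)"
      by (rule nn_integral_class_space) measurable
    also have "\<dots> = (\<integral>\<^sup>+x. 2 * indicator (space M - ?D) x \<partial>M)"
    proof (rule nn_integral_cong)
      fix x assume x: "x \<in> space M"
      have "(g, x) \<in> ?W \<longleftrightarrow> (g = class_rep x q \<longleftrightarrow> g \<noteq> class_rep x ?one)" if g: "g \<in> transversal x" for g
      proof -
        have gc: "g \<in> carrier \<Gamma>" "class_rep x g = g" using g by (auto simp: transversal_def)
        have "class_shift q (g, x) \<in> S \<longleftrightarrow> class_rep (\<alpha> q x) (g \<otimes> inv q) = class_rep (\<alpha> q x) ?one"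
          using x gc qc by (simp add: class_shift_def S_def space_pair_measure class_rep_closed)
        also have "\<dots> \<longleftrightarrow> (g \<otimes> inv q, ?one) \<in> R (\<alpha> q x)"
          using x gc qc by (intro class_rep_eq_iff) auto
        also have "\<dots> \<longleftrightarrow> (g, q) \<in> R x"
          using x gc qc by (subst equivariant) (auto simp: grp.m_assoc)
        also have "\<dots> \<longleftrightarrow> g = class_rep x q"
          using class_rep_eq_iff[OF x gc(1) qc] gc by simp
        finally show ?thesis
          using x gc by (simp add: S_def space_pair_measure)
      qed
      then have "{g\<in>transversal x. (g, x) \<in> ?W} = {g\<in>transversal x. g = class_rep x q \<longleftrightarrow> g \<noteq> class_rep x ?one}"
        by blast
      also have "\<dots> = (if x \<in> ?D then {} else {class_rep x ?one, class_rep x q})"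
        using class_rep_eq_iff[OF x _ qc, of ?one] class_rep_transversal[OF x] qc x by auto
      finally have "(\<integral>\<^sup>+g. indicator ?W (g, x) \<partial>count_space (transversal x))
          = emeasure (count_space UNIV) (if x \<in> ?D then {} else {class_rep x ?one, class_rep x q})"
        unfolding card_sum by (rule arg_cong)
      also have "\<dots> = 2 * indicator (space M - ?D) x"
        using class_rep_eq_iff[OF x _ qc, of ?one] x by (auto simp: emeasure_count_space card_insert_if)
      finally show "(\<integral>\<^sup>+g. indicator ?W (g, x) \<partial>count_space (transversal x)) = 2 * indicator (space M - ?D) x" .
    qed
    also have "\<dots> = 2 * emeasure M (space M - ?D)"
      by (subst nn_integral_cmult) auto
    also have "\<dots> = ennreal (2 * (1 - prob ?D))"
    proof -
      have "ennreal (2 * (1 - prob ?D)) = ennreal 2 * ennreal (1 - prob ?D)"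
        by (rule ennreal_mult) auto
      then show ?thesis by (simp only: emeasure_eq_measure prob_compl[OF D] ennreal_numeral)
    qed
    finally have "measure class_space ?W = 2 * (1 - prob ?D)"
      by (rule measure_eq_emeasure_eq_ennreal[rotated]) simp
    then show "measure class_space ?W < \<epsilon>\<^sup>2 * measure class_space S"
      using Q[OF q] emS by (simp add: measure_def)
  qed (use S emS class_shift_measurable class_shift_distr in auto)
  have hm [measurable]: "h \<in> borel_measurable (?C \<Otimes>\<^sub>M M)" using h(1) by (simp cong: measurable_cong_sets)
  define a where "a x = h (class_rep x ?one, x)" for x
  have am [measurable]: "a \<in> borel_measurable M"
  proof -
    have [measurable]: "(\<lambda>x. class_rep x ?one) \<in> measurable M ?C" by (rule class_rep_measurable) simp
    show ?thesis unfolding a_def by measurable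
  qed
  have "AE x in M. \<forall>g\<in>transversal x. h (class_shift k (g, x)) = h (g, x)" if "k \<in> carrier \<Gamma>" for k
    using h(4)[OF that] by (rule AE_class_spaceD)
  then have "AE x in M. \<forall>k\<in>carrier \<Gamma>. \<forall>g\<in>transversal x. h (class_shift k (g, x)) = h (g, x)"
    by (simp add: AE_ball_countable[OF count])
  then have h_class: "AE x in M. \<forall>k\<in>carrier \<Gamma>. h (class_rep x k, x) = a (\<alpha> k x)"
    using AE_space
  proof eventually_elim
    case (elim x)
    show ?case
    proof
      fix k assume k: "k \<in> carrier \<Gamma>"
      have "class_shift k (class_rep x k, x) = (class_rep (\<alpha> k x) ?one, \<alpha> k x)"
        using elim(2) k by (simp add: class_shift_def class_rep_shift)
      moreover have "h (class_shift k (class_rep x k, x)) = h (class_rep x k, x)"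
        using elim(1) k class_rep_transversal[OF elim(2) k] by blast
      ultimately show "h (class_rep x k, x) = a (\<alpha> k x)" by (simp add: a_def)
    qed
  qed
  have "AE x in M. a (\<alpha> \<gamma> x) = a x"
    using h_class \<gamma>(3) AE_space
  proof eventually_elim
    case (elim x)
    have "class_rep x \<gamma> = class_rep x ?one" using class_rep_eqI[OF elim(3,2)] by simp
    moreover have "h (class_rep x \<gamma>, x) = a (\<alpha> \<gamma> x)" using elim(1) \<gamma>(1) by blast
    ultimately show ?case by (simp add: a_def)
  qed
  then obtain c where c: "AE x in M. a x = c"
    using ergodic_invariant_function[OF \<gamma>(2,1) am] by blast
  have "AE x in M. \<forall>k\<in>carrier \<Gamma>. a (\<alpha> k x) = c"
    using AE_act[OF _ c] by (simp add: AE_ball_countable[OF count])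
  then have hc: "AE x in M. \<forall>g\<in>transversal x. h (g, x) = c"
    using h_class by eventually_elim (auto simp: transversal_def)
  have int: "(\<integral>\<^sup>+z. ennreal (h z) \<partial>class_space)
      = (\<integral>\<^sup>+x. ennreal c * emeasure (count_space UNIV) (transversal x) \<partial>M)"
  proof -
    have "(\<integral>\<^sup>+z. ennreal (h z) \<partial>class_space) = (\<integral>\<^sup>+x. (\<integral>\<^sup>+g. ennreal (h (g, x)) \<partial>count_space (transversal x)) \<partial>M)"
      by (rule nn_integral_class_space) measurable
    also have "\<dots> = (\<integral>\<^sup>+x. ennreal c * emeasure (count_space UNIV) (transversal x) \<partial>M)"
    proof (rule nn_integral_cong_AE, use hc in eventually_elim)
      case (elim x)
      have "(\<integral>\<^sup>+g. ennreal (h (g, x)) \<partial>count_space (transversal x)) = (\<integral>\<^sup>+g. ennreal c \<partial>count_space (transversal x))"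
        using elim by (intro nn_integral_cong) auto
      then show ?case by (simp add: emeasure_count_space)
    qed
    finally show ?thesis .
  qed
  \<comment> \<open>Otherwise \<open>h\<close> would vanish almost everywhere.\<close>
  have cpos: "c > 0"
  proof (rule ccontr)
    assume "\<not> c > 0"
    then have "(\<integral>\<^sup>+z. ennreal (h z) \<partial>class_space) = 0" unfolding int by (simp add: ennreal_neg)
    then have "AE z in class_space. ennreal (h z) = 0"
      by (subst (asm) nn_integral_0_iff_AE) (use h(1) in measurable)
    then have "AE z in class_space. h z = 0" by eventually_elim (use h(2) in \<open>auto intro: antisym\<close>)
    then show False using h(5) by blast
  qed
  have tm: "(\<lambda>x. emeasure (count_space UNIV) (transversal x)) \<in> borel_measurable M"
  proof -
    have "(\<lambda>x. \<integral>\<^sup>+g. (\<lambda>_. 1) (g, x) \<partial>count_space (transversal x)) \<in> borel_measurable M"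
      by (rule class_sum_measurable) measurable
    then show ?thesis by (simp add: emeasure_count_space)
  qed
  have "AE x in M. ennreal c * emeasure (count_space UNIV) (transversal x) \<noteq> \<infinity>"
    using h(3) tm unfolding int by (intro nn_integral_noteq_infinite) auto
  then show ?thesis
  proof eventually_elim
    case (elim x)
    then show ?case using cpos by (cases "finite (transversal x)") (auto simp: ennreal_mult_top)
  qed
qed

text \<open>The number of classes is the same at all points of an orbit.\<close>

lemma card_classes_constant:
  assumes fin: "AE x in M. finite (transversal x)" and \<gamma>: "\<gamma> \<in> carrier \<Gamma>" "ergodic_element \<gamma>"
  obtains n where "AE x in M. finite (transversal x) \<and> card (transversal x) = n"
proof -
  have "(\<lambda>x. \<integral>\<^sup>+g. (\<lambda>_. 1) (g, x) \<partial>count_space (transversal x)) \<in> borel_measurable M"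
    by (rule class_sum_measurable) measurable
  then have "(\<lambda>x. enn2real (\<integral>\<^sup>+g. 1 \<partial>count_space (transversal x))) \<in> borel_measurable M"
    by measurable
  moreover have "enn2real (\<integral>\<^sup>+g. 1 \<partial>count_space (transversal x)) = real (card (transversal x))" for x
    by (simp add: emeasure_count_space)
  ultimately have m: "(\<lambda>x. real (card (transversal x))) \<in> borel_measurable M" by simp
  have "AE x in M. real (card (transversal (\<alpha> \<gamma> x))) = real (card (transversal x))"
    using bij_betw_same_card[OF transversal_shift_bij[OF _ \<gamma>(1)]] by (intro AE_I2) simp
  then obtain c where c: "AE x in M. real (card (transversal x)) = c"
    using ergodic_invariant_function[OF \<gamma>(2,1) m] by blast
  obtain y where "real (card (transversal y)) = c"
    using eventually_happens'[OF _ c] AE_False by (auto simp: trivial_limit_def)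
  with fin c have "AE x in M. finite (transversal x) \<and> card (transversal x) = card (transversal y)"
    by (auto simp: AE_conj_iff)
  then show thesis by (rule that)
qed

end

section \<open>Bernoulli actions\<close>

definition is_cylinder :: "'a measure \<Rightarrow> (nat \<Rightarrow> 'a) set \<Rightarrow> bool" where
  "is_cylinder N C \<longleftrightarrow> (\<exists>J B. finite J \<and> B \<in> sets (PiM J (\<lambda>_. N)) \<and>
     C = {\<omega>\<in>space (PiM UNIV (\<lambda>_. N)). restrict \<omega> J \<in> B})"

lemma cylinder_measurable: "is_cylinder N C \<Longrightarrow> C \<in> sets (PiM UNIV (\<lambda>_. N))"
proof -
  assume "is_cylinder N C"
  then obtain J B where JB: "B \<in> sets (PiM J (\<lambda>_. N))" "C = {\<omega>\<in>space (PiM UNIV (\<lambda>_. N)). restrict \<omega> J \<in> B}"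
    by (auto simp: is_cylinder_def)
  have "(\<lambda>\<omega>. restrict \<omega> J) \<in> measurable (PiM UNIV (\<lambda>_. N)) (PiM J (\<lambda>_. N))"
    by (rule measurable_restrict_subset) simp
  from measurable_sets[OF this JB(1)] show ?thesis
    unfolding JB(2) by (simp add: vimage_def Collect_conj_eq Int_commute)
qed

lemma cylinder_Compl:
  assumes "is_cylinder N C" shows "is_cylinder N (space (PiM UNIV (\<lambda>_. N)) - C)"
proof -
  obtain J B where JB: "finite J" "B \<in> sets (PiM J (\<lambda>_. N))" "C = {\<omega>\<in>space (PiM UNIV (\<lambda>_. N)). restrict \<omega> J \<in> B}"
    using assms by (auto simp: is_cylinder_def)
  have "space (PiM UNIV (\<lambda>_. N)) - C = {\<omega>\<in>space (PiM UNIV (\<lambda>_. N)). restrict \<omega> J \<in> space (PiM J (\<lambda>_. N)) - B}"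
    unfolding JB(3) by (auto simp: space_PiM PiE_iff)
  then show ?thesis unfolding is_cylinder_def using JB by blast
qed

lemma cylinder_Un:
  assumes "is_cylinder N C" "is_cylinder N D" shows "is_cylinder N (C \<union> D)"
proof -
  obtain J B where JB: "finite J" "B \<in> sets (PiM J (\<lambda>_. N))" "C = {\<omega>\<in>space (PiM UNIV (\<lambda>_. N)). restrict \<omega> J \<in> B}"
    using assms(1) by (auto simp: is_cylinder_def)
  obtain K E where KE: "finite K" "E \<in> sets (PiM K (\<lambda>_. N))" "D = {\<omega>\<in>space (PiM UNIV (\<lambda>_. N)). restrict \<omega> K \<in> E}"
    using assms(2) by (auto simp: is_cylinder_def)
  let ?P = "PiM (J \<union> K) (\<lambda>_. N)"
  let ?F = "((\<lambda>f. restrict f J) -` B \<inter> space ?P) \<union> ((\<lambda>f. restrict f K) -` E \<inter> space ?P)"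
  have "?F \<in> sets ?P"
    by (intro sets.Un measurable_sets[OF measurable_restrict_subset] JB KE) auto
  moreover have "C \<union> D = {\<omega>\<in>space (PiM UNIV (\<lambda>_. N)). restrict \<omega> (J \<union> K) \<in> ?F}"
    unfolding JB(3) KE(3) by (auto simp: space_PiM PiE_iff Int_absorb1)
  moreover have "finite (J \<union> K)" using JB KE by simp
  ultimately show ?thesis unfolding is_cylinder_def by blast
qed

lemma cylinder_empty: "is_cylinder N {}"
  unfolding is_cylinder_def by (intro exI[of _ "{}"]) auto

locale bernoulli_space = prob_space N for N :: "'a measure"

sublocale bernoulli_space \<subseteq> P: product_prob_space "\<lambda>_. N" "UNIV :: nat set"
  by unfold_locales

context bernoulli_space begin

abbreviation Pr :: "(nat \<Rightarrow> 'a) measure" where "Pr \<equiv> PiM UNIV (\<lambda>_. N)"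

text \<open>
  The sets approximable by cylinders form a \<open>\<sigma>\<close>-algebra: for a countable union, finitely many sets
  exhaust all but \<open>e / 2\<close> of the measure, and the errors of their approximations are summable to \<open>e / 2\<close>.
\<close>

lemma cylinder_approximation:
  assumes A: "A \<in> sets Pr" and e: "e > 0"
  shows "\<exists>C. is_cylinder N C \<and> measure Pr (A - C \<union> (C - A)) < e"
proof -
  have "A \<in> sigma_sets (\<Pi>\<^sub>E i\<in>UNIV. space N) {{f\<in>\<Pi>\<^sub>E i\<in>UNIV. space N. f i \<in> B} | i B. i \<in> UNIV \<and> B \<in> sets N}"
    using A unfolding sets_PiM_single .
  then show ?thesis using e
  proof (induction arbitrary: e rule: sigma_sets.induct)
    case (Basic a)
    then obtain i B where iB: "B \<in> sets N" "a = {f\<in>\<Pi>\<^sub>E i\<in>UNIV. space N. f i \<in> B}" by blast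
    have "(\<lambda>f. f i) -` B \<inter> space (PiM {i} (\<lambda>_. N)) \<in> sets (PiM {i} (\<lambda>_. N))"
      by (rule measurable_sets[OF _ iB(1)]) measurable
    moreover have "a = {\<omega>\<in>space Pr. restrict \<omega> {i} \<in> (\<lambda>f. f i) -` B \<inter> space (PiM {i} (\<lambda>_. N))}"
      unfolding iB(2) by (auto simp: space_PiM PiE_iff)
    ultimately have "is_cylinder N a"
      unfolding is_cylinder_def by (intro exI[of _ "{i}"]) blast
    then show ?case using Basic.prems by (intro exI[of _ a]) simp
  next
    case Empty
    then show ?case using cylinder_empty by (intro exI[of _ "{}"]) simp
  next
    case (Compl a)
    then obtain C where C: "is_cylinder N C" "measure Pr (a - C \<union> (C - a)) < e" by blast
    have "a \<in> sets Pr" using Compl(1) unfolding sets_PiM_single .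
    then have "a \<subseteq> space Pr" "C \<subseteq> space Pr"
      using sets.sets_into_space cylinder_measurable[OF C(1)] by blast+
    then have "((\<Pi>\<^sub>E i\<in>UNIV. space N) - a) - (space Pr - C) \<union> ((space Pr - C) - ((\<Pi>\<^sub>E i\<in>UNIV. space N) - a))
        = a - C \<union> (C - a)"
      unfolding space_PiM by blast
    then show ?case using C cylinder_Compl[OF C(1)] by (intro exI[of _ "space Pr - C"]) simp
  next
    case (Union a)
    have am [measurable]: "a i \<in> sets Pr" for i using Union(1) unfolding sets_PiM_single .
    have "\<exists>C. is_cylinder N C \<and> measure Pr (a i - C \<union> (C - a i)) < e / 2 * (1/2) ^ Suc i" for i
      using Union.prems by (intro Union.IH) simp
    then obtain C where C: "\<And>i. is_cylinder N (C i)"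
      "\<And>i. measure Pr (a i - C i \<union> (C i - a i)) < e / 2 * (1/2) ^ Suc i" by metis
    note Cm [measurable] = cylinder_measurable[OF C(1)]
    have "(\<lambda>n. measure Pr (\<Union>i<n. a i)) \<longlonglongrightarrow> measure Pr (\<Union>n. \<Union>i<n. a i)"
      by (rule P.finite_Lim_measure_incseq) (auto simp: lessThan_Suc intro!: incseq_SucI)
    moreover have "(\<Union>n. \<Union>i<n. a i) = (\<Union>i. a i)" by auto
    ultimately have "eventually (\<lambda>n. measure Pr (\<Union>i<n. a i) > measure Pr (\<Union>i. a i) - e / 2) sequentially"
      using Union.prems by (intro order_tendstoD) auto
    then obtain n where n: "measure Pr (\<Union>i<n. a i) > measure Pr (\<Union>i. a i) - e / 2"
      by (auto simp: eventually_sequentially)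
    define D where "D = (\<Union>i<n. C i)"
    have cyl: "is_cylinder N (\<Union>i<m. C i)" for m
      by (induction m) (auto simp: lessThan_Suc cylinder_empty intro: cylinder_Un C(1))
    have "measure Pr ((\<Union>i. a i) - D \<union> (D - (\<Union>i. a i)))
        \<le> measure Pr (((\<Union>i. a i) - (\<Union>i<n. a i)) \<union> (\<Union>i<n. a i - C i \<union> (C i - a i)))"
      unfolding D_def by (rule P.finite_measure_mono) (auto intro!: sets.Un sets.Diff sets.countable_UN)
    also have "\<dots> \<le> measure Pr ((\<Union>i. a i) - (\<Union>i<n. a i)) + measure Pr (\<Union>i<n. a i - C i \<union> (C i - a i))"
      by (rule measure_Un_le) (auto intro!: sets.Un sets.Diff sets.countable_UN)
    also have "measure Pr ((\<Union>i. a i) - (\<Union>i<n. a i)) = measure Pr (\<Union>i. a i) - measure Pr (\<Union>i<n. a i)"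
      by (rule P.finite_measure_Diff) auto
    also have "measure Pr (\<Union>i<n. a i - C i \<union> (C i - a i)) \<le> (\<Sum>i<n. measure Pr (a i - C i \<union> (C i - a i)))"
      by (rule P.finite_measure_subadditive_finite) auto
    also have "\<dots> \<le> (\<Sum>i<n. e / 2 * (1/2) ^ Suc i)"
      by (intro sum_mono less_imp_le C(2))
    also have "\<dots> = e / 2 * (1 - (1/2)^n)"
      by (induction n) (auto simp: field_simps)
    also have "\<dots> \<le> e / 2" using Union.prems by (simp add: field_simps)
    finally have "measure Pr ((\<Union>i. a i) - D \<union> (D - (\<Union>i. a i))) < e" using n by linarith
    then show ?case using cyl[of n] unfolding D_def by blast
  qed
qed

lemma coordinates_indep: "P.indep_vars (\<lambda>_. N) (\<lambda>i \<omega>. \<omega> i) UNIV"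
proof (subst P.indep_vars_iff_distr_eq_PiM)
  have "distr Pr Pr (\<lambda>x. \<lambda>i\<in>UNIV. x i) = Pr" by (simp add: restrict_UNIV distr_id)
  moreover have "(\<Pi>\<^sub>M i\<in>UNIV. distr Pr N (\<lambda>\<omega>. \<omega> i)) = Pr"
    by (intro PiM_cong refl distr_PiM_component) (auto intro: prob_space_axioms)
  ultimately show "distr Pr Pr (\<lambda>x. \<lambda>i\<in>UNIV. x i) = (\<Pi>\<^sub>M i\<in>UNIV. distr Pr N (\<lambda>\<omega>. \<omega> i))" by simp
qed auto

lemma shift_measurable: "(\<lambda>\<omega> n. \<omega> (\<sigma> n)) \<in> measurable Pr Pr"
  by (rule measurable_PiM_single') (auto simp: space_PiM PiE_iff)

lemma shift_distr:
  assumes "inj \<sigma>"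
  shows "distr Pr Pr (\<lambda>\<omega> n. \<omega> (\<sigma> n)) = Pr"
  using distr_PiM_reindex[of UNIV "\<lambda>_. N" \<sigma> UNIV] assms by (simp add: prob_space_axioms restrict_UNIV)

text \<open>The cylinder and its translate depend on disjoint sets of independent coordinates.\<close>

lemma displaced_cylinder_indep:
  assumes \<tau>: "inj \<tau>" "\<tau> ` J \<inter> J = {}" and B: "B \<in> sets (PiM J (\<lambda>_. N))"
    and C: "C = {\<omega>\<in>space Pr. restrict \<omega> J \<in> B}"
  shows "measure Pr (C \<inter> {\<omega>\<in>space Pr. (\<lambda>n. \<omega> (\<tau> n)) \<in> C}) = (measure Pr C)\<^sup>2"
proof -
  let ?K = "\<tau> ` J"
  define B' where "B' = (\<lambda>f. \<lambda>j\<in>J. f (\<tau> j)) -` B \<inter> space (PiM ?K (\<lambda>_. N))"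
  have "(\<lambda>f. \<lambda>j\<in>J. f (\<tau> j)) \<in> measurable (PiM ?K (\<lambda>_. N)) (PiM J (\<lambda>_. N))"
    by (rule measurable_restrict) (auto intro: measurable_component_singleton)
  then have B': "B' \<in> sets (PiM ?K (\<lambda>_. N))" unfolding B'_def using B by (rule measurable_sets)
  have ind: "P.indep_var (PiM J (\<lambda>_. N)) (\<lambda>\<omega>. restrict (\<lambda>i. \<omega> i) J) (PiM ?K (\<lambda>_. N)) (\<lambda>\<omega>. restrict (\<lambda>i. \<omega> i) ?K)"
    by (rule P.indep_var_restrict[OF coordinates_indep]) (use \<tau> in auto)
  have Cm: "C \<in> sets Pr"
  proof -
    have "(\<lambda>\<omega>. restrict \<omega> J) \<in> measurable Pr (PiM J (\<lambda>_. N))" by (rule measurable_restrict_subset) simp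
    from measurable_sets[OF this B] show ?thesis
      unfolding C by (simp add: vimage_def Collect_conj_eq Int_commute)
  qed
  have C1: "C = (\<lambda>\<omega>. restrict (\<lambda>i. \<omega> i) J) -` B \<inter> space Pr" unfolding C by auto
  have C2: "{\<omega>\<in>space Pr. (\<lambda>n. \<omega> (\<tau> n)) \<in> C} = (\<lambda>\<omega>. restrict (\<lambda>i. \<omega> i) ?K) -` B' \<inter> space Pr"
  proof -
    have "(\<lambda>j\<in>J. restrict \<omega> ?K (\<tau> j)) = restrict (\<lambda>n. \<omega> (\<tau> n)) J" for \<omega> :: "nat \<Rightarrow> 'a"
      by (auto simp: restrict_def)
    then show ?thesis unfolding C B'_def by (auto simp: space_PiM PiE_iff)
  qed
  have "measure Pr (C \<inter> {\<omega>\<in>space Pr. (\<lambda>n. \<omega> (\<tau> n)) \<in> C}) = measure Pr C * measure Pr {\<omega>\<in>space Pr. (\<lambda>n. \<omega> (\<tau> n)) \<in> C}"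
  proof -
    have "measure Pr ((\<lambda>x. (restrict (\<lambda>i. x i) J, restrict (\<lambda>i. x i) ?K)) -` (B \<times> B') \<inter> space Pr)
        = measure Pr ((\<lambda>\<omega>. restrict (\<lambda>i. \<omega> i) J) -` B \<inter> space Pr) * measure Pr ((\<lambda>\<omega>. restrict (\<lambda>i. \<omega> i) ?K) -` B' \<inter> space Pr)"
      by (rule P.indep_varD[OF ind B B'])
    moreover have "(\<lambda>x. (restrict (\<lambda>i. x i) J, restrict (\<lambda>i. x i) ?K)) -` (B \<times> B') \<inter> space Pr
        = C \<inter> {\<omega>\<in>space Pr. (\<lambda>n. \<omega> (\<tau> n)) \<in> C}" by (subst C2, subst C1) auto
    ultimately show ?thesis unfolding C2 using C1 by simp
  qed
  also have "measure Pr {\<omega>\<in>space Pr. (\<lambda>n. \<omega> (\<tau> n)) \<in> C} = measure (distr Pr Pr (\<lambda>\<omega> n. \<omega> (\<tau> n))) C"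
    by (subst measure_distr[OF shift_measurable Cm]) (auto intro!: arg_cong[where f = "measure Pr"])
  also have "\<dots> = measure Pr C" unfolding shift_distr[OF \<tau>(1)] ..
  finally show ?thesis by (simp add: power2_eq_square)
qed

text \<open>
  Mixing implies ergodicity: \<open>A\<close> is close to a cylinder \<open>C\<close> and, being invariant, to a translate of \<open>C\<close> displaced
  from it; so its measure is close to that of their intersection, \<open>\<mu>(C)\<^sup>2\<close>, and in the limit
  \<open>\<mu>(A) = \<mu>(A)\<^sup>2\<close>.
\<close>

lemma displaced_invariant_trivial:
  assumes A: "A \<in> sets Pr"
    and disp: "\<And>J. finite J \<Longrightarrow> \<exists>\<tau>. inj \<tau> \<and> \<tau> ` J \<inter> J = {} \<and> (AE \<omega> in Pr. (\<lambda>n. \<omega> (\<tau> n)) \<in> A \<longleftrightarrow> \<omega> \<in> A)"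
  shows "measure Pr A = 0 \<or> measure Pr A = 1"
proof -
  have le: "\<bar>measure Pr A - (measure Pr A)\<^sup>2\<bar> \<le> 4 * e" if e: "e > 0" for e
  proof -
    obtain C where C: "is_cylinder N C" "measure Pr (A - C \<union> (C - A)) < e"
      using cylinder_approximation[OF A e] by blast
    obtain J B where JB: "finite J" "B \<in> sets (PiM J (\<lambda>_. N))" "C = {\<omega>\<in>space Pr. restrict \<omega> J \<in> B}"
      using C(1) by (auto simp: is_cylinder_def)
    obtain \<tau> where \<tau>: "inj \<tau>" "\<tau> ` J \<inter> J = {}" "AE \<omega> in Pr. (\<lambda>n. \<omega> (\<tau> n)) \<in> A \<longleftrightarrow> \<omega> \<in> A"
      using disp[OF JB(1)] by blast
    note [measurable] = A cylinder_measurable[OF C(1)] shift_measurable[of \<tau>]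
    let ?T = "\<lambda>\<omega> n. \<omega> (\<tau> n)"
    define C' where "C' = {\<omega>\<in>space Pr. ?T \<omega> \<in> C}"
    have pre: "measure Pr {\<omega>\<in>space Pr. ?T \<omega> \<in> X} = measure Pr X" if "X \<in> sets Pr" for X
    proof -
      have "measure Pr {\<omega>\<in>space Pr. ?T \<omega> \<in> X} = measure (distr Pr Pr ?T) X"
        using that by (subst measure_distr) (auto intro!: arg_cong[where f = "measure Pr"])
      then show ?thesis unfolding shift_distr[OF \<tau>(1)] .
    qed
    have [measurable]: "C' \<in> sets Pr" unfolding C'_def by measurable
    have "measure Pr (A - C' \<union> (C' - A)) = measure Pr {\<omega>\<in>space Pr. ?T \<omega> \<in> A - C \<union> (C - A)}"
      by (rule P.finite_measure_eq_AE)
         (use \<tau>(3) AE_space in \<open>eventually_elim, auto simp: C'_def\<close>, measurable)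
    also have "\<dots> < e" using C(2) by (subst pre) auto
    finally have e': "measure Pr (A - C' \<union> (C' - A)) < e" .
    have sub: "\<bar>measure Pr X - measure Pr Y\<bar> \<le> measure Pr (X - Y \<union> (Y - X))" if "X \<in> sets Pr" "Y \<in> sets Pr" for X Y
    proof -
      have "measure Pr X \<le> measure Pr (Y \<union> (X - Y \<union> (Y - X)))" "measure Pr Y \<le> measure Pr (X \<union> (X - Y \<union> (Y - X)))"
        using that by (auto intro!: P.finite_measure_mono)
      moreover have "measure Pr (Y \<union> (X - Y \<union> (Y - X))) \<le> measure Pr Y + measure Pr (X - Y \<union> (Y - X))"
        "measure Pr (X \<union> (X - Y \<union> (Y - X))) \<le> measure Pr X + measure Pr (X - Y \<union> (Y - X))"
        using that by (auto intro!: measure_Un_le)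
      ultimately show ?thesis by linarith
    qed
    have "\<bar>measure Pr A - measure Pr (C \<inter> C')\<bar> \<le> measure Pr (A - C \<inter> C' \<union> (C \<inter> C' - A))"
      by (rule sub) auto
    also have "\<dots> \<le> measure Pr ((A - C \<union> (C - A)) \<union> (A - C' \<union> (C' - A)))"
      by (rule P.finite_measure_mono) auto
    also have "\<dots> \<le> measure Pr (A - C \<union> (C - A)) + measure Pr (A - C' \<union> (C' - A))"
      by (rule measure_Un_le) auto
    finally have 1: "\<bar>measure Pr A - (measure Pr C)\<^sup>2\<bar> \<le> 2 * e"
      using displaced_cylinder_indep[OF \<tau>(1,2) JB(2,3)] C(2) e' by (simp add: C'_def)
    have 2: "\<bar>measure Pr A - measure Pr C\<bar> < e" using sub[of A C] C(2) by auto
    have "(measure Pr A)\<^sup>2 - (measure Pr C)\<^sup>2 = (measure Pr A - measure Pr C) * (measure Pr A + measure Pr C)"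
      by (simp add: power2_eq_square algebra_simps)
    then have "\<bar>(measure Pr A)\<^sup>2 - (measure Pr C)\<^sup>2\<bar> = \<bar>measure Pr A - measure Pr C\<bar> * (measure Pr A + measure Pr C)"
      by (simp add: abs_mult)
    also have "\<dots> \<le> e * 2"
    proof (rule mult_mono)
      show "measure Pr A + measure Pr C \<le> 2" using P.prob_le_1[of A] P.prob_le_1[of C] by linarith
    qed (use 2 e in auto)
    finally show ?thesis using 1 by linarith
  qed
  have "\<bar>measure Pr A - (measure Pr A)\<^sup>2\<bar> \<le> 0"
  proof (rule field_le_epsilon)
    fix e :: real assume "e > 0"
    then show "\<bar>measure Pr A - (measure Pr A)\<^sup>2\<bar> \<le> 0 + e" using le[of "e / 4"] by simp
  qed
  then have "measure Pr A * (1 - measure Pr A) = 0" by (simp add: power2_eq_square algebra_simps)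
  then show ?thesis by simp
qed

end

abbreviation unit_uniform :: "real measure" where
  "unit_uniform \<equiv> uniform_measure lborel {0..1}"

lemma prob_space_unit_uniform: "prob_space unit_uniform"
  by (rule prob_space_uniform_measure) auto

lemma AE_unit_uniform_neq: "AE y in unit_uniform. y \<noteq> x"
  by (subst AE_uniform_measure) (use AE_lborel_singleton[of x] in \<open>auto elim!: AE_mp\<close>)

lemma measure_unit_uniform:
  assumes "0 \<le> s" "s \<le> t" "t \<le> 1"
  shows "measure unit_uniform {s<..t} = t - s"
proof -
  have "{0..1} \<inter> {s<..t} = {s<..t}" using assms by auto
  then show ?thesis
    using assms by (subst measure_uniform_measure) (auto simp: measure_def)
qed

interpretation bernoulli: bernoulli_space unit_uniform
  unfolding bernoulli_space_def by (rule prob_space_unit_uniform)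

abbreviation bernoulli_measure :: "(nat \<Rightarrow> real) measure" where
  "bernoulli_measure \<equiv> PiM UNIV (\<lambda>_. unit_uniform)"

lemma space_bernoulli [simp]: "space bernoulli_measure = UNIV"
  by (simp add: space_PiM)

lemma sets_bernoulli: "sets bernoulli_measure = sets borel"
proof -
  have "sets bernoulli_measure = sets (PiM UNIV (\<lambda>_. borel :: real measure))"
    by (rule sets_PiM_cong) auto
  then show ?thesis by (simp add: sets_PiM_equal_borel)
qed

lemma standard_bernoulli: "standard_prob_space bernoulli_measure"
  unfolding standard_prob_space_def standard_borel_def
proof (intro conjI exI)
  show "prob_space bernoulli_measure" by (rule bernoulli.P.prob_space_axioms)
  show "completely_metrizable_space (euclidean :: (nat \<Rightarrow> real) topology)"
    by (rule completely_metrizable_space_euclidean)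
  show "second_countable (euclidean :: (nat \<Rightarrow> real) topology)"
  proof -
    obtain \<B> :: "(nat \<Rightarrow> real) set set" where B: "countable \<B>" "topological_basis \<B>"
      using ex_countable_basis by blast
    have "\<exists>V\<in>\<B>. x \<in> V \<and> V \<subseteq> U" if "open U" "x \<in> U" for U x
      using topological_basisE[OF B(2) that] by metis
    then show ?thesis
      unfolding second_countable_def
      using B topological_basis_open[OF B(2)] by (intro exI[of _ \<B>]) auto
  qed
  show "sets bernoulli_measure = sigma_sets (space bernoulli_measure) {U. openin euclidean U}"
    unfolding sets_bernoulli by (simp add: borel_def)
qed simp

lemma diagonal_bernoulli:
  "{(x, y). x = y} \<in> sets (bernoulli_measure \<Otimes>\<^sub>M bernoulli_measure)"
proof -
  have "{(x, y). x = y} = (\<Inter>n. {p\<in>space (bernoulli_measure \<Otimes>\<^sub>M bernoulli_measure). fst p n = snd p n})"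
    by (auto simp: space_pair_measure fun_eq_iff)
  also have "\<dots> \<in> sets (bernoulli_measure \<Otimes>\<^sub>M bernoulli_measure)"
  proof (rule sets.countable_INT')
    have 1: "(\<lambda>p. fst p n) \<in> borel_measurable (bernoulli_measure \<Otimes>\<^sub>M bernoulli_measure)" for n
      by measurable
    have 2: "(\<lambda>p. snd p n) \<in> borel_measurable (bernoulli_measure \<Otimes>\<^sub>M bernoulli_measure)" for n
      by measurable
    show "(\<lambda>n. {p\<in>space (bernoulli_measure \<Otimes>\<^sub>M bernoulli_measure). fst p n = snd p n}) ` UNIV
      \<subseteq> sets (bernoulli_measure \<Otimes>\<^sub>M bernoulli_measure)"
      using borel_measurable_eq[OF 1 2] by auto
  qed auto
  finally show ?thesis .
qed

lemma bernoulli_coordinates_distinct: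
  assumes ij: "i \<noteq> j"
  shows "AE \<omega> in bernoulli_measure. \<omega> i \<noteq> \<omega> j"
proof -
  let ?U = unit_uniform and ?P = bernoulli_measure
  have c: "(\<lambda>\<omega>. \<omega> k) \<in> measurable ?P ?U" for k by (rule measurable_component_singleton) simp
  have d: "distr ?P ?U (\<lambda>\<omega>. \<omega> k) = ?U" for k
    by (rule distr_PiM_component) (auto intro: prob_space_unit_uniform)
  have "bernoulli.P.indep_var (PiM {i} (\<lambda>_. ?U)) (\<lambda>\<omega>. restrict (\<lambda>k. \<omega> k) {i}) (PiM {j} (\<lambda>_. ?U)) (\<lambda>\<omega>. restrict (\<lambda>k. \<omega> k) {j})"
    by (rule bernoulli.P.indep_var_restrict[OF bernoulli.coordinates_indep]) (use ij in auto)
  then have "bernoulli.P.indep_var ?U ((\<lambda>f. f i) \<circ> (\<lambda>\<omega>. restrict (\<lambda>k. \<omega> k) {i})) ?U ((\<lambda>f. f j) \<circ> (\<lambda>\<omega>. restrict (\<lambda>k. \<omega> k) {j}))"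
    by (rule bernoulli.P.indep_var_compose) (auto intro: measurable_component_singleton)
  then have "bernoulli.P.indep_var ?U (\<lambda>\<omega>. \<omega> i) ?U (\<lambda>\<omega>. \<omega> j)"
    by (simp add: comp_def)
  then have "distr ?P (?U \<Otimes>\<^sub>M ?U) (\<lambda>\<omega>. (\<omega> i, \<omega> j)) = ?U \<Otimes>\<^sub>M ?U"
    using d by (simp add: bernoulli.P.indep_var_distribution_eq)
  interpret U: prob_space ?U by (rule prob_space_unit_uniform)
  interpret UU: pair_prob_space ?U ?U ..
  have m: "{p\<in>space (?U \<Otimes>\<^sub>M ?U). snd p \<noteq> fst p} \<in> sets (?U \<Otimes>\<^sub>M ?U)"
    by measurable
  have "AE p in ?U \<Otimes>\<^sub>M ?U. snd p \<noteq> fst p"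
    by (rule UU.AE_pair_measure[OF m]) (simp add: AE_unit_uniform_neq)
  then have "AE p in distr ?P (?U \<Otimes>\<^sub>M ?U) (\<lambda>\<omega>. (\<omega> i, \<omega> j)). snd p \<noteq> fst p"
    unfolding \<open>distr ?P (?U \<Otimes>\<^sub>M ?U) (\<lambda>\<omega>. (\<omega> i, \<omega> j)) = ?U \<Otimes>\<^sub>M ?U\<close> .
  then have "AE \<omega> in ?P. snd (\<omega> i, \<omega> j) \<noteq> fst (\<omega> i, \<omega> j)"
    by (rule AE_distrD[rotated]) (use c in measurable)
  then show ?thesis by eventually_elim auto
qed

text \<open>
  The measure of the part of \<open>D\<close> with first coordinate at most \<open>t\<close> is \<open>1\<close>-Lipschitz in \<open>t\<close>, so it takes every
  value up to that of \<open>D\<close>.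
\<close>

lemma bernoulli_divisible:
  assumes D: "D \<in> sets bernoulli_measure" and r: "0 \<le> r" "r \<le> measure bernoulli_measure D"
  shows "\<exists>B\<in>sets bernoulli_measure. B \<subseteq> D \<and> measure bernoulli_measure B = r"
proof -
  let ?P = bernoulli_measure
  define S where "S t = D \<inter> {\<omega>. 0 < \<omega> 0 \<and> \<omega> 0 \<le> t}" for t :: real
  define f where "f t = measure ?P (S t)" for t :: real
  have c [measurable]: "(\<lambda>\<omega>. \<omega> 0) \<in> measurable ?P unit_uniform" by (rule measurable_component_singleton) simp
  have slice: "{\<omega>. s < \<omega> 0 \<and> \<omega> 0 \<le> t} \<in> sets ?P" for s t
    using measurable_sets[OF c, of "{s<..t}"] by (simp add: vimage_def)
  have Sm: "S t \<in> sets ?P" for t unfolding S_def using D slice by (intro sets.Int)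
  have ms: "measure ?P {\<omega>. s < \<omega> 0 \<and> \<omega> 0 \<le> t} = t - s" if st: "0 \<le> s" "s \<le> t" "t \<le> 1" for s t
  proof -
    have "measure (distr ?P unit_uniform (\<lambda>\<omega>. \<omega> 0)) {s<..t} = measure ?P ((\<lambda>\<omega>. \<omega> 0) -` {s<..t} \<inter> space ?P)"
      by (rule measure_distr[OF c]) simp
    moreover have "distr ?P unit_uniform (\<lambda>\<omega>. \<omega> 0) = unit_uniform"
      by (rule distr_PiM_component) (auto intro: prob_space_unit_uniform)
    moreover have "(\<lambda>\<omega>. \<omega> 0) -` {s<..t} \<inter> space ?P = {\<omega>. s < \<omega> 0 \<and> \<omega> 0 \<le> t}" by auto
    ultimately show ?thesis using measure_unit_uniform[OF st] by simp
  qed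
  have lip: "\<bar>f t - f s\<bar> \<le> t - s" if st: "0 \<le> s" "s \<le> t" "t \<le> 1" for s t
  proof -
    have "f t \<le> measure ?P (S s \<union> {\<omega>. s < \<omega> 0 \<and> \<omega> 0 \<le> t})"
      unfolding f_def by (rule bernoulli.P.finite_measure_mono) (auto simp: S_def intro!: sets.Un Sm[unfolded S_def] slice)
    also have "\<dots> \<le> f s + (t - s)"
      using measure_Un_le[OF Sm slice, of s s t] ms[OF st] by (simp add: f_def)
    finally have "f t \<le> f s + (t - s)" .
    moreover have "f s \<le> f t"
      unfolding f_def by (rule bernoulli.P.finite_measure_mono[OF _ Sm]) (use st in \<open>auto simp: S_def\<close>)
    ultimately show ?thesis by simp
  qed
  have "continuous_on {0..1} f"
  proof (rule continuous_onI)
    fix x e :: real assume x: "x \<in> {0..1}" and e: "e > 0"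
    have "dist (f y) (f x) \<le> e" if y: "y \<in> {0..1}" "dist y x < e" for y
    proof (cases "x \<le> y")
      case True
      then have "\<bar>f y - f x\<bar> \<le> y - x" using x y by (intro lip) auto
      then show ?thesis using y(2) True by (simp add: dist_real_def)
    next
      case False
      then have "\<bar>f x - f y\<bar> \<le> x - y" using x y by (intro lip) auto
      then show ?thesis using y(2) False by (simp add: dist_real_def)
    qed
    then show "\<exists>d>0. \<forall>y\<in>{0..1}. dist y x < d \<longrightarrow> dist (f y) (f x) \<le> e" using e by blast
  qed
  moreover have "f 0 = 0"
  proof -
    have "S 0 = {}" unfolding S_def by fastforce
    then show ?thesis by (simp add: f_def)
  qed
  moreover have "f 1 = measure ?P D"
  proof -
    have "AE \<omega> in ?P. \<omega> \<in> {\<omega>. 0 < \<omega> 0 \<and> \<omega> 0 \<le> 1}"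
      by (rule bernoulli.P.prob_eq_1[OF slice, THEN iffD1]) (use ms[of 0 1] in simp)
    then have "AE \<omega> in ?P. \<omega> \<in> S 1 \<longleftrightarrow> \<omega> \<in> D" by eventually_elim (auto simp: S_def)
    then show ?thesis
      unfolding f_def by (rule bernoulli.P.finite_measure_eq_AE[OF _ Sm D])
  qed
  ultimately obtain t where "f t = r"
    using IVT'[of f 0 r 1] r by auto
  then show ?thesis using Sm[of t] by (intro bexI[of _ "S t"]) (auto simp: f_def S_def)
qed

text \<open>
  The shift action on functions on the group, with the group enumerated by the natural numbers. A
  non-trivial \<open>g\<close> moves every coordinate, and two given coordinates almost surely differ, which gives freeness.
  If \<open>\<gamma>\<close> has infinite order, each coordinate is sent to a given other one by at most one power of
  \<open>\<gamma>\<close>, so some power displaces any given finite set of coordinates.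
\<close>

lemma bernoulli_action:
  fixes \<Gamma> :: "('g, 'b) monoid_scheme" (structure)
  assumes G: "group \<Gamma>" "countable (carrier \<Gamma>)" "infinite (carrier \<Gamma>)"
  obtains \<alpha> where "pmp_action \<Gamma> bernoulli_measure \<alpha>" "free_pmp_action \<Gamma> bernoulli_measure \<alpha>"
    "\<And>\<gamma>. \<lbrakk>\<gamma> \<in> carrier \<Gamma>; group.ord \<Gamma> \<gamma> = 0\<rbrakk> \<Longrightarrow> pmp_action.ergodic_element bernoulli_measure \<alpha> \<gamma>"
proof -
  interpret G: group \<Gamma> by fact
  let ?P = bernoulli_measure
  define d where "d = to_nat_on (carrier \<Gamma>)"
  define e where "e = from_nat_into (carrier \<Gamma>)"
  have de [simp]: "d (e n) = n" for n
    using G unfolding d_def e_def by simp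
  have ed [simp]: "g \<in> carrier \<Gamma> \<Longrightarrow> e (d g) = g" for g
    using G unfolding d_def e_def by simp
  have ec [simp]: "e n \<in> carrier \<Gamma>" for n
    unfolding e_def by (rule from_nat_into) (use G.one_closed in blast)
  define \<sigma> where "\<sigma> g n = d (inv g \<otimes> e n)" for g n
  define \<alpha> :: "'g \<Rightarrow> (nat \<Rightarrow> real) \<Rightarrow> nat \<Rightarrow> real" where "\<alpha> g \<omega> n = \<omega> (\<sigma> g n)" for g \<omega> n
  have \<sigma>_mult: "\<sigma> (g \<otimes> h) n = \<sigma> h (\<sigma> g n)" if "g \<in> carrier \<Gamma>" "h \<in> carrier \<Gamma>" for g h n
    using that by (simp add: \<sigma>_def G.inv_mult_group G.m_assoc)
  have \<sigma>_one: "\<sigma> \<one> n = n" for n by (simp add: \<sigma>_def)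
  have \<alpha>_mult: "\<alpha> (g \<otimes> h) \<omega> = \<alpha> g (\<alpha> h \<omega>)" if "g \<in> carrier \<Gamma>" "h \<in> carrier \<Gamma>" for g h \<omega>
    using that by (simp add: \<alpha>_def fun_eq_iff \<sigma>_mult)
  have \<alpha>_one: "\<alpha> \<one> \<omega> = \<omega>" for \<omega> by (simp add: \<alpha>_def fun_eq_iff \<sigma>_one)
  have inj: "inj (\<sigma> g)" if "g \<in> carrier \<Gamma>" for g
  proof (rule inj_on_inverseI)
    show "\<sigma> (inv g) (\<sigma> g n) = n" for n
      using \<sigma>_mult[of g "inv g" n] that by (simp add: \<sigma>_one)
  qed
  have bij: "\<alpha> g \<in> Bij (space ?P)" if "g \<in> carrier \<Gamma>" for g
  proof -
    have "bij_betw (\<alpha> g) UNIV UNIV"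
      by (rule bij_betw_byWitness[where f' = "\<alpha> (inv g)"])
         (use that in \<open>auto simp: \<alpha>_mult[symmetric] \<alpha>_one\<close>)
    then show ?thesis by (simp add: Bij_def)
  qed
  have act: "group_action \<Gamma> (space ?P) \<alpha>"
    unfolding group_action_def group_hom_def group_hom_axioms_def
  proof (intro conjI G.is_group group_BijGroup)
    show "\<alpha> \<in> hom \<Gamma> (BijGroup (space ?P))"
      using bij \<alpha>_mult by (auto simp: hom_def BijGroup_def compose_def restrict_def fun_eq_iff)
  qed
  have meas: "\<alpha> g \<in> measurable ?P ?P" for g
    unfolding \<alpha>_def by (rule bernoulli.shift_measurable)
  have dist: "distr ?P ?P (\<alpha> g) = ?P" if "g \<in> carrier \<Gamma>" for g
    unfolding \<alpha>_def by (rule bernoulli.shift_distr[OF inj[OF that]])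
  show thesis
  proof (rule that[of \<alpha>])
    show pmp: "pmp_action \<Gamma> ?P \<alpha>"
      by (rule pmp_action.intro[OF bernoulli.P.prob_space_axioms act meas dist G(2)])
    have "AE \<omega> in ?P. \<alpha> g \<omega> \<noteq> \<omega>" if g: "g \<in> carrier \<Gamma>" "g \<noteq> \<one>" for g
    proof -
      have "\<sigma> g 0 \<noteq> 0"
      proof
        assume "\<sigma> g 0 = 0"
        then have "e (\<sigma> g 0) = e 0" by simp
        then have "inv g \<otimes> e 0 = e 0" using g by (simp add: \<sigma>_def)
        then have "inv g = \<one>" using g by simp
        then show False using g by (metis G.inv_inv G.inv_one)
      qed
      then have "AE \<omega> in ?P. \<omega> (\<sigma> g 0) \<noteq> \<omega> 0" by (rule bernoulli_coordinates_distinct)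
      then show ?thesis by eventually_elim (auto simp: \<alpha>_def fun_eq_iff)
    qed
    then have "AE \<omega> in ?P. g \<noteq> \<one> \<longrightarrow> \<alpha> g \<omega> \<noteq> \<omega>" if "g \<in> carrier \<Gamma>" for g
      using that by (cases "g = \<one>") simp_all
    then have "\<forall>g\<in>carrier \<Gamma>. AE \<omega> in ?P. g \<noteq> \<one> \<longrightarrow> \<alpha> g \<omega> \<noteq> \<omega>" by (rule ballI)
    then have "AE \<omega> in ?P. \<forall>g\<in>carrier \<Gamma>. g \<noteq> \<one> \<longrightarrow> \<alpha> g \<omega> \<noteq> \<omega>"
      by (rule AE_ball_countable[OF G(2), THEN iffD2])
    then show "free_pmp_action \<Gamma> ?P \<alpha>"
      unfolding free_pmp_action_def using act meas dist by blast
    interpret A: pmp_action \<Gamma> ?P \<alpha> by (rule pmp)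
    fix \<gamma> assume \<gamma>: "\<gamma> \<in> carrier \<Gamma>" "group.ord \<Gamma> \<gamma> = 0"
    show "A.ergodic_element \<gamma>"
      unfolding A.ergodic_element_def
    proof (intro ballI impI)
      fix A assume A: "A \<in> sets ?P" and inv: "AE x in ?P. \<alpha> \<gamma> x \<in> A \<longleftrightarrow> x \<in> A"
      have pow: "AE x in ?P. \<alpha> (\<gamma> [^] (k::nat)) x \<in> A \<longleftrightarrow> x \<in> A" for k
      proof (induction k)
        case (Suc k)
        show ?case
          using A.AE_act[OF \<gamma>(1) Suc] inv
        proof eventually_elim
          case (elim x)
          then show ?case using \<gamma>(1) \<alpha>_mult[of "\<gamma> [^] k" \<gamma> x] by simp
        qed
      qed (simp add: \<alpha>_one)
      show "measure ?P A = 0 \<or> measure ?P A = 1"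
      proof (rule bernoulli.displaced_invariant_trivial[OF A])
        fix J :: "nat set" assume J: "finite J"
        define bad where "bad = (\<lambda>(i, j). {k::nat. \<sigma> (\<gamma> [^] k) i = j})"
        have "finite (bad (i, j))" for i j
        proof (rule finite_subset)
          have "k = l" if "k \<in> bad (i, j)" "l \<in> bad (i, j)" for k l
          proof -
            have "e (\<sigma> (\<gamma> [^] k) i) = e (\<sigma> (\<gamma> [^] l) i)" using that by (simp add: bad_def)
            then have "inv (\<gamma> [^] k) \<otimes> e i = inv (\<gamma> [^] l) \<otimes> e i"
              using \<gamma>(1) by (simp add: \<sigma>_def)
            then have "inv (\<gamma> [^] k) = inv (\<gamma> [^] l)" 
              by (rule G.right_cancel[THEN iffD1, rotated -1]) (use \<gamma>(1) in auto)
            then have "inv (inv (\<gamma> [^] k)) = inv (inv (\<gamma> [^] l))" by simp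
            then have "\<gamma> [^] k = \<gamma> [^] l" using \<gamma>(1) by simp
            then have "\<gamma> [^] int k = \<gamma> [^] int l" by (simp add: int_pow_int)
            then show "k = l" using \<gamma> by (simp add: G.int_pow_eq)
          qed
          then show "bad (i, j) \<subseteq> {SOME k. k \<in> bad (i, j)}"
            using someI[of "\<lambda>k. k \<in> bad (i, j)"] by blast
        qed simp
        then have "finite (\<Union>p\<in>J \<times> J. bad p)" using J by auto
        then obtain k where k: "k \<notin> (\<Union>p\<in>J \<times> J. bad p)" using ex_new_if_finite infinite_UNIV_nat by blast
        have kc: "\<gamma> [^] k \<in> carrier \<Gamma>" using \<gamma>(1) by simp
        show "\<exists>\<tau>. inj \<tau> \<and> \<tau> ` J \<inter> J = {} \<and> (AE \<omega> in ?P. (\<lambda>n. \<omega> (\<tau> n)) \<in> A \<longleftrightarrow> \<omega> \<in> A)"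
        proof (intro exI conjI)
          show "inj (\<sigma> (\<gamma> [^] k))" by (rule inj[OF kc])
          show "\<sigma> (\<gamma> [^] k) ` J \<inter> J = {}" using k unfolding bad_def by blast
          have "(\<lambda>n. \<omega> (\<sigma> (\<gamma> [^] k) n)) = \<alpha> (\<gamma> [^] k) \<omega>" for \<omega>
            by (rule ext) (simp only: \<alpha>_def)
          then show "AE \<omega> in ?P. (\<lambda>n. \<omega> (\<sigma> (\<gamma> [^] k) n)) \<in> A \<longleftrightarrow> \<omega> \<in> A"
            using pow[of k] by (simp only:)
        qed
      qed
    qed
  qed
qed

section \<open>Percolation on the Cayley graph\<close>

text \<open>Being joined by a path is a countable union over the possible finite paths.\<close>

lemma random_relation_closure_measurable:
  fixes S :: "'x \<Rightarrow> ('g \<times> 'g) set"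
  assumes C: "countable C" and sub: "\<And>x. S x \<subseteq> C \<times> C"
    and meas: "\<And>g h. \<lbrakk>g \<in> C; h \<in> C\<rbrakk> \<Longrightarrow> {x\<in>space M. (g, h) \<in> S x} \<in> sets M"
    and gh: "g \<in> C" "h \<in> C"
  shows "{x\<in>space M. (g, h) \<in> (S x)\<^sup>*} \<in> sets M"
proof -
  have pow: "{x\<in>space M. (g, h) \<in> S x ^^ n} \<in> sets M" if "h \<in> C" for n h
    using that
  proof (induction n arbitrary: h)
    case (Suc n)
    have "{x\<in>space M. (g, h) \<in> S x ^^ Suc n} = (\<Union>k\<in>C. {x\<in>space M. (g, k) \<in> S x ^^ n} \<inter> {x\<in>space M. (k, h) \<in> S x})"
      using sub by auto
    also have "\<dots> \<in> sets M"
      using Suc meas by (intro sets.countable_UN' C) auto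
    finally show ?case .
  qed (cases "g = h", auto)
  have "{x\<in>space M. (g, h) \<in> (S x)\<^sup>*} = (\<Union>n. {x\<in>space M. (g, h) \<in> S x ^^ n})"
    by (auto simp: rtrancl_is_UN_relpow)
  also have "\<dots> \<in> sets M" using pow[OF gh(2)] by (intro sets.countable_UN) auto
  finally show ?thesis .
qed

text \<open>
  Edges of the Cayley graph seen from \<open>x\<close>: all edges for generators other than \<open>c\<close>, and those edges
  \<open>(g, cg)\<close> for which \<open>gx\<close> lies in \<open>A\<close>.
\<close>

definition percolation_edges ::
  "('g, 'b) monoid_scheme \<Rightarrow> ('g \<Rightarrow> 'x \<Rightarrow> 'x) \<Rightarrow> 'g set \<Rightarrow> 'g \<Rightarrow> 'x set \<Rightarrow> 'x \<Rightarrow> ('g \<times> 'g) set" where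
  "percolation_edges \<Gamma> \<alpha> Q c A x =
     {(g, q \<otimes>\<^bsub>\<Gamma>\<^esub> g) | g q. g \<in> carrier \<Gamma> \<and> q \<in> Q \<and> (q \<noteq> c \<or> \<alpha> g x \<in> A)}"

definition clusters ::
  "('g, 'b) monoid_scheme \<Rightarrow> ('g \<Rightarrow> 'x \<Rightarrow> 'x) \<Rightarrow> 'g set \<Rightarrow> 'g \<Rightarrow> 'x set \<Rightarrow> 'x \<Rightarrow> ('g \<times> 'g) set" where
  "clusters \<Gamma> \<alpha> Q c A x =
     (percolation_edges \<Gamma> \<alpha> Q c A x \<union> (percolation_edges \<Gamma> \<alpha> Q c A x)\<inverse>)\<^sup>* \<inter> carrier \<Gamma> \<times> carrier \<Gamma>"

lemma clusters_mono:
  assumes "A \<subseteq> A'" shows "clusters \<Gamma> \<alpha> Q c A x \<subseteq> clusters \<Gamma> \<alpha> Q c A' x"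
proof -
  have "percolation_edges \<Gamma> \<alpha> Q c A x \<subseteq> percolation_edges \<Gamma> \<alpha> Q c A' x"
    using assms unfolding percolation_edges_def by blast
  then show ?thesis unfolding clusters_def by (intro Int_mono rtrancl_mono Un_mono converse_mono[THEN iffD2]) auto
qed

context pmp_action begin

lemma percolation_edges_sub:
  "Q \<subseteq> carrier \<Gamma> \<Longrightarrow> percolation_edges \<Gamma> \<alpha> Q c A x \<subseteq> carrier \<Gamma> \<times> carrier \<Gamma>"
  by (auto simp: percolation_edges_def)

lemma percolation_edges_shift:
  assumes "Q \<subseteq> carrier \<Gamma>" "k \<in> carrier \<Gamma>" "x \<in> space M" "(g, h) \<in> percolation_edges \<Gamma> \<alpha> Q c A (\<alpha> k x)"
  shows "(g \<otimes> k, h \<otimes> k) \<in> percolation_edges \<Gamma> \<alpha> Q c A x"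
proof -
  obtain q where q: "g \<in> carrier \<Gamma>" "q \<in> Q" "h = q \<otimes> g" "q \<noteq> c \<or> \<alpha> g (\<alpha> k x) \<in> A"
    using assms(4) by (auto simp: percolation_edges_def)
  have "h \<otimes> k = q \<otimes> (g \<otimes> k)" using q assms by (auto intro: grp.m_assoc)
  moreover have "q \<noteq> c \<or> \<alpha> (g \<otimes> k) x \<in> A" using q assms by (simp add: act_mult)
  ultimately show ?thesis
    unfolding percolation_edges_def using q(1,2) grp.m_closed[OF q(1) assms(2)] by blast
qed

lemma clusters_shift:
  assumes Q: "Q \<subseteq> carrier \<Gamma>" and k: "k \<in> carrier \<Gamma>" and x: "x \<in> space M"
    and gh: "(g, h) \<in> clusters \<Gamma> \<alpha> Q c A (\<alpha> k x)"
  shows "(g \<otimes> k, h \<otimes> k) \<in> clusters \<Gamma> \<alpha> Q c A x"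
proof -
  let ?S = "\<lambda>x. percolation_edges \<Gamma> \<alpha> Q c A x \<union> (percolation_edges \<Gamma> \<alpha> Q c A x)\<inverse>"
  have "(g, h) \<in> (?S (\<alpha> k x))\<^sup>*" and c: "g \<in> carrier \<Gamma>" "h \<in> carrier \<Gamma>" using gh by (auto simp: clusters_def)
  from this(1) have "(g \<otimes> k, h \<otimes> k) \<in> (?S x)\<^sup>*"
  proof (induction rule: rtrancl_induct)
    case (step y z)
    then have "(y \<otimes> k, z \<otimes> k) \<in> ?S x" using percolation_edges_shift[OF Q k x] by blast
    with step(3) show ?case by (rule rtrancl.rtrancl_into_rtrancl)
  qed simp
  with c k show ?thesis by (simp add: clusters_def)
qed

lemma random_equivalence_clusters:
  assumes Q: "Q \<subseteq> carrier \<Gamma>" and A: "A \<in> sets M"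
  shows "random_equivalence \<Gamma> M \<alpha> (clusters \<Gamma> \<alpha> Q c A)"
proof unfold_locales
  let ?S = "\<lambda>x. percolation_edges \<Gamma> \<alpha> Q c A x \<union> (percolation_edges \<Gamma> \<alpha> Q c A x)\<inverse>"
  fix x assume x: "x \<in> space M"
  have "sym (clusters \<Gamma> \<alpha> Q c A x)"
    unfolding clusters_def by (intro sym_Int sym_rtrancl sym_Un_converse) (auto simp: sym_def)
  moreover have "trans (clusters \<Gamma> \<alpha> Q c A x)"
    unfolding clusters_def by (intro trans_Int trans_rtrancl) (auto simp: trans_def)
  ultimately show "equiv (carrier \<Gamma>) (clusters \<Gamma> \<alpha> Q c A x)"
    by (auto simp: equiv_def refl_on_def clusters_def)
next
  let ?S = "\<lambda>x. percolation_edges \<Gamma> \<alpha> Q c A x \<union> (percolation_edges \<Gamma> \<alpha> Q c A x)\<inverse>"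
  fix g h assume g: "g \<in> carrier \<Gamma>" and h: "h \<in> carrier \<Gamma>"
  have pre: "{x\<in>space M. \<alpha> g x \<in> A} \<in> sets M" if "g \<in> carrier \<Gamma>" for g
    using measurable_sets[OF act_meas[OF that] A] by (simp add: vimage_def Collect_conj_eq Int_commute)
  have e: "{x\<in>space M. (g, h) \<in> percolation_edges \<Gamma> \<alpha> Q c A x} \<in> sets M" if "g \<in> carrier \<Gamma>" for g h
  proof -
    have "{x\<in>space M. (g, h) \<in> percolation_edges \<Gamma> \<alpha> Q c A x} =
        (if \<exists>q\<in>Q. q \<noteq> c \<and> h = q \<otimes> g then space M
         else if c \<in> Q \<and> h = c \<otimes> g then {x\<in>space M. \<alpha> g x \<in> A} else {})"
      using that by (auto simp: percolation_edges_def)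
    then show ?thesis using pre[OF that] by simp
  qed
  have "{x\<in>space M. (g, h) \<in> (?S x)\<^sup>*} \<in> sets M"
  proof (rule random_relation_closure_measurable[OF count _ _ g h])
    show "?S x \<subseteq> carrier \<Gamma> \<times> carrier \<Gamma>" for x using percolation_edges_sub[OF Q] by blast
    fix g h assume "g \<in> carrier \<Gamma>" "h \<in> carrier \<Gamma>"
    then have "{x\<in>space M. (g, h) \<in> percolation_edges \<Gamma> \<alpha> Q c A x} \<union> {x\<in>space M. (h, g) \<in> percolation_edges \<Gamma> \<alpha> Q c A x} \<in> sets M"
      by (intro sets.Un e)
    moreover have "{x\<in>space M. (g, h) \<in> ?S x} = {x\<in>space M. (g, h) \<in> percolation_edges \<Gamma> \<alpha> Q c A x} \<union> {x\<in>space M. (h, g) \<in> percolation_edges \<Gamma> \<alpha> Q c A x}"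
      by auto
    ultimately show "{x\<in>space M. (g, h) \<in> ?S x} \<in> sets M" by simp
  qed
  then show "{x\<in>space M. (g, h) \<in> clusters \<Gamma> \<alpha> Q c A x} \<in> sets M"
    using g h by (simp add: clusters_def)
next
  fix k g h x assume k: "k \<in> carrier \<Gamma>" and g: "g \<in> carrier \<Gamma>" and h: "h \<in> carrier \<Gamma>" and x: "x \<in> space M"
  show "(g, h) \<in> clusters \<Gamma> \<alpha> Q c A (\<alpha> k x) \<longleftrightarrow> (g \<otimes> k, h \<otimes> k) \<in> clusters \<Gamma> \<alpha> Q c A x"
  proof
    assume "(g \<otimes> k, h \<otimes> k) \<in> clusters \<Gamma> \<alpha> Q c A x"
    then have "(g \<otimes> k, h \<otimes> k) \<in> clusters \<Gamma> \<alpha> Q c A (\<alpha> (inv k) (\<alpha> k x))"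
      using k x by (simp only: act_inv)
    then have "(g \<otimes> k \<otimes> inv k, h \<otimes> k \<otimes> inv k) \<in> clusters \<Gamma> \<alpha> Q c A (\<alpha> k x)"
      by (rule clusters_shift[OF Q grp.inv_closed[OF k] act_closed[OF k x]])
    then show "(g, h) \<in> clusters \<Gamma> \<alpha> Q c A (\<alpha> k x)" using k g h by (simp add: grp.m_assoc)
  qed (rule clusters_shift[OF Q k x])
qed

lemma clusters_edge:
  assumes "Q \<subseteq> carrier \<Gamma>" "g \<in> carrier \<Gamma>" "q \<in> Q" "q \<noteq> c \<or> \<alpha> g x \<in> A"
  shows "(g, q \<otimes> g) \<in> clusters \<Gamma> \<alpha> Q c A x"
proof -
  have "(g, q \<otimes> g) \<in> percolation_edges \<Gamma> \<alpha> Q c A x"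
    using assms by (auto simp: percolation_edges_def)
  then show ?thesis using assms by (auto simp: clusters_def)
qed

text \<open>
  The first element of a class of \<open>R'\<close> is also the first of its smaller class for \<open>R\<close>. Of the two first
  elements of the classes of \<open>g\<close> and \<open>h\<close> for \<open>R\<close>, at most one survives the merging.
\<close>

lemma coarsening_shrinks_transversal:
  assumes R: "random_equivalence \<Gamma> M \<alpha> R" and R': "random_equivalence \<Gamma> M \<alpha> R'" and x: "x \<in> space M"
    and sub: "R x \<subseteq> R' x" and gh: "g \<in> carrier \<Gamma>" "h \<in> carrier \<Gamma>" "(g, h) \<in> R' x" "(g, h) \<notin> R x"
  shows "random_equivalence.transversal \<Gamma> R' x \<subset> random_equivalence.transversal \<Gamma> R x"
proof -
  interpret R: random_equivalence \<Gamma> M \<alpha> R by fact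
  interpret R': random_equivalence \<Gamma> M \<alpha> R' by fact
  have "R'.transversal x \<subseteq> R.transversal x"
  proof
    fix k assume k: "k \<in> R'.transversal x"
    then have kc: "k \<in> carrier \<Gamma>" "R'.class_rep x k = k" by (auto simp: R'.transversal_def)
    let ?l = "R.class_rep x k"
    have l: "?l \<in> carrier \<Gamma>" "(k, ?l) \<in> R x" using R.class_rep_closed R.class_rep_R x kc by auto
    have "to_nat_on (carrier \<Gamma>) k \<le> to_nat_on (carrier \<Gamma>) ?l"
      using R'.class_rep_least[of ?l k x] l sub kc by auto
    moreover have "to_nat_on (carrier \<Gamma>) ?l \<le> to_nat_on (carrier \<Gamma>) k"
      using R.class_rep_least[of k k x] R.R_refl[OF x kc(1)] kc by auto
    ultimately have "?l = k" using inj_on_to_nat_on[OF count] l kc by (auto dest: inj_onD)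
    then show "k \<in> R.transversal x" using kc by (simp add: R.transversal_def)
  qed
  moreover have "R'.transversal x \<noteq> R.transversal x"
  proof
    assume eq: "R'.transversal x = R.transversal x"
    let ?g = "R.class_rep x g" and ?h = "R.class_rep x h"
    have "?g \<in> R'.transversal x" "?h \<in> R'.transversal x" using R.class_rep_transversal[OF x] gh eq by auto
    then have "R'.class_rep x ?g = ?g" "R'.class_rep x ?h = ?h" by (auto simp: R'.transversal_def)
    moreover have "R'.class_rep x ?g = R'.class_rep x g" "R'.class_rep x ?h = R'.class_rep x h"
      using R.class_rep_R[OF x] gh sub R'.class_rep_eqI[OF x] by (metis subsetD)+
    moreover have "R'.class_rep x g = R'.class_rep x h" using R'.class_rep_eqI[OF x gh(3)] .
    ultimately have "?g = ?h" by simp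
    then show False using R.class_rep_eq_iff[OF x gh(1,2)] gh(4) by simp
  qed
  ultimately show ?thesis by blast
qed

text \<open>
  Among the admissible sets \<open>A\<close>, all of which give an almost surely constant finite number of clusters, one
  with the least number is already connected. Otherwise the edge from \<open>\<one>\<close> to \<open>c\<close> would join different
  clusters on a set of positive measure, and adding a small part \<open>B\<close> of that set to \<open>A\<close> would lower the
  number of clusters over \<open>B\<close>.
\<close>

lemma connected_percolation:
  assumes kp: "kazhdan_pair \<Gamma> Q \<epsilon>" and inf: "infinite (carrier \<Gamma>)"
    and \<gamma>: "\<gamma> \<in> Q" "ergodic_element \<gamma>" and c: "c \<in> Q" "c \<noteq> \<gamma>"
    and divisible: "\<And>D r. \<lbrakk>D \<in> sets M; 0 \<le> r; r \<le> prob D\<rbrakk> \<Longrightarrow> \<exists>B\<in>sets M. B \<subseteq> D \<and> prob B = r"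
    and \<delta>: "\<delta> > 0"
  obtains A where "A \<in> sets M" "prob A < 1 - \<epsilon>\<^sup>2 / 2 + \<delta>"
    "AE x in M. \<forall>g\<in>carrier \<Gamma>. (\<one>, g) \<in> clusters \<Gamma> \<alpha> Q c A x"
proof -
  have Q: "Q \<subseteq> carrier \<Gamma>" and epos: "\<epsilon> > 0" and gen: "generate \<Gamma> Q = carrier \<Gamma>"
    using kp by (auto simp: kazhdan_pair_def)
  have \<gamma>c: "\<gamma> \<in> carrier \<Gamma>" and cc: "c \<in> carrier \<Gamma>" using \<gamma> c Q by auto
  have e2: "\<epsilon>\<^sup>2 \<le> 2" by (rule kazhdan_pair_square_le_2[OF grp.is_group count inf kp])
  define R where "R A = clusters \<Gamma> \<alpha> Q c A" for A
  define T where "T A = random_equivalence.transversal \<Gamma> (R A)" for A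
  define good where "good A \<longleftrightarrow> A \<in> sets M \<and> 1 - \<epsilon>\<^sup>2 / 2 < prob A \<and> prob A < 1 - \<epsilon>\<^sup>2 / 2 + \<delta>" for A
  have RE: "random_equivalence \<Gamma> M \<alpha> (R A)" if "good A" for A
    unfolding R_def using that by (intro random_equivalence_clusters Q) (simp add: good_def)
  have const: "\<exists>n. AE x in M. finite (T A x) \<and> card (T A x) = n" if A: "good A" for A
  proof -
    interpret RA: random_equivalence \<Gamma> M \<alpha> "R A" by (rule RE[OF A])
    have As: "A \<in> sets M" and Ap: "1 - \<epsilon>\<^sup>2 / 2 < prob A" using A by (auto simp: good_def)
    have "AE x in M. finite (RA.transversal x)"
    proof (rule RA.finitely_many_classes[OF kp _ \<gamma>c \<gamma>(2)])
      fix q assume q: "q \<in> Q"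
      have qc: "q \<in> carrier \<Gamma>" using q Q by auto
      have "A \<subseteq> {x\<in>space M. (\<one>, q) \<in> R A x}"
      proof
        fix x assume x: "x \<in> A"
        then have xs: "x \<in> space M" using sets.sets_into_space[OF As] by auto
        have "(\<one>, q \<otimes> \<one>) \<in> clusters \<Gamma> \<alpha> Q c A x"
          by (rule clusters_edge[OF Q grp.one_closed q]) (use x xs in simp)
        then show "x \<in> {x\<in>space M. (\<one>, q) \<in> R A x}" using xs qc by (simp add: R_def)
      qed
      then have "prob A \<le> prob {x\<in>space M. (\<one>, q) \<in> R A x}"
        by (intro finite_measure_mono RA.measR qc grp.one_closed)
      then show "1 - \<epsilon>\<^sup>2 / 2 < prob {x\<in>space M. (\<one>, q) \<in> R A x}" using Ap by simp
    next
      show "AE x in M. (\<one>, \<gamma>) \<in> R A x"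
      proof (rule AE_I2)
        fix x
        have "(\<one>, \<gamma> \<otimes> \<one>) \<in> clusters \<Gamma> \<alpha> Q c A x"
          by (rule clusters_edge[OF Q grp.one_closed \<gamma>(1)]) (use c in simp)
        then show "(\<one>, \<gamma>) \<in> R A x" using \<gamma>c by (simp add: R_def)
      qed
    qed
    from RA.card_classes_constant[OF this \<gamma>c \<gamma>(2)] show ?thesis unfolding T_def by blast
  qed
  define P where "P n \<longleftrightarrow> (\<exists>A. good A \<and> (AE x in M. finite (T A x) \<and> card (T A x) = n))" for n
  have "\<exists>A. good A"
  proof -
    \<comment> \<open>Strictly between the two bounds and, as \<open>\<epsilon>\<^sup>2 \<le> 2\<close>, a possible measure of a set.\<close>
    let ?r = "1 - \<epsilon>\<^sup>2 / 2 + min \<delta> (\<epsilon>\<^sup>2 / 2) / 2"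
    have m: "0 < min \<delta> (\<epsilon>\<^sup>2 / 2)" using \<delta> epos by simp
    have "min \<delta> (\<epsilon>\<^sup>2 / 2) \<le> \<delta>" "min \<delta> (\<epsilon>\<^sup>2 / 2) \<le> \<epsilon>\<^sup>2 / 2" by auto
    then have r: "0 \<le> ?r" "?r \<le> 1" "1 - \<epsilon>\<^sup>2 / 2 < ?r" "?r < 1 - \<epsilon>\<^sup>2 / 2 + \<delta>" using m e2 by linarith+
    then obtain A where "A \<in> sets M" "prob A = ?r" using divisible[of "space M" ?r] by (auto simp: prob_space)
    then show ?thesis using r unfolding good_def by auto
  qed
  then have "\<exists>n. P n" using const unfolding P_def by blast
  then have "P (LEAST n. P n)" by (rule LeastI_ex)
  then obtain A where A: "good A" "AE x in M. finite (T A x) \<and> card (T A x) = (LEAST n. P n)"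
    unfolding P_def by blast
  interpret RA: random_equivalence \<Gamma> M \<alpha> "R A" by (rule RE[OF A(1)])
  let ?D = "{x\<in>space M. (\<one>, c) \<in> R A x}"
  have D: "?D \<in> sets M" using cc by (intro RA.measR) auto
  have "prob ?D = 1"
  proof (rule ccontr)
    assume "prob ?D \<noteq> 1"
    then have "prob ?D < 1" using prob_le_1[of ?D] by (rule order_le_neq_trans[rotated])
    then have pos: "prob (space M - ?D) > 0" using prob_compl[OF D] by simp
    define r where "r = min (prob (space M - ?D)) ((1 - \<epsilon>\<^sup>2 / 2 + \<delta> - prob A) / 2)"
    have r: "0 < r" "r \<le> prob (space M - ?D)" "prob A + r < 1 - \<epsilon>\<^sup>2 / 2 + \<delta>"
      using pos A(1) unfolding r_def good_def by (auto simp: min_def field_simps)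
    obtain B where B: "B \<in> sets M" "B \<subseteq> space M - ?D" "prob B = r"
      using divisible[of "space M - ?D" r] r D by auto
    have As: "A \<in> sets M" using A(1) by (simp add: good_def)
    have good': "good (A \<union> B)"
      unfolding good_def
    proof (intro conjI)
      show "prob (A \<union> B) < 1 - \<epsilon>\<^sup>2 / 2 + \<delta>" using measure_Un_le[OF As B(1)] r B(3) by linarith
      have "prob A \<le> prob (A \<union> B)" using As B(1) by (intro finite_measure_mono) auto
      then show "1 - \<epsilon>\<^sup>2 / 2 < prob (A \<union> B)" using A(1) by (simp add: good_def)
    qed (use As B in auto)
    obtain n where n: "AE x in M. finite (T (A \<union> B) x) \<and> card (T (A \<union> B) x) = n" using const[OF good'] by blast
    have "P n" unfolding P_def using good' n by blast
    then have le: "(LEAST n. P n) \<le> n" by (rule Least_le)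
    have "\<not> (AE x in M. x \<notin> B)" using prob_eq_0[OF B(1)] B(3) r(1) by simp
    then obtain x where x: "x \<in> space M" "x \<in> B" "finite (T A x)" "card (T A x) = (LEAST n. P n)" "card (T (A \<union> B) x) = n"
    proof -
      have "AE x in M. x \<notin> B" if "\<not> (\<exists>x. x \<in> space M \<and> x \<in> B \<and> finite (T A x) \<and> card (T A x) = (LEAST n. P n) \<and> card (T (A \<union> B) x) = n)"
        using A(2) n AE_space by eventually_elim (use that in blast)
      then show thesis using that \<open>\<not> (AE x in M. x \<notin> B)\<close> by blast
    qed
    have "T (A \<union> B) x \<subset> T A x"
      unfolding T_def
    proof (rule coarsening_shrinks_transversal[OF RE[OF A(1)] RE[OF good'] x(1)])
      show "R A x \<subseteq> R (A \<union> B) x" unfolding R_def by (rule clusters_mono) auto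
      show "(\<one>, c) \<in> R (A \<union> B) x"
        using clusters_edge[OF Q grp.one_closed c(1), of c x "A \<union> B"] x cc by (simp add: R_def)
      show "(\<one>, c) \<notin> R A x" using B(2) x by auto
    qed (use cc in auto)
    then have "card (T (A \<union> B) x) < card (T A x)" by (rule psubset_card_mono[OF x(3)])
    then show False using x le by simp
  qed
  then have "AE x in M. x \<in> ?D" by (subst (asm) prob_eq_1[OF D])
  then have "AE x in M. \<forall>g\<in>carrier \<Gamma>. \<alpha> g x \<in> ?D"
    using AE_act by (simp only: AE_ball_countable[OF count]) blast
  then have "AE x in M. \<forall>g\<in>carrier \<Gamma>. (\<one>, g) \<in> R A x"
    using AE_space
  proof eventually_elim
    case (elim x)
    have edge: "(g, q \<otimes> g) \<in> R A x" if g: "g \<in> carrier \<Gamma>" and q: "q \<in> Q" for g q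
    proof (cases "q = c")
      case True
      have "(\<one>, c) \<in> R A (\<alpha> g x)" using elim g by auto
      then show ?thesis using RA.equivariant[OF g grp.one_closed cc elim(2)] g cc True by simp
    next
      case False
      then show ?thesis unfolding R_def using g q by (intro clusters_edge Q) auto
    qed
    have "(h, g \<otimes> h) \<in> R A x" if "g \<in> generate \<Gamma> Q" "h \<in> carrier \<Gamma>" for g h
      using that
    proof (induction arbitrary: h rule: generate.induct)
      case one
      then show ?case using RA.R_refl[OF elim(2)] by simp
    next
      case (incl q)
      then show ?case using edge by simp
    next
      case (inv q)
      then have qc: "q \<in> carrier \<Gamma>" using Q by auto
      have "(inv q \<otimes> h, q \<otimes> (inv q \<otimes> h)) \<in> R A x" using inv qc by (intro edge) auto
      then have "(inv q \<otimes> h, h) \<in> R A x" using inv qc by (simp add: grp.m_assoc[symmetric])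
      then show ?case by (rule RA.R_sym[OF elim(2)])
    next
      case (eng g1 g2)
      have gc: "g1 \<in> carrier \<Gamma>" "g2 \<in> carrier \<Gamma>" using eng(1,2) grp.generate_in_carrier[OF Q] by auto
      have "(h, g2 \<otimes> h) \<in> R A x" using eng by blast
      moreover have "(g2 \<otimes> h, g1 \<otimes> (g2 \<otimes> h)) \<in> R A x" using eng gc by (intro eng.IH) auto
      ultimately have "(h, g1 \<otimes> (g2 \<otimes> h)) \<in> R A x" by (rule RA.R_trans[OF elim(2)])
      then show ?case using gc eng(5) by (simp add: grp.m_assoc)
    qed
    then have "(\<one>, g \<otimes> \<one>) \<in> R A x" if "g \<in> carrier \<Gamma>" for g
      using that gen grp.one_closed by blast
    then show ?case by simp
  qed
  then show thesis using that[of A] A(1) unfolding good_def R_def by blast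
qed

definition percolation_graph :: "'g set \<Rightarrow> 'g \<Rightarrow> 'x set \<Rightarrow> ('x \<times> 'x) set" where
  "percolation_graph Q c A = {(x, y). x \<in> space M \<and> y \<in> space M \<and> x \<noteq> y \<and>
     (\<exists>q\<in>Q. (\<alpha> q x = y \<and> (q \<noteq> c \<or> x \<in> A)) \<or> (\<alpha> q y = x \<and> (q \<noteq> c \<or> y \<in> A)))}"

lemma percolation_graph_borel:
  assumes Q: "finite Q" "Q \<subseteq> carrier \<Gamma>" and A [measurable]: "A \<in> sets M"
    and diag: "{p\<in>space (M \<Otimes>\<^sub>M M). fst p = snd p} \<in> sets (M \<Otimes>\<^sub>M M)"
  shows "borel_graph M (percolation_graph Q c A)"
proof -
  let ?MM = "M \<Otimes>\<^sub>M M"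
  have eq: "{p\<in>space ?MM. f p = g p} \<in> sets ?MM" if f: "f \<in> measurable ?MM M" and g: "g \<in> measurable ?MM M" for f g
  proof -
    have "(\<lambda>p. (f p, g p)) \<in> measurable ?MM ?MM" using f g by (rule measurable_Pair)
    then have "(\<lambda>p. (f p, g p)) -` {p\<in>space ?MM. fst p = snd p} \<inter> space ?MM \<in> sets ?MM"
      using diag by (rule measurable_sets)
    also have "(\<lambda>p. (f p, g p)) -` {p\<in>space ?MM. fst p = snd p} \<inter> space ?MM = {p\<in>space ?MM. f p = g p}"
    proof (intro subset_antisym subsetI)
      fix p assume "p \<in> {p\<in>space ?MM. f p = g p}"
      then have "p \<in> space ?MM" "f p = g p" "f p \<in> space M" "g p \<in> space M"
        using measurable_space[OF f] measurable_space[OF g] by auto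
      then show "p \<in> (\<lambda>p. (f p, g p)) -` {p\<in>space ?MM. fst p = snd p} \<inter> space ?MM"
        by (simp add: space_pair_measure)
    qed auto
    finally show ?thesis .
  qed
  have [measurable]: "\<alpha> q \<in> measurable M M" if "q \<in> Q" for q using act_meas that Q by blast
  have m1: "{p\<in>space ?MM. \<alpha> q (fst p) = snd p} \<in> sets ?MM" if "q \<in> Q" for q
    using that by (intro eq) measurable
  have m2: "{p\<in>space ?MM. \<alpha> q (snd p) = fst p} \<in> sets ?MM" if "q \<in> Q" for q
    using that by (intro eq) measurable
  have m3: "{p\<in>space ?MM. q \<noteq> c \<or> fst p \<in> A} \<in> sets ?MM" "{p\<in>space ?MM. q \<noteq> c \<or> snd p \<in> A} \<in> sets ?MM" for q
    by measurable
  have "percolation_graph Q c A =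
      (\<Union>q\<in>Q. ({p\<in>space ?MM. \<alpha> q (fst p) = snd p} \<inter> {p\<in>space ?MM. q \<noteq> c \<or> fst p \<in> A})
        \<union> ({p\<in>space ?MM. \<alpha> q (snd p) = fst p} \<inter> {p\<in>space ?MM. q \<noteq> c \<or> snd p \<in> A}))
      - {p\<in>space ?MM. fst p = snd p}"
    unfolding percolation_graph_def space_pair_measure by auto
  also have "\<dots> \<in> sets ?MM"
    by (intro sets.Diff diag sets.finite_UN Q(1) sets.Un sets.Int m1 m2 m3)
  finally have "percolation_graph Q c A \<in> sets ?MM" .
  moreover have "sym (percolation_graph Q c A)" unfolding percolation_graph_def sym_def by blast
  moreover have "irrefl (percolation_graph Q c A)" unfolding percolation_graph_def irrefl_def by blast
  ultimately show ?thesis by (simp add: borel_graph_def)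
qed

lemma percolation_graph_component:
  assumes Q: "Q \<subseteq> carrier \<Gamma>" and x: "x \<in> space M"
    and conn: "\<And>g. g \<in> carrier \<Gamma> \<Longrightarrow> (\<one>, g) \<in> clusters \<Gamma> \<alpha> Q c A x"
  shows "(percolation_graph Q c A)\<^sup>* `` {x} = orbit_relation \<Gamma> M \<alpha> `` {x}"
proof -
  let ?G = "percolation_graph Q c A"
  let ?S = "percolation_edges \<Gamma> \<alpha> Q c A x"
  have orb: "orbit_relation \<Gamma> M \<alpha> `` {x} = {\<alpha> g x | g. g \<in> carrier \<Gamma>}"
    using x by (auto simp: orbit_relation_def orbit_def)
  have 1: "\<exists>g\<in>carrier \<Gamma>. y = \<alpha> g x" if "(x, y) \<in> ?G\<^sup>*" for y
    using that
  proof (induction rule: rtrancl_induct)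
    case base
    then show ?case using x grp.one_closed by force
  next
    case (step y z)
    then obtain g where g: "g \<in> carrier \<Gamma>" "y = \<alpha> g x" by blast
    obtain q where q: "q \<in> Q" "\<alpha> q y = z \<or> \<alpha> q z = y" and z: "z \<in> space M"
      using step(2) unfolding percolation_graph_def by blast
    have qc: "q \<in> carrier \<Gamma>" using q Q by auto
    from q(2) show ?case
    proof
      assume "\<alpha> q y = z"
      then have "z = \<alpha> (q \<otimes> g) x" using g qc x by (simp add: act_mult)
      then show ?thesis using g qc by blast
    next
      assume "\<alpha> q z = y"
      then have "\<alpha> (inv q) y = z" using act_inv(1)[OF qc z] by simp
      then have "z = \<alpha> (inv q \<otimes> g) x" using g qc x by (simp add: act_mult)
      then show ?thesis using g qc by blast
    qed
  qed
  have edge: "(\<alpha> g x, \<alpha> h x) \<in> ?G\<^sup>* \<and> (\<alpha> h x, \<alpha> g x) \<in> ?G\<^sup>*" if "(g, h) \<in> ?S" for g h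
  proof -
    obtain q where q: "g \<in> carrier \<Gamma>" "q \<in> Q" "h = q \<otimes> g" "q \<noteq> c \<or> \<alpha> g x \<in> A"
      using \<open>(g, h) \<in> ?S\<close> unfolding percolation_edges_def by blast
    have qc: "q \<in> carrier \<Gamma>" using q Q by auto
    have h: "\<alpha> q (\<alpha> g x) = \<alpha> h x" using q qc x by (simp add: act_mult)
    have s: "\<alpha> g x \<in> space M" "\<alpha> h x \<in> space M" using q qc x by auto
    show ?thesis
    proof (cases "\<alpha> g x = \<alpha> h x")
      case False
      then have "(\<alpha> g x, \<alpha> h x) \<in> ?G" "(\<alpha> h x, \<alpha> g x) \<in> ?G"
        using q h s unfolding percolation_graph_def by auto
      then show ?thesis by blast
    qed simp
  qed
  have "(\<alpha> \<one> x, \<alpha> g x) \<in> ?G\<^sup>*" if "(\<one>, g) \<in> (?S \<union> ?S\<inverse>)\<^sup>*" for g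
    using that
  proof (induction rule: rtrancl_induct)
    case (step y z)
    then have "(\<alpha> y x, \<alpha> z x) \<in> ?G\<^sup>*" using edge by blast
    with step(3) show ?case by (rule rtrancl_trans)
  qed simp
  then have "(x, \<alpha> g x) \<in> ?G\<^sup>*" if "g \<in> carrier \<Gamma>" for g
    using conn[OF that] x by (simp add: clusters_def)
  with 1 show ?thesis unfolding orb by blast
qed

text \<open>
  A generator \<open>q\<close> contributes at most the two neighbours \<open>qx\<close> and \<open>q\<^sup>-\<^sup>1 x\<close>; for \<open>q = c\<close> these
  count only if \<open>x\<close>, respectively \<open>c\<^sup>-\<^sup>1 x\<close>, lies in \<open>A\<close>, and both events have the measure of \<open>A\<close>.
\<close>

lemma percolation_graph_degree:
  assumes Q: "finite Q" "Q \<subseteq> carrier \<Gamma>" and c: "c \<in> Q" and A [measurable]: "A \<in> sets M"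
  shows "(\<integral>\<^sup>+x. graph_degree (percolation_graph Q c A) x \<partial>M) \<le> ennreal (2 * (real (card Q) - 1 + prob A))"
proof -
  define B where "B q = (if q = c then A else space M)" for q
  have Bm [measurable]: "B q \<in> sets M" for q by (simp add: B_def)
  have act [measurable]: "\<alpha> q \<in> measurable M M" "\<alpha> (inv q) \<in> measurable M M" if "q \<in> Q" for q
    using act_meas that Q by (auto intro!: act_meas)
  have "(\<integral>\<^sup>+x. graph_degree (percolation_graph Q c A) x \<partial>M)
      \<le> (\<integral>\<^sup>+x. (\<Sum>q\<in>Q. indicator (B q) x + indicator (B q) (\<alpha> (inv q) x)) \<partial>M)"
  proof (rule nn_integral_mono)
    fix x assume x: "x \<in> space M"
    let ?U = "count_space UNIV :: 'x measure"
    define N where "N q = {y. y = \<alpha> q x \<and> x \<in> B q} \<union> {y. y = \<alpha> (inv q) x \<and> \<alpha> (inv q) x \<in> B q}" for q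
    have "percolation_graph Q c A `` {x} \<subseteq> (\<Union>q\<in>Q. N q)"
    proof
      fix y assume "y \<in> percolation_graph Q c A `` {x}"
      then obtain q where y: "y \<in> space M" and q: "q \<in> Q"
        and disj: "\<alpha> q x = y \<and> (q \<noteq> c \<or> x \<in> A) \<or> \<alpha> q y = x \<and> (q \<noteq> c \<or> y \<in> A)"
        unfolding percolation_graph_def by blast
      have qc: "q \<in> carrier \<Gamma>" using q Q by auto
      from disj have "y \<in> N q"
      proof
        assume "\<alpha> q x = y \<and> (q \<noteq> c \<or> x \<in> A)"
        then show ?thesis using x by (auto simp: N_def B_def)
      next
        assume h: "\<alpha> q y = x \<and> (q \<noteq> c \<or> y \<in> A)"
        then have "\<alpha> (inv q) x = y" using act_inv(1)[OF qc y] by simp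
        then show ?thesis using h y by (auto simp: N_def B_def)
      qed
      then show "y \<in> (\<Union>q\<in>Q. N q)" using q by blast
    qed
    then have "graph_degree (percolation_graph Q c A) x \<le> emeasure ?U (\<Union>q\<in>Q. N q)"
      unfolding graph_degree_def by (rule emeasure_mono) simp
    also have "\<dots> \<le> (\<Sum>q\<in>Q. emeasure ?U (N q))"
      by (rule emeasure_subadditive_finite) (use Q in auto)
    also have "\<dots> \<le> (\<Sum>q\<in>Q. indicator (B q) x + indicator (B q) (\<alpha> (inv q) x))"
    proof (rule sum_mono)
      fix q
      have one: "emeasure ?U {y. y = z \<and> w \<in> B q} = indicator (B q) w" for z w :: 'x
        by (cases "w \<in> B q") auto
      have "emeasure ?U (N q) \<le> emeasure ?U {y. y = \<alpha> q x \<and> x \<in> B q}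
          + emeasure ?U {y. y = \<alpha> (inv q) x \<and> \<alpha> (inv q) x \<in> B q}"
        unfolding N_def by (rule emeasure_subadditive) auto
      then show "emeasure ?U (N q) \<le> indicator (B q) x + indicator (B q) (\<alpha> (inv q) x)"
        unfolding one .
    qed
    finally show "graph_degree (percolation_graph Q c A) x
      \<le> (\<Sum>q\<in>Q. indicator (B q) x + indicator (B q) (\<alpha> (inv q) x))" .
  qed
  also have "\<dots> = (\<Sum>q\<in>Q. \<integral>\<^sup>+x. indicator (B q) x + indicator (B q) (\<alpha> (inv q) x) \<partial>M)"
    by (rule nn_integral_sum) measurable
  also have "\<dots> = (\<Sum>q\<in>Q. ennreal (2 * prob (B q)))"
  proof (rule sum.cong[OF refl])
    fix q assume q: "q \<in> Q"
    then have qc: "inv q \<in> carrier \<Gamma>" using Q by auto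
    have "(\<integral>\<^sup>+x. indicator (B q) (\<alpha> (inv q) x) \<partial>M) = (\<integral>\<^sup>+x. indicator (B q) x \<partial>distr M M (\<alpha> (inv q)))"
      by (rule nn_integral_distr[OF act_meas[OF qc], symmetric]) simp
    then have "(\<integral>\<^sup>+x. indicator (B q) (\<alpha> (inv q) x) \<partial>M) = ennreal (prob (B q))"
      unfolding act_distr[OF qc] by (simp add: emeasure_eq_measure)
    moreover have "(\<integral>\<^sup>+x. indicator (B q) x + indicator (B q) (\<alpha> (inv q) x) \<partial>M)
        = (\<integral>\<^sup>+x. indicator (B q) x \<partial>M) + (\<integral>\<^sup>+x. indicator (B q) (\<alpha> (inv q) x) \<partial>M)"
      by (rule nn_integral_add) (use q in measurable)
    ultimately show "(\<integral>\<^sup>+x. indicator (B q) x + indicator (B q) (\<alpha> (inv q) x) \<partial>M) = ennreal (2 * prob (B q))"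
      by (simp add: emeasure_eq_measure ennreal_plus[symmetric] del: ennreal_plus)
  qed
  also have "\<dots> = ennreal (\<Sum>q\<in>Q. 2 * prob (B q))" by (rule sum_ennreal) simp
  also have "(\<Sum>q\<in>Q. 2 * prob (B q)) = 2 * (real (card Q) - 1 + prob A)"
  proof -
    have "(\<Sum>q\<in>Q. prob (B q)) = prob (B c) + (\<Sum>q\<in>Q - {c}. prob (B q))"
      by (rule sum.remove[OF Q(1) c])
    also have "(\<Sum>q\<in>Q - {c}. prob (B q)) = (\<Sum>q\<in>Q - {c}. 1)"
      by (rule sum.cong) (auto simp: B_def prob_space)
    also have "\<dots> = real (card Q) - 1"
      using c Q(1) card_gt_0_iff[of Q] by (auto simp: of_nat_diff Suc_leI)
    finally show ?thesis by (simp add: B_def sum_distrib_left[symmetric])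
  qed
  finally show ?thesis .
qed

lemma cost_orbit_relation_le:
  assumes kp: "kazhdan_pair \<Gamma> Q \<epsilon>" and inf: "infinite (carrier \<Gamma>)"
    and \<gamma>: "\<gamma> \<in> Q" "ergodic_element \<gamma>" and c: "c \<in> Q" "c \<noteq> \<gamma>"
    and divisible: "\<And>D r. \<lbrakk>D \<in> sets M; 0 \<le> r; r \<le> prob D\<rbrakk> \<Longrightarrow> \<exists>B\<in>sets M. B \<subseteq> D \<and> prob B = r"
    and diag: "{p\<in>space (M \<Otimes>\<^sub>M M). fst p = snd p} \<in> sets (M \<Otimes>\<^sub>M M)"
  shows "cost_rel M (orbit_relation \<Gamma> M \<alpha>) \<le> ennreal (real (card Q) - \<epsilon>\<^sup>2 / 2)"
proof (rule ennreal_le_epsilon)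
  fix \<delta> :: real assume \<delta>: "\<delta> > 0"
  have Q: "finite Q" "Q \<subseteq> carrier \<Gamma>" using kp by (auto simp: kazhdan_pair_def)
  have e2: "\<epsilon>\<^sup>2 \<le> 2" by (rule kazhdan_pair_square_le_2[OF grp.is_group count inf kp])
  have n: "1 \<le> real (card Q)" using \<gamma>(1) Q(1) card_gt_0_iff[of Q] by (auto simp: Suc_leI)
  obtain A where A: "A \<in> sets M" "prob A < 1 - \<epsilon>\<^sup>2 / 2 + \<delta>"
    "AE x in M. \<forall>g\<in>carrier \<Gamma>. (\<one>, g) \<in> clusters \<Gamma> \<alpha> Q c A x"
    using connected_percolation[OF kp inf \<gamma> c divisible \<delta>] by blast
  let ?G = "percolation_graph Q c A"
  have "AE x in M. ?G\<^sup>* `` {x} = orbit_relation \<Gamma> M \<alpha> `` {x}"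
    using A(3) AE_space by eventually_elim (rule percolation_graph_component[OF Q(2)], auto)
  then have "graphing M (orbit_relation \<Gamma> M \<alpha>) ?G"
    using percolation_graph_borel[OF Q A(1) diag] by (simp add: graphing_def)
  then have "cost_rel M (orbit_relation \<Gamma> M \<alpha>) \<le> (\<integral>\<^sup>+x. graph_degree ?G x \<partial>M) / 2"
    unfolding cost_rel_def by (intro INF_lower) simp
  also have "\<dots> \<le> ennreal (2 * (real (card Q) - 1 + prob A)) / 2"
    by (rule divide_right_mono_ennreal[OF percolation_graph_degree[OF Q c(1) A(1)]])
  also have "\<dots> = ennreal (2 * (real (card Q) - 1 + prob A) / 2)"
    using divide_ennreal[of "2 * (real (card Q) - 1 + prob A)" 2] n by simp
  also have "\<dots> \<le> ennreal ((real (card Q) - \<epsilon>\<^sup>2 / 2) + \<delta>)"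
    using A(2) by (intro ennreal_leI) simp
  also have "\<dots> = ennreal (real (card Q) - \<epsilon>\<^sup>2 / 2) + ennreal \<delta>"
    using e2 n \<delta> by (intro ennreal_plus) auto
  finally show "cost_rel M (orbit_relation \<Gamma> M \<alpha>) \<le> ennreal (real (card Q) - \<epsilon>\<^sup>2 / 2) + ennreal \<delta>" .
qed

end

section \<open>The cost of groups with property (T)\<close>

lemma group_cost_kazhdan_pair:
  fixes \<Gamma> :: "('g, 'b) monoid_scheme" (structure)
  assumes G: "group \<Gamma>" "countable (carrier \<Gamma>)" "infinite (carrier \<Gamma>)"
    and kp: "kazhdan_pair \<Gamma> Q \<epsilon>" and \<gamma>: "\<gamma> \<in> Q" "group.ord \<Gamma> \<gamma> = 0"
  shows "enn2ereal (group_cost \<Gamma>) \<le> ereal (real (card Q) - \<epsilon>\<^sup>2 / 2)"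
proof -
  have Q: "finite Q" "Q \<subseteq> carrier \<Gamma>" using kp by (auto simp: kazhdan_pair_def)
  obtain c where c: "c \<in> Q" "c \<noteq> \<gamma>"
    using kazhdan_pair_not_cyclic[OF G kp \<gamma>] \<gamma>(1) by blast
  obtain \<alpha> where \<alpha>: "pmp_action \<Gamma> bernoulli_measure \<alpha>" "free_pmp_action \<Gamma> bernoulli_measure \<alpha>"
    "\<And>\<gamma>. \<lbrakk>\<gamma> \<in> carrier \<Gamma>; group.ord \<Gamma> \<gamma> = 0\<rbrakk> \<Longrightarrow> pmp_action.ergodic_element bernoulli_measure \<alpha> \<gamma>"
    using bernoulli_action[OF G] by blast
  have "{p \<in> space (bernoulli_measure \<Otimes>\<^sub>M bernoulli_measure). fst p = snd p} = {(x, y). x = y}"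
    by (auto simp: space_pair_measure)
  then have diag: "{p \<in> space (bernoulli_measure \<Otimes>\<^sub>M bernoulli_measure). fst p = snd p}
      \<in> sets (bernoulli_measure \<Otimes>\<^sub>M bernoulli_measure)"
    using diagonal_bernoulli by simp
  have "group_cost \<Gamma> \<le> cost_rel bernoulli_measure (orbit_relation \<Gamma> bernoulli_measure \<alpha>)"
    by (rule group_cost_le_any_type[OF standard_bernoulli \<alpha>(2)])
  also have "\<dots> \<le> ennreal (real (card Q) - \<epsilon>\<^sup>2 / 2)"
    by (rule pmp_action.cost_orbit_relation_le[OF \<alpha>(1) kp G(3) \<gamma>(1) _ c bernoulli_divisible diag])
       (use \<alpha>(3) \<gamma> Q in auto)
  finally have le: "group_cost \<Gamma> \<le> ennreal (real (card Q) - \<epsilon>\<^sup>2 / 2)" .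
  have "1 \<le> real (card Q)" using \<gamma>(1) Q(1) card_gt_0_iff[of Q] by (auto simp: Suc_leI)
  then have "0 \<le> real (card Q) - \<epsilon>\<^sup>2 / 2" using kazhdan_pair_square_le_2[OF G kp] by simp
  then have "enn2ereal (ennreal (real (card Q) - \<epsilon>\<^sup>2 / 2)) = ereal (real (card Q) - \<epsilon>\<^sup>2 / 2)"
    by (rule enn2ereal_ennreal)
  moreover have "enn2ereal (group_cost \<Gamma>) \<le> enn2ereal (ennreal (real (card Q) - \<epsilon>\<^sup>2 / 2))"
    using le by (simp add: less_eq_ennreal.rep_eq)
  ultimately show ?thesis by simp
qed

text \<open>
  In a torsion-free group a Kazhdan set with two elements contains an element of infinite order, so the bound passes to the
  supremum once there is such a pair.
\<close>

lemma group_cost_kazhdan_constant: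
  fixes \<Gamma> :: "('g, 'b) monoid_scheme" (structure)
  assumes G: "group \<Gamma>" "countable (carrier \<Gamma>)" "infinite (carrier \<Gamma>)" and T: "property_T \<Gamma>"
    and tf: "torsion_free_group \<Gamma>" and gen: "two_generated \<Gamma>"
  shows "enn2ereal (group_cost \<Gamma>) \<le> ereal (2 - (kazhdan_constant \<Gamma> 2)\<^sup>2 / 2)"
proof -
  interpret G: group \<Gamma> by fact
  let ?S = "{\<epsilon>. \<exists>Q. card Q = 2 \<and> kazhdan_pair \<Gamma> Q \<epsilon>}"
  have bound: "enn2ereal (group_cost \<Gamma>) \<le> ereal (2 - \<epsilon>\<^sup>2 / 2)" and pos: "\<epsilon> > 0" if e: "\<epsilon> \<in> ?S" for \<epsilon>
  proof -
    obtain Q where Q: "card Q = 2" "kazhdan_pair \<Gamma> Q \<epsilon>" using e by blast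
    then have Qc: "Q \<subseteq> carrier \<Gamma>" by (auto simp: kazhdan_pair_def)
    have "\<not> Q \<subseteq> {\<one>}" using card_mono[of "{\<one>}" Q] Q(1) by auto
    then obtain \<gamma> where \<gamma>: "\<gamma> \<in> Q" "\<gamma> \<noteq> \<one>" by blast
    then have "group.ord \<Gamma> \<gamma> = 0" using tf Qc by (auto simp: torsion_free_group_def)
    then show "enn2ereal (group_cost \<Gamma>) \<le> ereal (2 - \<epsilon>\<^sup>2 / 2)"
      using group_cost_kazhdan_pair[OF G Q(2) \<gamma>(1)] Q(1) by simp
    show "\<epsilon> > 0" using Q(2) by (simp add: kazhdan_pair_def)
  qed
  have "?S \<noteq> {}"
  proof -
    obtain a b where ab: "a \<in> carrier \<Gamma>" "b \<in> carrier \<Gamma>" "generate \<Gamma> {a, b} = carrier \<Gamma>"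
      using gen by (auto simp: two_generated_def)
    obtain Q where Q: "card Q = 2" "Q \<subseteq> carrier \<Gamma>" "generate \<Gamma> Q = carrier \<Gamma>"
    proof (cases "a = b")
      case False
      then show thesis using ab that[of "{a, b}"] by simp
    next
      case True
      \<comment> \<open>The identity serves as a second element.\<close>
      then have ga: "generate \<Gamma> {a} = carrier \<Gamma>" using ab by simp
      have "a \<noteq> \<one>"
      proof
        assume "a = \<one>"
        then have "carrier \<Gamma> = {\<one>}" using ga G.generate_one by simp
        then show False using G(3) by (metis finite.emptyI finite_insert)
      qed
      then have card: "card {a, \<one>} = 2" by simp
      have sub: "{a, \<one>} \<subseteq> carrier \<Gamma>" using ab(1) by simp
      have "generate \<Gamma> {a} \<subseteq> generate \<Gamma> {a, \<one>}" by (rule G.mono_generate) simp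
      then have "generate \<Gamma> {a, \<one>} = carrier \<Gamma>"
        unfolding ga using G.generate_incl[OF sub] by (rule subset_antisym[rotated])
      then show thesis by (rule that[OF card sub])
    qed
    have "finite Q" "Q \<noteq> {}" using Q(1) card_ge_0_finite[of Q] by auto
    then obtain \<epsilon> where "kazhdan_pair \<Gamma> Q \<epsilon>" using property_T_generating_set[OF G(1) T _ Q(2,3)] by blast
    then show ?thesis using Q(1) by blast
  qed
  then obtain \<epsilon>0 where e0: "\<epsilon>0 \<in> ?S" by blast
  have "enn2ereal (group_cost \<Gamma>) \<ge> 0" by simp
  then obtain C where C: "enn2ereal (group_cost \<Gamma>) = ereal C"
    using bound[OF e0] by (cases "enn2ereal (group_cost \<Gamma>)") auto
  have le: "\<epsilon> \<le> sqrt (2 * (2 - C))" if "\<epsilon> \<in> ?S" for \<epsilon>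
    using bound[OF that] unfolding C by (intro real_le_rsqrt) simp
  have "bdd_above ?S" using le by (intro bdd_aboveI) blast
  then have "\<epsilon>0 \<le> kazhdan_constant \<Gamma> 2" unfolding kazhdan_constant_def using e0 by (intro cSup_upper)
  then have "0 \<le> kazhdan_constant \<Gamma> 2" using pos[OF e0] by simp
  moreover have "kazhdan_constant \<Gamma> 2 \<le> sqrt (2 * (2 - C))"
    unfolding kazhdan_constant_def using \<open>?S \<noteq> {}\<close> le by (rule cSup_least)
  ultimately have "(kazhdan_constant \<Gamma> 2)\<^sup>2 \<le> (sqrt (2 * (2 - C)))\<^sup>2" by (intro power_mono)
  also have "\<dots> = 2 * (2 - C)"
    using le[OF e0] pos[OF e0] by (intro real_sqrt_pow2) (smt (verit) real_sqrt_lt_0_iff)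
  finally show ?thesis unfolding C by simp
qed

theorem theorem9:
  fixes \<Gamma> :: "('g, 'b) monoid_scheme"
  assumes "group \<Gamma>" and "countable (carrier \<Gamma>)" and "infinite (carrier \<Gamma>)" and "property_T \<Gamma>"
  shows "(\<forall>Q \<epsilon> n. kazhdan_pair \<Gamma> Q \<epsilon> \<and> (\<exists>\<gamma>\<in>Q. group.ord \<Gamma> \<gamma> = 0) \<and> card Q = n
            \<longrightarrow> enn2ereal (group_cost \<Gamma>) \<le> ereal (real n - \<epsilon>\<^sup>2 / 2)) \<and>
         (torsion_free_group \<Gamma> \<and> two_generated \<Gamma>
            \<longrightarrow> enn2ereal (group_cost \<Gamma>) \<le> ereal (2 - (kazhdan_constant \<Gamma> 2)\<^sup>2 / 2))"
  using group_cost_kazhdan_pair[OF assms(1-3)] group_cost_kazhdan_constant[OF assms] by blast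

end
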